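(* Let $\varepsilon>0$ be a constant. There exists a dynamic streaming tester for $1$-edge connectivity (i.e., connectivity) of graphs on vertex set $[n]$ that uses $\tilde{O}(n^{1-\varepsilon})$ space and post-processing time.
   Context: In the dynamic streaming model, the input graph on the fixed vertex set $[n]$ is defined by a sequence of edge insertions and deletions. For a graph property $\Pi$, a graph $G$ with $m$ edges is $\varepsilon$-far from having $\Pi$ if one has to modify (insert or delete) more than $\varepsilon m$ edges of $G$ to obtain a graph having $\Pi$. A dynamic streaming tester for $\Pi$ is an algorithm that makes a single pass over a stream of edge insertions and deletions and, with probability at least $2/3$, accepts every graph satisfying $\Pi$ and rejects every graph that is $\varepsilon$-far from having $\Pi$. Post-processing time is the time needed after the stream ends to produce the output. $\tilde{O}(g)$ hides $\mathrm{poly}\log$ factors (here $\mathrm{poly}\log n$).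
   Formalization: The bound n^(1-ε) is read as max(1, n^(1-ε)); this changes nothing for ε ≤ 1, while for ε > 1 the literal bound tends to 0 and no tester can use less than one bit of space and one step of time. *)

theory Defs
  imports "HOL-Probability.Probability" "HOL-Library.Landau_Symbols" "HOL-Library.Log_Nat"
begin

text \<open>A graph on the vertex set $[n]$ is given by its set of edges, each edge being a
  two-element subset of \<open>{1..n}\<close>.\<close>

definition edges_on :: "nat \<Rightarrow> nat set set" where
  "edges_on n = {{u, v} | u v. u \<in> {1..n} \<and> v \<in> {1..n} \<and> u \<noteq> v}"

definition connected_graph :: "nat \<Rightarrow> nat set set \<Rightarrow> bool" where
  "connected_graph n E \<longleftrightarrow> (\<forall>u\<in>{1..n}. \<forall>v\<in>{1..n}. (u, v) \<in> {(x, y). {x, y} \<in> E}\<^sup>*)"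

text \<open>The number of edge insertions and deletions that turn one edge set into another is the
  size of their symmetric difference.\<close>

definition far_from :: "(nat \<Rightarrow> nat set set \<Rightarrow> bool) \<Rightarrow> real \<Rightarrow> nat \<Rightarrow> nat set set \<Rightarrow> bool" where
  "far_from P \<epsilon> n E \<longleftrightarrow>
     (\<forall>E'. E' \<subseteq> edges_on n \<longrightarrow> P n E' \<longrightarrow> real (card ((E - E') \<union> (E' - E))) > \<epsilon> * real (card E))"

datatype edge_update = Insert nat nat | Delete nat nat

text \<open>The streamed graph stays simple: only absent edges are inserted and only present edges
  are deleted. The end points of an edge may be presented in either order.\<close>

fun valid_stream_from :: "nat \<Rightarrow> nat set set \<Rightarrow> edge_update list \<Rightarrow> bool" where
  "valid_stream_from n E [] \<longleftrightarrow> True"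
| "valid_stream_from n E (Insert u v # xs) \<longleftrightarrow>
     {u, v} \<in> edges_on n \<and> {u, v} \<notin> E \<and> valid_stream_from n (insert {u, v} E) xs"
| "valid_stream_from n E (Delete u v # xs) \<longleftrightarrow>
     {u, v} \<in> E \<and> valid_stream_from n (E - {{u, v}}) xs"

abbreviation valid_stream :: "nat \<Rightarrow> edge_update list \<Rightarrow> bool" where
  "valid_stream n xs \<equiv> valid_stream_from n {} xs"

fun apply_update :: "edge_update \<Rightarrow> nat set set \<Rightarrow> nat set set" where
  "apply_update (Insert u v) E = insert {u, v} E"
| "apply_update (Delete u v) E = E - {{u, v}}"

definition stream_graph :: "edge_update list \<Rightarrow> nat set set" where
  "stream_graph xs = fold apply_update xs {}"

text \<open>Algorithms are while-programs for a randomized word RAM with \<open>S\<close> memory words of \<open>w\<close> bits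
  each. Every value computed by an expression is reduced modulo \<open>2 ^ w\<close>; all data, including
  loop counters and stored random choices, live in the \<open>S\<close> words.\<close>

type_synonym memory = "nat \<Rightarrow> nat"

datatype binop = Plus | Minus | Times | Div | Mod | Less | Equal

datatype aexp = Const nat | Load aexp | Binop binop aexp aexp

fun eval_op :: "binop \<Rightarrow> nat \<Rightarrow> nat \<Rightarrow> nat" where
  "eval_op Plus x y = x + y"
| "eval_op Minus x y = x - y"
| "eval_op Times x y = x * y"
| "eval_op Div x y = x div y"
| "eval_op Mod x y = x mod y"
| "eval_op Less x y = (if x < y then 1 else 0)"
| "eval_op Equal x y = (if x = y then 1 else 0)"

fun eval :: "nat \<Rightarrow> aexp \<Rightarrow> memory \<Rightarrow> nat" where
  "eval w (Const k) m = k mod 2 ^ w"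
| "eval w (Load a) m = m (eval w a m)"
| "eval w (Binop f a b) m = eval_op f (eval w a m) (eval w b m) mod 2 ^ w"

text \<open>\<open>Store a e\<close> writes the value of \<open>e\<close> to the cell whose address is the value of \<open>a\<close>;
  \<open>Rand a e\<close> writes there a uniformly random number between 0 and the value of \<open>e\<close>, inclusive.\<close>

datatype com =
    Skip
  | Store aexp aexp
  | Rand aexp aexp
  | Seq com com
  | Cond aexp com com
  | While aexp com

text \<open>One time step. An attempt to write outside the \<open>S\<close> available words blocks, so that a program
  that halts has respected the space bound. Cells outside are never written and contain 0.
  Expressions in a program have constant size, so evaluating one is part of a single step.\<close>

primrec step :: "nat \<Rightarrow> nat \<Rightarrow> com \<Rightarrow> memory \<Rightarrow> (com \<times> memory) pmf" where
  "step w S Skip m = return_pmf (Skip, m)"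
| "step w S (Store a e) m =
     (if eval w a m < S then return_pmf (Skip, m(eval w a m := eval w e m))
      else return_pmf (Store a e, m))"
| "step w S (Rand a e) m =
     (if eval w a m < S
      then map_pmf (\<lambda>x. (Skip, m(eval w a m := x))) (pmf_of_set {..eval w e m})
      else return_pmf (Rand a e, m))"
| "step w S (Seq c d) m =
     (if c = Skip then return_pmf (d, m)
      else map_pmf (\<lambda>(c', m'). (Seq c' d, m')) (step w S c m))"
| "step w S (Cond e c d) m = return_pmf (if eval w e m \<noteq> 0 then c else d, m)"
| "step w S (While e c) m =
     return_pmf (if eval w e m \<noteq> 0 then Seq c (While e c) else Skip, m)"

primrec steps :: "nat \<Rightarrow> nat \<Rightarrow> nat \<Rightarrow> com \<times> memory \<Rightarrow> (com \<times> memory) pmf" where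
  "steps w S 0 cm = return_pmf cm"
| "steps w S (Suc t) cm = bind_pmf (step w S (fst cm) (snd cm)) (steps w S t)"

definition halts_within :: "nat \<Rightarrow> nat \<Rightarrow> nat \<Rightarrow> com \<Rightarrow> memory \<Rightarrow> bool" where
  "halts_within w S t c m \<longleftrightarrow> (\<forall>cm \<in> set_pmf (steps w S t (c, m)). fst cm = Skip)"

text \<open>Only meaningful if \<open>c\<close> halts within some number of steps for all random choices; the number of
  steps taken is then immaterial, as halted configurations do not change.\<close>

definition outcome :: "nat \<Rightarrow> nat \<Rightarrow> com \<Rightarrow> memory \<Rightarrow> memory pmf" where
  "outcome w S c m = map_pmf snd (steps w S (LEAST t. halts_within w S t c m) (c, m))"

text \<open>A streaming algorithm is a fixed program for all \<open>n\<close>: an initialization, a routine executed once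
  for each stream element in order, and the post-processing. Words have \<open>\<Theta>(log n)\<close> bits;
  \<open>floorlog 2 n\<close> is the length of the binary representation of \<open>n\<close>.\<close>

record stream_alg =
  word_factor :: nat
  init_prog :: com
  update_prog :: com
  post_prog :: com

definition word_size :: "stream_alg \<Rightarrow> nat \<Rightarrow> nat" where
  "word_size A n = word_factor A * floorlog 2 n"

text \<open>Cell 0 initially holds \<open>n\<close>; cells 1 to 3 receive each stream element.\<close>

definition start_memory :: "nat \<Rightarrow> memory" where
  "start_memory n = (\<lambda>_. 0)(0 := n)"

fun feed :: "edge_update \<Rightarrow> memory \<Rightarrow> memory" where
  "feed (Insert u v) m = m(1 := 1, 2 := u, 3 := v)"
| "feed (Delete u v) m = m(1 := 0, 2 := u, 3 := v)"

definition memory_after :: "stream_alg \<Rightarrow> nat \<Rightarrow> nat \<Rightarrow> edge_update list \<Rightarrow> memory pmf" where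
  "memory_after A S n xs =
     foldl (\<lambda>p x. bind_pmf p (\<lambda>m. outcome (word_size A n) S (update_prog A) (feed x m)))
       (outcome (word_size A n) S (init_prog A) (start_memory n)) xs"

text \<open>Cell 0 holds the verdict at the end; nonzero means accept.\<close>

definition verdict :: "stream_alg \<Rightarrow> nat \<Rightarrow> nat \<Rightarrow> edge_update list \<Rightarrow> bool pmf" where
  "verdict A S n xs =
     bind_pmf (memory_after A S n xs)
       (\<lambda>m. map_pmf (\<lambda>m'. m' 0 \<noteq> 0) (outcome (word_size A n) S (post_prog A) m))"

text \<open>On streams over \<open>n\<close> vertices the algorithm works with \<open>S\<close> words and takes at most \<open>T\<close>
  post-processing steps, for all outcomes of its random choices. The memory has to
  contain the four interface cells.\<close>

definition runs_within :: "stream_alg \<Rightarrow> nat \<Rightarrow> nat \<Rightarrow> nat \<Rightarrow> bool" where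
  "runs_within A n S T \<longleftrightarrow>
     4 \<le> S \<and> 0 < word_factor A \<and>
     (\<exists>t. halts_within (word_size A n) S t (init_prog A) (start_memory n)) \<and>
     (\<forall>xs x. valid_stream n (xs @ [x]) \<longrightarrow> (\<forall>m \<in> set_pmf (memory_after A S n xs).
        \<exists>t. halts_within (word_size A n) S t (update_prog A) (feed x m))) \<and>
     (\<forall>xs. valid_stream n xs \<longrightarrow> (\<forall>m \<in> set_pmf (memory_after A S n xs).
        halts_within (word_size A n) S T (post_prog A) m))"

definition dynamic_streaming_tester ::
  "(nat \<Rightarrow> nat set set \<Rightarrow> bool) \<Rightarrow> real \<Rightarrow> stream_alg \<Rightarrow> (nat \<Rightarrow> nat) \<Rightarrow> (nat \<Rightarrow> nat) \<Rightarrow> bool" where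
  "dynamic_streaming_tester P \<epsilon> A S T \<longleftrightarrow>
     (\<forall>n\<ge>1. runs_within A n (S n) (T n) \<and>
        (\<forall>xs. valid_stream n xs \<longrightarrow>
           (P n (stream_graph xs) \<longrightarrow> pmf (verdict A (S n) n xs) True \<ge> 2 / 3) \<and>
           (far_from P \<epsilon> n (stream_graph xs) \<longrightarrow> pmf (verdict A (S n) n xs) False \<ge> 2 / 3)))"

definition space_bits :: "stream_alg \<Rightarrow> (nat \<Rightarrow> nat) \<Rightarrow> nat \<Rightarrow> nat" where
  "space_bits A S n = S n * word_size A n"

definition soft_O :: "(nat \<Rightarrow> real) \<Rightarrow> (nat \<Rightarrow> real) set" where
  "soft_O g = {f. \<exists>k::nat. f \<in> O(\<lambda>n. g n * ln (real n) ^ k)}"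

end

theory Submission
  imports Defs
begin

text \<open>
  If a graph with at least \<open>n - 1\<close> edges is \<open>\<epsilon>\<close>-far from connected, then it has more than \<open>\<epsilon> n\<close>
  components, hence \<open>\<Omega>(n)\<close> components of size at most \<open>k = \<lfloor>1/\<epsilon>\<rfloor>\<close>. The vertices are divided into blocks
  of length \<open>q \<approx> n powr (1/k)\<close>, up to a constant factor, and from each block one uniformly random
  vertex is drawn for each of \<open>k\<close> colours, independently in each of \<open>M\<close> groups. A component of size
  \<open>s \<le> k\<close> is caught by a group, its \<open>b\<close>-th vertex having colour \<open>b\<close> and no other one, with
  probability about \<open>q powr (-s)\<close>. Vertices in different blocks are drawn independently and vertices of
  one block exclude each other, so the second moment method shows that some component is caught with
  probability at least \<open>2/3\<close>.

  For each sampled vertex a linear sketch records its degree and, for each colour, the sum of \<open>n + v\<close>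
  over its neighbours \<open>v\<close> sampled with that colour; this sum tells whether there is exactly one such
  neighbour, and which. A caught component is recovered from its vertex of colour 0 by exploration. That
  a recovered set has no outgoing edges is certified by comparing degrees, so a connected graph is never
  rejected.
\<close>

text \<open>Distance is measured relative to the number m of edges, which forces a separate
  treatment of sparse graphs: having fewer than n - 1 edges already proves disconnectedness, and
  from n - 1 edges on, \<epsilon>m is at least \<epsilon>(n - 1). Stored random choices count as
  space, so independent random bits for every vertex are out of reach. One draw per block takes one
  word, about n powr (1 - 1/k) blocks are needed, and draws in different blocks remain fully
  independent, so the pairwise bound of the second moment method holds up to a constant. With
  \<open>q ^ k\<close> of order n, one group catches a fixed small component with probability of
  order at least 1/n; linearly many components and a constant number M of groups raise the
  expectation to 3. Since k and M depend on \<epsilon> only, groups, colours and exploration rounds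
  are unrolled into expressions of fixed size, and post-processing is one loop over the blocks. All
  randomness is spent before the stream arrives; the rest is deterministic, so the analysis fixes
  the draws and follows the memory.\<close>

lemma mult_add_less:
  fixes i a r N :: nat
  assumes "i < r" "a < N"
  shows "i * N + a < r * N"
proof -
  have "(i + 1) * N \<le> r * N" using assms(1) by (intro mult_le_mono1) simp
  then show ?thesis using assms(2) by simp
qed

lemma mult_add_div: "(a::nat) < N \<Longrightarrow> (i * N + a) div N = i"
  by simp

lemma mult_add_eq_iff:
  fixes i a i' a' N :: nat
  assumes "a < N" "a' < N"
  shows "i * N + a = i' * N + a' \<longleftrightarrow> i = i' \<and> a = a'"
proof
  assume eq: "i * N + a = i' * N + a'"
  then have "i = i'" using mult_add_div[OF assms(1), of i] mult_add_div[OF assms(2), of i'] by simp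
  then show "i = i' \<and> a = a'" using eq by simp
qed simp

section \<open>Execution of programs\<close>

text \<open>One equation records halting under all random choices, a time bound and the exact law of
  the final memory. As \<open>Skip\<close> is a fixed point of \<open>step\<close>, \<open>t\<close>
  acts as an upper bound.\<close>

definition yields :: "nat \<Rightarrow> nat \<Rightarrow> nat \<Rightarrow> com \<Rightarrow> memory \<Rightarrow> memory pmf \<Rightarrow> bool" where
  "yields w S t c m P \<longleftrightarrow> steps w S t (c, m) = map_pmf (Pair Skip) P"

lemma steps_Skip: "steps w S t (Skip, m) = return_pmf (Skip, m)"
  by (induction t) (auto simp: bind_return_pmf)

lemma steps_add: "steps w S (s + t) cm = bind_pmf (steps w S s cm) (steps w S t)"
proof (induction s arbitrary: cm)
  case (Suc s)
  have "steps w S (s + t) = (\<lambda>cm. bind_pmf (steps w S s cm) (steps w S t))"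
    by (rule ext) (rule Suc)
  then show ?case by (simp add: bind_assoc_pmf)
qed (simp add: bind_return_pmf)

lemma yields_mono:
  assumes "yields w S s c m P" "s \<le> t"
  shows "yields w S t c m P"
proof -
  have "steps w S t (c, m) = bind_pmf (map_pmf (Pair Skip) P) (steps w S (t - s))"
    using assms steps_add[of w S s "t - s" "(c, m)"] by (simp add: yields_def)
  also have "\<dots> = bind_pmf P (\<lambda>x. return_pmf (Skip, x))"
    by (simp add: bind_map_pmf steps_Skip)
  finally show ?thesis by (simp add: yields_def map_pmf_def)
qed

lemma yields_halts: "yields w S t c m P \<Longrightarrow> halts_within w S t c m"
  by (auto simp: yields_def halts_within_def)

lemma halts_yields:
  assumes "halts_within w S t c m"
  shows "yields w S t c m (map_pmf snd (steps w S t (c, m)))"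
proof -
  have "map_pmf (Pair Skip \<circ> snd) (steps w S t (c, m)) = map_pmf id (steps w S t (c, m))"
    using assms by (intro map_pmf_cong) (auto simp: halts_within_def prod_eq_iff)
  then show ?thesis by (simp add: yields_def map_pmf_comp o_def pmf.map_id)
qed

lemma yields_unique:
  assumes "yields w S t c m P" "yields w S t c m Q"
  shows "P = Q"
proof -
  have "map_pmf snd (map_pmf (Pair Skip) P) = map_pmf snd (map_pmf (Pair Skip) Q)"
    using assms by (simp add: yields_def)
  then show ?thesis by (simp add: map_pmf_comp)
qed

text \<open>The least halting time is at most \<open>t\<close> and halted configurations stay put,
  so the law read off at that time is the one at time \<open>t\<close>. Later arguments never have
  to determine the least halting time.\<close>

lemma yields_outcome:
  assumes "yields w S t c m P"
  shows "outcome w S c m = P"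
proof -
  define l where "l = (LEAST t. halts_within w S t c m)"
  have "halts_within w S l c m" "l \<le> t"
    unfolding l_def using yields_halts[OF assms] by (auto intro: LeastI Least_le)
  then have "yields w S t c m (map_pmf snd (steps w S l (c, m)))"
    using halts_yields yields_mono by blast
  then show ?thesis
    using assms yields_unique unfolding outcome_def l_def by blast
qed

lemma yields_Skip: "yields w S 0 Skip m (return_pmf m)"
  by (simp add: yields_def)

lemma yields_Store:
  assumes "eval w a m < S"
  shows "yields w S 1 (Store a e) m (return_pmf (m(eval w a m := eval w e m)))"
  using assms by (simp add: yields_def bind_return_pmf)

lemma yields_Rand:
  assumes "eval w a m < S"
  shows "yields w S 1 (Rand a e) m
    (map_pmf (\<lambda>x. m(eval w a m := x)) (pmf_of_set {..eval w e m}))"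
proof -
  have "steps w S 0 = return_pmf" by (rule ext) simp
  then show ?thesis using assms by (simp add: yields_def bind_return_pmf' map_pmf_comp)
qed

text \<open>Induction on the time of \<open>c\<close>. The extra step discards the finished
  \<open>Skip\<close>. Since \<open>c\<close> may finish early, \<open>c = Skip\<close> is treated
  apart in the induction step and the run is padded by \<open>yields_mono\<close>.\<close>

lemma yields_Seq:
  assumes "yields w S s c m P" "\<And>m'. m' \<in> set_pmf P \<Longrightarrow> yields w S t d m' (Q m')"
  shows "yields w S (s + t + 1) (Seq c d) m (bind_pmf P Q)"
  using assms
proof (induction s arbitrary: c m P)
  case 0
  then have "return_pmf (c, m) = map_pmf (Pair Skip) P" by (simp add: yields_def)
  then have "set_pmf (return_pmf (c, m)) = Pair Skip ` set_pmf P" by (metis set_map_pmf)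
  then have c: "c = Skip" and "set_pmf P = {m}" by auto
  then have P: "P = return_pmf m" by (simp add: set_pmf_subset_singleton[symmetric])
  show ?case
    using 0(2)[of m] by (simp add: c P yields_def bind_return_pmf)
next
  case (Suc s)
  show ?case
  proof (cases "c = Skip")
    case True
    then have "map_pmf (Pair Skip) P = map_pmf (Pair Skip) (return_pmf m)"
      using Suc.prems(1) steps_Skip[of w S "Suc s" m] by (simp only: yields_def map_return_pmf)
    then have P: "P = return_pmf m"
      using yields_unique[of w S "Suc s" Skip m P "return_pmf m"] True Suc.prems(1)
      by (simp add: yields_def)
    have "yields w S (s + t + 1) d m (Q m)"
      using Suc.prems(2)[of m] yields_mono by (auto simp: P)
    then show ?thesis
      by (simp add: yields_def True P bind_return_pmf)
  next
    case False
    \<comment> \<open>Splits \<open>P\<close> along the first step of \<open>c\<close>: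
      \<open>P' cm\<close> is the law of the final memory once \<open>cm\<close> is reached. Halting
      is inherited because the runs from \<open>cm\<close> continue runs from
      \<open>(c, m)\<close>.\<close>
    define P' where "P' = (\<lambda>cm. map_pmf snd (steps w S s cm))"
    have sub: "yields w S s (fst cm) (snd cm) (P' cm)" if "cm \<in> set_pmf (step w S c m)" for cm
    proof -
      have "set_pmf (steps w S s cm) \<subseteq> set_pmf (steps w S (Suc s) (c, m))"
        using that by auto
      then have "halts_within w S s (fst cm) (snd cm)"
        using yields_halts[OF Suc.prems(1)] unfolding halts_within_def prod.collapse by blast
      then show ?thesis unfolding P'_def using halts_yields by fastforce
    qed
    have P: "P = bind_pmf (step w S c m) P'"
    proof -
      have "map_pmf snd (steps w S (Suc s) (c, m)) = map_pmf snd (map_pmf (Pair Skip) P)"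
        using Suc.prems(1) by (simp add: yields_def)
      then show ?thesis by (simp add: map_pmf_comp map_bind_pmf P'_def)
    qed
    have "steps w S (Suc s + t + 1) (Seq c d, m) =
      bind_pmf (step w S c m) (\<lambda>cm. steps w S (s + t + 1) (Seq (fst cm) d, snd cm))"
      using False by (simp add: bind_map_pmf case_prod_beta)
    also have "\<dots> = bind_pmf (step w S c m) (\<lambda>cm. map_pmf (Pair Skip) (bind_pmf (P' cm) Q))"
    proof (intro bind_pmf_cong refl)
      fix cm assume cm: "cm \<in> set_pmf (step w S c m)"
      have "yields w S (s + t + 1) (Seq (fst cm) d) (snd cm) (bind_pmf (P' cm) Q)"
        using cm by (intro Suc.IH[OF sub] Suc.prems(2)) (auto simp: P)
      then show "steps w S (s + t + 1) (Seq (fst cm) d, snd cm)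
          = map_pmf (Pair Skip) (bind_pmf (P' cm) Q)"
        by (simp add: yields_def)
    qed
    finally show ?thesis
      by (simp add: yields_def P map_bind_pmf bind_assoc_pmf)
  qed
qed

lemma yields_Seq_det:
  assumes "yields w S s c m (return_pmf m')" "yields w S t d m' Q"
  shows "yields w S (s + t + 1) (Seq c d) m Q"
  using yields_Seq[of w S s c m "return_pmf m'" t d "\<lambda>_. Q"] assms by (simp add: bind_return_pmf)

lemma yields_While_end:
  assumes "eval w e m = 0"
  shows "yields w S 1 (While e c) m (return_pmf m)"
  using assms by (simp add: yields_def bind_return_pmf)

text \<open>The two extra steps are the test that unfolds the loop and the removal of the finished
  body.\<close>

lemma yields_While_step:
  assumes "eval w e m \<noteq> 0" "yields w S s c m P"
    "\<And>m'. m' \<in> set_pmf P \<Longrightarrow> yields w S t (While e c) m' (Q m')"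
  shows "yields w S (s + t + 2) (While e c) m (bind_pmf P Q)"
proof -
  have "yields w S (s + t + 1) (Seq c (While e c)) m (bind_pmf P Q)"
    using assms(2,3) by (rule yields_Seq)
  then show ?thesis using assms(1) by (simp add: yields_def bind_return_pmf)
qed

lemma yields_While_step_det:
  assumes "eval w e m \<noteq> 0" "yields w S s c m (return_pmf m')" "yields w S t (While e c) m' Q"
  shows "yields w S (s + t + 2) (While e c) m Q"
  using yields_While_step[of w e m S s c "return_pmf m'" t "\<lambda>_. Q"] assms
  by (simp add: bind_return_pmf)

section \<open>Simultaneous assignment by a sequence of stores\<close>

definition stores :: "(aexp \<times> aexp) list \<Rightarrow> com" where
  "stores ps = foldr (\<lambda>(a, e) c. Seq (Store a e) c) ps Skip"

text \<open>If no store affects the operands of another one, then the stores of a list act as if they were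
  executed simultaneously.\<close>

lemma yields_stores:
  assumes "distinct ps" "inj_on ad (set ps)" "\<And>p. p \<in> set ps \<Longrightarrow> ad p < S"
    and "\<And>p m'. p \<in> set ps \<Longrightarrow> m' (ad p) = m (ad p) \<Longrightarrow>
      (\<And>z. z \<notin> ad ` set ps \<Longrightarrow> m' z = m z) \<Longrightarrow> eval w (ae p) m' = ad p \<and> eval w (ve p) m' = vl p"
  shows "\<exists>m'. yields w S (2 * length ps) (stores (map (\<lambda>p. (ae p, ve p)) ps)) m (return_pmf m') \<and>
    (\<forall>p\<in>set ps. m' (ad p) = vl p) \<and> (\<forall>z. z \<notin> ad ` set ps \<longrightarrow> m' z = m z)"
  using assms
proof (induction ps arbitrary: m)
  case Nil
  then show ?case using yields_Skip by (auto simp: stores_def)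
next
  case (Cons p ps)
  define m1 where "m1 = m(ad p := vl p)"
  have ev: "eval w (ae p) m = ad p" "eval w (ve p) m = vl p"
    using Cons.prems(4)[of p m] by auto
  have 1: "yields w S 1 (Store (ae p) (ve p)) m (return_pmf m1)"
    using yields_Store[of w "ae p" m S "ve p"] Cons.prems(3)[of p] by (simp add: ev m1_def)
  have notin: "ad p \<notin> ad ` set ps"
    using Cons.prems(1,2) by auto
  have "\<exists>m'. yields w S (2 * length ps) (stores (map (\<lambda>p. (ae p, ve p)) ps)) m1 (return_pmf m') \<and>
    (\<forall>p\<in>set ps. m' (ad p) = vl p) \<and> (\<forall>z. z \<notin> ad ` set ps \<longrightarrow> m' z = m1 z)"
  proof (rule Cons.IH)
    fix p' m' assume p': "p' \<in> set ps" "m' (ad p') = m1 (ad p')"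
      and ag: "\<And>z. z \<notin> ad ` set ps \<Longrightarrow> m' z = m1 z"
    show "eval w (ae p') m' = ad p' \<and> eval w (ve p') m' = vl p'"
    proof (rule Cons.prems(4))
      show "m' (ad p') = m (ad p')" using p' notin by (metis fun_upd_other imageI m1_def)
      show "m' z = m z" if "z \<notin> ad ` set (p # ps)" for z
        using ag[of z] that by (auto simp: m1_def)
    qed (use p' in simp)
  qed (use Cons.prems in auto)
  then obtain m' where m': "yields w S (2 * length ps) (stores (map (\<lambda>p. (ae p, ve p)) ps)) m1 (return_pmf m')"
    "\<forall>p\<in>set ps. m' (ad p) = vl p" "\<forall>z. z \<notin> ad ` set ps \<longrightarrow> m' z = m1 z" by blast
  have "yields w S (1 + 2 * length ps + 1) (stores (map (\<lambda>p. (ae p, ve p)) (p # ps))) m (return_pmf m')"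
    using yields_Seq_det[OF 1 m'(1)] by (simp add: stores_def)
  moreover have "\<forall>p\<in>set (p # ps). m' (ad p) = vl p"
    using m'(2,3) notin by (auto simp: m1_def)
  moreover have "\<forall>z. z \<notin> ad ` set (p # ps) \<longrightarrow> m' z = m z"
    using m'(3) by (auto simp: m1_def)
  ultimately show ?case by auto
qed

section \<open>Components of graphs\<close>

text \<open>An edge becomes two ordered pairs. The sketch is kept per end point, so an update can be
  treated as two one-sided changes with an asymmetric relation in between.\<close>

definition arcs :: "nat set set \<Rightarrow> (nat \<times> nat) set" where
  "arcs E = {(x, y). {x, y} \<in> E}"

text \<open>Confined to the vertex set: the reflexive closure lives on all naturals, and the
  restriction is an equivalence on \<open>{1..n}\<close> whose quotient gives the
  components.\<close>

definition reach :: "nat \<Rightarrow> nat set set \<Rightarrow> (nat \<times> nat) set" where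
  "reach n E = {(u, v). u \<in> {1..n} \<and> v \<in> {1..n} \<and> (u, v) \<in> (arcs E)\<^sup>*}"

definition graph_components :: "nat \<Rightarrow> nat set set \<Rightarrow> nat set set" where
  "graph_components n E = {1..n} // reach n E"

lemma connected_graph_iff_arcs:
  "connected_graph n E \<longleftrightarrow> (\<forall>u\<in>{1..n}. \<forall>v\<in>{1..n}. (u, v) \<in> (arcs E)\<^sup>*)"
  by (simp add: connected_graph_def arcs_def)

lemma arcs_sym: "(u, v) \<in> arcs E \<longleftrightarrow> (v, u) \<in> arcs E"
  by (simp add: arcs_def insert_commute)

lemma rtrancl_arcs_sym: "(u, v) \<in> (arcs E)\<^sup>* \<Longrightarrow> (v, u) \<in> (arcs E)\<^sup>*"
  by (meson arcs_sym sym_rtrancl symD symI)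

lemma edges_onD:
  assumes "{u, v} \<in> edges_on n"
  shows "u \<in> {1..n}" "v \<in> {1..n}" "u \<noteq> v"
  using assms by (auto simp: edges_on_def doubleton_eq_iff)

lemma finite_edges_on: "finite (edges_on n)"
  by (rule finite_subset[of _ "Pow {1..n}"]) (auto simp: edges_on_def)

lemma card_edges_le:
  assumes "E \<subseteq> edges_on n"
  shows "card E \<le> n * n"
proof -
  have "edges_on n \<subseteq> (\<lambda>(u, v). {u, v}) ` ({1..n} \<times> {1..n})"
    by (auto simp: edges_on_def image_iff Bex_def)
  then have "E \<subseteq> (\<lambda>(u, v). {u, v}) ` ({1..n} \<times> {1..n})"
    using assms by (rule order.trans[rotated])
  then show ?thesis using surj_card_le[of "{1..n} \<times> {1..n}" E] by simp
qed

lemma arcs_subset: "E \<subseteq> edges_on n \<Longrightarrow> arcs E \<subseteq> {1..n} \<times> {1..n}"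
  using edges_onD by (fastforce simp: arcs_def)

text \<open>Every vertex other than 1 is assigned an edge to a vertex strictly closer to 1. Two
  vertices cannot share this edge, as each would then be closer than the other. This makes it safe
  to reject graphs with fewer than \<open>n - 1\<close> edges.\<close>

lemma connected_graph_card_edges:
  assumes conn: "connected_graph n E" and E: "E \<subseteq> edges_on n"
  shows "n \<le> card E + 1"
proof (cases "n = 0")
  case False
  define d where "d v = (LEAST t. (1, v) \<in> arcs E ^^ t)" for v
  have d: "(1, v) \<in> arcs E ^^ d v" if "v \<in> {1..n}" for v
  proof -
    have "(1, v) \<in> (arcs E)\<^sup>*"
      using conn that False by (auto simp: connected_graph_iff_arcs)
    then show ?thesis unfolding d_def by (meson LeastI rtrancl_imp_relpow)
  qed
  have "\<exists>u. {v, u} \<in> E \<and> d u < d v" if "v \<in> {2..n}" for v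
  proof -
    have "d v \<noteq> 0" using d[of v] that by (intro notI) auto
    then obtain t where t: "d v = Suc t" by (cases "d v") auto
    have "(1, v) \<in> arcs E ^^ Suc t"
      using d[of v] that unfolding t by simp
    then obtain u where u: "(1, u) \<in> arcs E ^^ t" "(u, v) \<in> arcs E"
      by (rule relpow_Suc_E)
    have "d u \<le> t" unfolding d_def using u(1) by (rule Least_le)
    then show ?thesis using u(2) t by (auto simp: arcs_def insert_commute)
  qed
  then obtain p where p: "\<And>v. v \<in> {2..n} \<Longrightarrow> {v, p v} \<in> E \<and> d (p v) < d v" by metis
  have "inj_on (\<lambda>v. {v, p v}) {2..n}"
  proof (rule inj_onI)
    fix v v' assume "v \<in> {2..n}" "v' \<in> {2..n}" "{v, p v} = {v', p v'}"
    then show "v = v'" using p[of v] p[of v'] by (auto simp: doubleton_eq_iff)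
  qed
  then have "card {2..n} \<le> card E"
    using p E finite_edges_on by (intro card_inj_on_le[of "\<lambda>v. {v, p v}"]) (auto intro: finite_subset)
  then show ?thesis by simp
qed simp

lemma equiv_reach: "equiv {1..n} (reach n E)"
  by (rule equivI) (auto simp: reach_def refl_on_def sym_def trans_def dest: rtrancl_arcs_sym intro: rtrancl_trans)

lemma Union_components: "\<Union> (graph_components n E) = {1..n}"
  unfolding graph_components_def by (rule Union_quotient[OF equiv_reach])

lemma finite_components: "finite (graph_components n E)"
  using Union_components[of n E] by (metis finite_UnionD finite_atLeastAtMost)

lemma components_disjoint:
  "C \<in> graph_components n E \<Longrightarrow> C' \<in> graph_components n E \<Longrightarrow> C \<noteq> C' \<Longrightarrow> C \<inter> C' = {}"
  unfolding graph_components_def using quotient_disj[OF equiv_reach] by blast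

lemma component_nonempty: "C \<in> graph_components n E \<Longrightarrow> C \<noteq> {}"
  unfolding graph_components_def using in_quotient_imp_non_empty[OF equiv_reach] by blast

lemma component_subset: "C \<in> graph_components n E \<Longrightarrow> C \<subseteq> {1..n}"
  using Union_components by blast

lemma finite_component: "C \<in> graph_components n E \<Longrightarrow> finite C"
  by (rule finite_subset[OF component_subset]) auto

lemma card_component: "C \<in> graph_components n E \<Longrightarrow> 1 \<le> card C"
  using component_nonempty finite_component by (simp add: Suc_le_eq card_gt_0_iff)

lemma component_reach:
  assumes "C \<in> graph_components n E" "u \<in> C" "v \<in> C"
  shows "(u, v) \<in> (arcs E)\<^sup>*"
  using quotient_eq_iff[OF equiv_reach, of C n E C u v] assms
  by (auto simp: graph_components_def reach_def)

lemma component_closed: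
  assumes "C \<in> graph_components n E" "E \<subseteq> edges_on n" "u \<in> C" "(u, v) \<in> arcs E"
  shows "v \<in> C"
proof -
  have "(u, v) \<in> reach n E"
    using arcs_subset[OF assms(2)] assms(4) by (auto simp: reach_def)
  then show ?thesis
    using assms(1,3) in_quotient_imp_closed[OF equiv_reach] unfolding graph_components_def by blast
qed

lemma sum_card_components: "(\<Sum>C\<in>graph_components n E. card C) = n"
proof -
  have "card (\<Union> (graph_components n E)) = (\<Sum>C\<in>graph_components n E. card C)"
    using components_disjoint finite_component
    by (intro card_Union_disjoint) (auto simp: pairwise_def disjnt_def)
  then show ?thesis by (simp add: Union_components)
qed

text \<open>Joining one representative of each component to a fixed one makes the graph connected.\<close>

lemma far_from_connected_components:
  assumes far: "far_from connected_graph \<epsilon> n E" and E: "E \<subseteq> edges_on n" and n: "n \<ge> 1"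
  shows "real (card (graph_components n E)) > \<epsilon> * real (card E) + 1"
proof -
  define Q where "Q = graph_components n E"
  define rep where "rep C = (SOME v. v \<in> C)" for C :: "nat set"
  have rep: "rep C \<in> C" if "C \<in> Q" for C
    using component_nonempty that unfolding Q_def rep_def by (simp add: some_in_eq)
  obtain C0 where C0: "C0 \<in> Q"
    using Union_components[of n E] n unfolding Q_def by fastforce
  define F where "F = (\<lambda>C. {rep C0, rep C}) ` (Q - {C0})"
  have rep_in: "rep C \<in> {1..n}" if "C \<in> Q" for C
    using rep that component_subset unfolding Q_def by blast
  have rep_ne: "rep C \<noteq> rep C0" if "C \<in> Q" "C \<noteq> C0" for C
    using rep[OF that(1)] rep[OF C0] components_disjoint[of C n E C0] that C0 unfolding Q_def by auto
  have F: "F \<subseteq> edges_on n"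
  proof
    fix e assume "e \<in> F"
    then obtain C where C: "C \<in> Q" "C \<noteq> C0" "e = {rep C0, rep C}" by (auto simp: F_def)
    then show "e \<in> edges_on n"
      using rep_in[OF C0] rep_in[OF C(1)] rep_ne[OF C(1,2)]
      unfolding edges_on_def C(3) by (intro CollectI exI[of _ "rep C0"] exI[of _ "rep C"]) auto
  qed
  have mono: "(arcs E)\<^sup>* \<subseteq> (arcs (E \<union> F))\<^sup>*"
    by (intro rtrancl_mono) (auto simp: arcs_def)
  have to_root: "(u, rep C0) \<in> (arcs (E \<union> F))\<^sup>*" if u: "u \<in> {1..n}" for u
  proof -
    obtain C where C: "C \<in> Q" "u \<in> C"
      using Union_components[of n E] u unfolding Q_def by blast
    have "(u, rep C) \<in> (arcs (E \<union> F))\<^sup>*"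
      using component_reach[OF _ C(2) rep[OF C(1)]] C(1) mono unfolding Q_def by (intro subsetD[OF mono]) auto
    moreover have "(rep C, rep C0) \<in> (arcs (E \<union> F))\<^sup>*"
    proof (cases "C = C0")
      case False
      then have "(rep C, rep C0) \<in> arcs (E \<union> F)"
        using C by (auto simp: arcs_def F_def insert_commute)
      then show ?thesis by blast
    qed simp
    ultimately show ?thesis by (rule rtrancl_trans)
  qed
  have "connected_graph n (E \<union> F)"
    unfolding connected_graph_iff_arcs
  proof (intro ballI)
    fix u v assume "u \<in> {1..n}" "v \<in> {1..n}"
    then show "(u, v) \<in> (arcs (E \<union> F))\<^sup>*"
      by (intro rtrancl_trans[OF to_root rtrancl_arcs_sym[OF to_root]])
  qed
  then have "real (card ((E - (E \<union> F)) \<union> ((E \<union> F) - E))) > \<epsilon> * real (card E)"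
    using far E F unfolding far_from_def by blast
  moreover have "card ((E - (E \<union> F)) \<union> ((E \<union> F) - E)) \<le> card F"
    using finite_subset[OF F finite_edges_on] by (intro card_mono) auto
  moreover have "card F \<le> card (Q - {C0})"
    unfolding F_def using finite_components Q_def by (intro card_image_le) auto
  moreover have "card (Q - {C0}) + 1 = card Q"
    using card_Suc_Diff1[OF finite_components[of n E], of C0] C0 by (simp add: Q_def)
  ultimately show ?thesis unfolding Q_def by linarith
qed

section \<open>Many small components in a far graph\<close>

text \<open>A component with more than \<open>k\<close> vertices contributes at least
  \<open>k + 1\<close> to \<open>n\<close>; a small one contributes at least 1 and is topped up by
  \<open>k\<close>. Summation over all components gives the bound.\<close>

lemma small_components_bound:
  "(k + 1) * card (graph_components n E) \<le> k * card {C \<in> graph_components n E. card C \<le> k} + n"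
proof -
  define Q where "Q = graph_components n E"
  have fin: "finite Q" by (simp add: Q_def finite_components)
  have pos: "1 \<le> card C" if "C \<in> Q" for C
    using card_component that by (simp add: Q_def)
  have "(k + 1) * card Q = (\<Sum>C\<in>Q. k + 1)" by simp
  also have "\<dots> \<le> (\<Sum>C\<in>Q. (if card C \<le> k then k else 0) + card C)"
    using pos by (intro sum_mono) auto
  also have "\<dots> = k * card {C \<in> Q. card C \<le> k} + n"
    using sum_card_components[of n E] fin
    by (simp add: sum.distrib Q_def[symmetric] sum.inter_filter[symmetric])
  finally show ?thesis by (simp add: Q_def)
qed

text \<open>There are at most \<open>n\<close> components, so the lower bound \<epsilon>(n - 1) + 1
  on their number forces \<epsilon> < 1, and then this bound exceeds \<epsilon>n. The second part
  inserts this into \<open>small_components_bound\<close>.\<close>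

lemma many_small_components:
  assumes far: "far_from connected_graph \<epsilon> n E" and E: "E \<subseteq> edges_on n" and n: "n \<ge> 1"
    and m: "n \<le> card E + 1" and \<epsilon>: "\<epsilon> > 0" and k: "k \<ge> 1"
  shows "\<epsilon> < 1"
    and "((real k + 1) * \<epsilon> - 1) * real n \<le> real k * real (card {C \<in> graph_components n E. card C \<le> k})"
proof -
  define c where "c = card (graph_components n E)"
  have "\<epsilon> * (real n - 1) \<le> \<epsilon> * real (card E)"
    using m \<epsilon> by (intro mult_left_mono) auto
  then have c: "real c > \<epsilon> * (real n - 1) + 1"
    using far_from_connected_components[OF far E n] unfolding c_def by linarith
  have "(\<Sum>C\<in>graph_components n E. 1) \<le> (\<Sum>C\<in>graph_components n E. card C)"
    by (rule sum_mono) (rule card_component)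
  then have "real c \<le> real n" by (simp add: sum_card_components c_def)
  then have "\<epsilon> * (real n - 1) + 1 < real n" using c by (rule less_le_trans[rotated])
  moreover have "1 * (real n - 1) \<le> \<epsilon> * (real n - 1)" if "\<epsilon> \<ge> 1"
    using that n by (intro mult_right_mono) auto
  ultimately show \<epsilon>1: "\<epsilon> < 1" by (cases "\<epsilon> < 1") auto
  have "\<epsilon> * real n \<le> real c" using c \<epsilon>1 by (simp add: algebra_simps)
  then have "(real k + 1) * (\<epsilon> * real n) \<le> (real k + 1) * real c" by (intro mult_left_mono) auto
  also have "\<dots> \<le> real k * real (card {C \<in> graph_components n E. card C \<le> k}) + real n"
    using small_components_bound[of k n E]
    unfolding c_def by (simp flip: of_nat_mult of_nat_add of_nat_Suc add: add.commute)
  finally show "((real k + 1) * \<epsilon> - 1) * real n \<le> real k * real (card {C \<in> graph_components n E. card C \<le> k})"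
    by (simp add: algebra_simps)
qed

lemma closed_set_not_connected:
  assumes "U \<noteq> {}" "U \<subseteq> {1..n}" "card U < n" "\<And>u v. u \<in> U \<Longrightarrow> (u, v) \<in> arcs E \<Longrightarrow> v \<in> U"
  shows "\<not> connected_graph n E"
proof
  assume conn: "connected_graph n E"
  obtain u where u: "u \<in> U" using assms(1) by blast
  obtain z where z: "z \<in> {1..n}" "z \<notin> U"
    using assms(3) card_mono[of U "{1..n}"] finite_subset[OF assms(2)] by fastforce
  have "(u, z) \<in> (arcs E)\<^sup>*"
    using conn u z assms(2) unfolding connected_graph_iff_arcs by blast
  then have "z \<in> U" by (induction rule: rtrancl_induct) (use u assms(4) in auto)
  then show False using z by blast
qed

section \<open>Streams and the graphs they describe\<close>

lemma valid_stream_from_append: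
  "valid_stream_from n E (xs @ ys) \<longleftrightarrow>
     valid_stream_from n E xs \<and> valid_stream_from n (fold apply_update xs E) ys"
  by (induction n E xs rule: valid_stream_from.induct) auto

lemma fold_apply_update_subset:
  "valid_stream_from n E xs \<Longrightarrow> E \<subseteq> edges_on n \<Longrightarrow> fold apply_update xs E \<subseteq> edges_on n"
  by (induction n E xs rule: valid_stream_from.induct) auto

lemma stream_graph_subset: "valid_stream n xs \<Longrightarrow> stream_graph xs \<subseteq> edges_on n"
  unfolding stream_graph_def by (rule fold_apply_update_subset) auto

lemma stream_graph_snoc: "stream_graph (xs @ [x]) = apply_update x (stream_graph xs)"
  by (simp add: stream_graph_def)

lemma valid_stream_snoc:
  "valid_stream n (xs @ [x]) \<longleftrightarrow> valid_stream n xs \<and> valid_stream_from n (stream_graph xs) [x]"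
  by (simp add: valid_stream_from_append stream_graph_def)

section \<open>Sampling from blocks\<close>

text \<open>The second moment method in the form \<open>1 \<ge> 2 t X - t\<^sup>2 X\<^sup>2\<close>, where \<open>X\<close> counts the events
  that occur.\<close>

lemma second_moment_union:
  fixes P :: "'a pmf" and G :: "'b \<Rightarrow> 'a set"
  assumes I: "finite I" and \<mu>: "\<mu> = (\<Sum>c\<in>I. measure_pmf.prob P (G c))" "\<mu> > 0" and \<kappa>: "\<kappa> \<ge> 0"
    and pair: "\<And>c d. c \<in> I \<Longrightarrow> d \<in> I \<Longrightarrow> c \<noteq> d \<Longrightarrow>
      measure_pmf.prob P (G c \<inter> G d) \<le> \<kappa> * measure_pmf.prob P (G c) * measure_pmf.prob P (G d)"
  shows "measure_pmf.prob P (\<Union>c\<in>I. G c) \<ge> 1 / (1 / \<mu> + \<kappa>)"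
proof -
  define p where "p c = measure_pmf.prob P (G c)" for c
  define X where "X \<omega> = (\<Sum>c\<in>I. indicator (G c) \<omega> :: real)" for \<omega>
  \<comment> \<open>The maximiser of
    \<open>2 * t * \<mu> - t\<^sup>2 * (\<mu> * (1 + \<kappa> * \<mu>))\<close>; the maximum is
    \<open>t * \<mu>\<close>, which equals the claimed bound.\<close>
  define t where "t = 1 / (1 + \<kappa> * \<mu>)"
  have \<kappa>\<mu>: "0 \<le> \<kappa> * \<mu>" using \<mu>(2) \<kappa> by simp
  have intg [simp]: "integrable P (indicator A :: 'a \<Rightarrow> real)" for A
    by (rule measure_pmf.integrable_const_bound[where B = 1]) auto
  have X2: "(X \<omega>)\<^sup>2 = (\<Sum>c\<in>I. \<Sum>d\<in>I. indicator (G c \<inter> G d) \<omega>)" for \<omega>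
    unfolding X_def power2_eq_square by (simp add: sum_product indicator_inter_arith)
  have EX: "measure_pmf.expectation P X = \<mu>"
    unfolding X_def \<mu>(1) by (subst Bochner_Integration.integral_sum) auto
  have EX2: "measure_pmf.expectation P (\<lambda>\<omega>. (X \<omega>)\<^sup>2) =
      (\<Sum>c\<in>I. \<Sum>d\<in>I. measure_pmf.prob P (G c \<inter> G d))"
    unfolding X2 by (simp add: Bochner_Integration.integral_sum)
  have "integrable P (\<lambda>\<omega>. \<Sum>c\<in>I. indicator (G c) \<omega> :: real)"
    by (intro Bochner_Integration.integrable_sum intg)
  moreover have "integrable P (\<lambda>\<omega>. \<Sum>c\<in>I. \<Sum>d\<in>I. indicator (G c \<inter> G d) \<omega> :: real)"
    by (intro Bochner_Integration.integrable_sum intg)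
  ultimately have iX: "integrable P X" "integrable P (\<lambda>\<omega>. (X \<omega>)\<^sup>2)"
    unfolding X2 by (simp_all add: X_def[abs_def])
  \<comment> \<open>On the diagonal the intersection is \<open>G c\<close> itself. Adding
    \<open>\<kappa> * p c * p d\<close> there as well only enlarges the sum and lets that part
    factor into \<open>\<kappa> * \<mu> * \<mu>\<close>.\<close>
  have "(\<Sum>c\<in>I. \<Sum>d\<in>I. measure_pmf.prob P (G c \<inter> G d)) \<le>
      (\<Sum>c\<in>I. \<Sum>d\<in>I. (if d = c then p c else 0) + \<kappa> * p c * p d)"
    using pair \<kappa> by (intro sum_mono) (auto simp: p_def)
  also have "\<dots> = \<mu> + \<kappa> * \<mu> * \<mu>"
    using I by (simp add: sum.distrib \<mu>(1) p_def[symmetric] sum_distrib_left sum_distrib_right mult_ac)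
  finally have EX2': "measure_pmf.expectation P (\<lambda>\<omega>. (X \<omega>)\<^sup>2) \<le> \<mu> * (1 + \<kappa> * \<mu>)"
    by (simp add: EX2 algebra_simps)
  have "measure_pmf.expectation P (\<lambda>\<omega>. 2 * t * X \<omega> - t\<^sup>2 * (X \<omega>)\<^sup>2) \<le>
      measure_pmf.expectation P (indicator (\<Union>c\<in>I. G c))"
  proof (rule integral_mono)
    fix \<omega>
    show "2 * t * X \<omega> - t\<^sup>2 * (X \<omega>)\<^sup>2 \<le> indicator (\<Union>c\<in>I. G c) \<omega>"
    proof (cases "\<omega> \<in> (\<Union>c\<in>I. G c)")
      case True
      have "0 \<le> (1 - t * X \<omega>)\<^sup>2" by simp
      then show ?thesis using True by (simp add: power2_eq_square algebra_simps)
    next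
      case False
      then have "X \<omega> = 0" by (simp add: X_def)
      then show ?thesis by simp
    qed
  qed (use iX in auto)
  then have "2 * t * \<mu> - t\<^sup>2 * measure_pmf.expectation P (\<lambda>\<omega>. (X \<omega>)\<^sup>2) \<le>
      measure_pmf.prob P (\<Union>c\<in>I. G c)"
    using iX EX by simp
  moreover have "t\<^sup>2 * measure_pmf.expectation P (\<lambda>\<omega>. (X \<omega>)\<^sup>2) \<le> t\<^sup>2 * (\<mu> * (1 + \<kappa> * \<mu>))"
    using EX2' by (intro mult_left_mono) auto
  moreover have "t * (1 + \<kappa> * \<mu>) = 1" using \<kappa>\<mu> by (simp add: t_def)
  then have "t\<^sup>2 * (\<mu> * (1 + \<kappa> * \<mu>)) = t * \<mu>" by (simp add: power2_eq_square mult_ac)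
  moreover have "t * \<mu> = 1 / (1 / \<mu> + \<kappa>)"
    using \<mu>(2) \<kappa>\<mu> by (simp add: t_def field_simps)
  ultimately show ?thesis by linarith
qed

text \<open>The block of \<open>v\<close> is \<open>v div q\<close>, so block 0 also covers the
  number 0 and the last block may reach beyond \<open>n\<close>; drawing such a number samples no
  vertex. \<open>A\<close> is the number of draws per block.\<close>

locale block_sampling =
  fixes n q r A :: nat
  assumes q_pos: "q > 0" and blocks: "n div q < r"
begin

definition space :: "(nat \<Rightarrow> nat) pmf" where
  "space = Pi_pmf {..<r * A} 0 (\<lambda>_. pmf_of_set {..<q})"

definition slot :: "nat \<times> nat \<Rightarrow> nat" where
  "slot = (\<lambda>(v, a). (v div q) * A + a)"

definition hit :: "(nat \<Rightarrow> nat) \<Rightarrow> nat \<times> nat \<Rightarrow> bool" where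
  "hit \<rho> z \<longleftrightarrow> \<rho> (slot z) = fst z mod q"

lemma slot_eq_iff:
  assumes "a < A" "a' < A"
  shows "slot (v, a) = slot (v', a') \<longleftrightarrow> v div q = v' div q \<and> a = a'"
  using mult_add_eq_iff[OF assms] by (simp add: slot_def)

lemma slot_less:
  assumes "v \<le> n" "a < A"
  shows "slot (v, a) < r * A"
  using mult_add_less[of "v div q" r a A] div_le_mono[OF assms(1), of q] blocks assms(2)
  by (simp add: slot_def)

lemma set_space: "\<rho> \<in> set_pmf space \<Longrightarrow> j < r * A \<Longrightarrow> \<rho> j < q"
  using q_pos by (auto simp: space_def set_Pi_pmf PiE_dflt_def lessThan_empty_iff)

lemma prob_hits_inj:
  assumes H: "finite H" "H \<subseteq> {..n} \<times> {..<A}" and inj: "inj_on slot H"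
  shows "measure_pmf.prob space {\<rho>. \<forall>z\<in>H. hit \<rho> z} = (1 / real q) ^ card H"
proof -
  \<comment> \<open>Each slot used by \<open>H\<close> belongs to exactly one pair, which prescribes
    the offset drawn there; all other slots are free, so the event is a product set.\<close>
  define B where "B j = (if j \<in> slot ` H then {fst (the_inv_into H slot j) mod q} else UNIV)" for j
  have H': "slot ` H \<subseteq> {..<r * A}" using H(2) slot_less by auto
  have "{\<rho>. \<forall>z\<in>H. hit \<rho> z} = Pi {..<r * A} B"
  proof (intro equalityI subsetI)
    fix \<rho> assume "\<rho> \<in> {\<rho>. \<forall>z\<in>H. hit \<rho> z}"
    then show "\<rho> \<in> Pi {..<r * A} B"
      by (auto simp: B_def hit_def the_inv_into_f_f[OF inj])
  next
    fix \<rho> assume \<rho>: "\<rho> \<in> Pi {..<r * A} B"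
    show "\<rho> \<in> {\<rho>. \<forall>z\<in>H. hit \<rho> z}"
    proof (intro CollectI ballI)
      fix z assume z: "z \<in> H"
      then have "\<rho> (slot z) \<in> B (slot z)" using \<rho> H' by auto
      then show "hit \<rho> z" using z by (simp add: B_def hit_def the_inv_into_f_f[OF inj])
    qed
  qed
  then have "measure_pmf.prob space {\<rho>. \<forall>z\<in>H. hit \<rho> z} =
      (\<Prod>j<r * A. measure_pmf.prob (pmf_of_set {..<q}) (B j))"
    unfolding space_def by (simp add: measure_Pi_pmf_Pi)
  also have "\<dots> = (\<Prod>j<r * A. if j \<in> slot ` H then 1 / real q else 1)"
    using q_pos by (intro prod.cong refl)
      (auto simp: B_def measure_pmf_single lessThan_empty_iff)
  also have "\<dots> = (1 / real q) ^ card (slot ` H)"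
    using H' by (subst prod.inter_restrict[symmetric]) (auto simp: Int_absorb1)
  also have "\<dots> = (1 / real q) ^ card H" by (simp add: card_image[OF inj])
  finally show ?thesis .
qed

text \<open>Two vertices of one block cannot both be hit, so collisions of slots only help.\<close>

lemma prob_hits_le:
  assumes H: "finite H" "H \<subseteq> {..n} \<times> {..<A}"
  shows "measure_pmf.prob space {\<rho>. \<forall>z\<in>H. hit \<rho> z} \<le> (1 / real q) ^ card H"
proof (cases "inj_on slot H")
  case True
  then show ?thesis using prob_hits_inj[OF assms] by simp
next
  case False
  then obtain z z' where z: "z \<in> H" "z' \<in> H" "slot z = slot z'" "z \<noteq> z'"
    by (auto simp: inj_on_def)
  obtain v a v' a' where va: "z = (v, a)" "z' = (v', a')" by (cases z, cases z')
  have "v div q = v' div q" "a = a'"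
    using slot_eq_iff[of a a' v v'] z va H(2) by auto
  then have "v mod q \<noteq> v' mod q" using z(4) va by (metis div_mod_decomp)
  then have "{\<rho>. \<forall>z\<in>H. hit \<rho> z} = {}"
    using z(1-3) va unfolding hit_def by (metis (mono_tags, lifting) Collect_empty_eq fst_conv)
  then show ?thesis by (simp only: measure_empty) simp
qed

end

section \<open>The probability that some small component is caught\<close>

context block_sampling
begin

definition good :: "nat \<Rightarrow> (nat \<Rightarrow> nat) \<Rightarrow> nat \<Rightarrow> nat set \<Rightarrow> bool" where
  "good k \<rho> g C \<longleftrightarrow>
     (\<forall>j<card C. \<forall>b<k. hit \<rho> (sorted_list_of_set C ! j, g * k + b) \<longleftrightarrow> j = b)"

definition targets :: "nat \<Rightarrow> nat \<Rightarrow> nat set \<Rightarrow> (nat \<times> nat) set" where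
  "targets k g C = (\<lambda>b. (sorted_list_of_set C ! b, g * k + b)) ` {..<card C}"

lemma finite_targets: "finite (targets k g C)"
  by (simp add: targets_def)

lemma card_targets: "card (targets k g C) = card C"
  unfolding targets_def by (subst card_image) (auto simp: inj_on_def)

lemma sorted_list_of_set_nth_in:
  "finite C \<Longrightarrow> j < card C \<Longrightarrow> sorted_list_of_set C ! j \<in> C"
  by (metis nth_mem set_sorted_list_of_set sorted_list_of_set.length_sorted_key_list_of_set)

lemma targets_subset:
  assumes "A = M * k" "g < M" "C \<subseteq> {1..n}" "card C \<le> k"
  shows "targets k g C \<subseteq> {..n} \<times> {..<A}"
proof
  fix z assume "z \<in> targets k g C"
  then obtain b where b: "b < card C" "z = (sorted_list_of_set C ! b, g * k + b)"
    by (auto simp: targets_def)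
  have "finite C" using assms(3) finite_subset by auto
  then have "sorted_list_of_set C ! b \<in> {1..n}"
    using sorted_list_of_set_nth_in[of C b] b assms(3) by blast
  then show "z \<in> {..n} \<times> {..<A}"
    using b assms(1,2,4) mult_add_less[of g M b k] by auto
qed

lemma inj_on_slot_targets:
  assumes "A = M * k" "g < M" "card C \<le> k"
  shows "inj_on slot (targets k g C)"
proof (rule inj_onI)
  fix z z' assume "z \<in> targets k g C" "z' \<in> targets k g C" and eq: "slot z = slot z'"
  then obtain b b' where "b < card C" "z = (sorted_list_of_set C ! b, g * k + b)"
    "b' < card C" "z' = (sorted_list_of_set C ! b', g * k + b')"
    by (auto simp: targets_def)
  then show "z = z'"
    using eq slot_eq_iff[of "g * k + b" "g * k + b'"] mult_add_less[of g M _ k] assms by auto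
qed

lemma good_imp_hits:
  assumes "good k \<rho> g C" "card C \<le> k"
  shows "\<forall>z\<in>targets k g C. hit \<rho> z"
  using assms by (auto simp: good_def targets_def)

text \<open>The targets are hit with probability exactly \<open>(1 / real q) ^ card C\<close>. Each
  of at most \<open>k * k\<close> unwanted extra hits costs a further factor
  \<open>1 / real q\<close>, and a union bound removes them. An extra hit that shares a slot with a
  target cannot occur together with it, a case covered by \<open>prob_hits_le\<close>.\<close>

lemma prob_good_ge:
  assumes "A = M * k" "g < M" "C \<subseteq> {1..n}" "card C \<le> k"
  shows "measure_pmf.prob space {\<rho>. good k \<rho> g C} \<ge> (1 / real q) ^ card C * (1 - real (k * k) / real q)"
proof -
  let ?P = "measure_pmf.prob space" and ?H = "targets k g C"
  define c where "c j = sorted_list_of_set C ! j" for j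
  define J where "J = {(j, b). j < card C \<and> b < k \<and> j \<noteq> b}"
  define Bad where "Bad p = {\<rho>. \<forall>z\<in>insert (c (fst p), g * k + snd p) ?H. hit \<rho> z}" for p
  have fin: "finite C" using assms(3) finite_subset by auto
  have J: "J \<subseteq> {..<k} \<times> {..<k}" using assms(4) by (auto simp: J_def)
  then have finJ: "finite J" by (rule finite_subset) auto
  have cardJ: "card J \<le> k * k" using card_mono[OF _ J] by simp
  have c_eq: "c j = c b \<longleftrightarrow> j = b" if "j < card C" "b < card C" for j b
    using that fin by (simp add: c_def nth_eq_iff_index_eq)
  have bad: "?P (Bad p) \<le> (1 / real q) ^ (card C + 1)" if pJ: "p \<in> J" for p
  proof -
    obtain j b where p: "p = (j, b)" "j < card C" "b < k" "j \<noteq> b" using pJ by (auto simp: J_def)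
    have notin: "(c j, g * k + b) \<notin> ?H"
      using p c_eq by (auto simp: targets_def c_def[symmetric])
    have "c j \<in> {1..n}"
      using sorted_list_of_set_nth_in[OF fin p(2)] assms(3) by (auto simp: c_def)
    then have "insert (c j, g * k + b) ?H \<subseteq> {..n} \<times> {..<A}"
      using targets_subset[OF assms] mult_add_less[OF assms(2) p(3)] assms(1) by auto
    then have "?P (Bad p) \<le> (1 / real q) ^ card (insert (c j, g * k + b) ?H)"
      unfolding Bad_def p by (simp only: fst_conv snd_conv) (intro prob_hits_le, auto simp: finite_targets)
    then show ?thesis using notin by (simp add: finite_targets card_targets)
  qed
  have "{\<rho>. \<forall>z\<in>?H. hit \<rho> z} \<subseteq> {\<rho>. good k \<rho> g C} \<union> (\<Union>p\<in>J. Bad p)"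
  proof
    fix \<rho> assume \<rho>: "\<rho> \<in> {\<rho>. \<forall>z\<in>?H. hit \<rho> z}"
    show "\<rho> \<in> {\<rho>. good k \<rho> g C} \<union> (\<Union>p\<in>J. Bad p)"
    proof (rule ccontr)
      assume n: "\<rho> \<notin> {\<rho>. good k \<rho> g C} \<union> (\<Union>p\<in>J. Bad p)"
      have "hit \<rho> (c j, g * k + b) \<longleftrightarrow> j = b" if "j < card C" "b < k" for j b
      proof
        assume "j = b"
        then show "hit \<rho> (c j, g * k + b)" using \<rho> that by (auto simp: targets_def c_def)
      next
        assume h: "hit \<rho> (c j, g * k + b)"
        show "j = b"
        proof (rule ccontr)
          assume "j \<noteq> b"
          then have "(j, b) \<in> J" using that by (simp add: J_def)
          moreover have "\<rho> \<in> Bad (j, b)" using h \<rho> by (simp add: Bad_def)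
          ultimately show False using n by blast
        qed
      qed
      then have "good k \<rho> g C" by (simp add: good_def c_def)
      then show False using n by blast
    qed
  qed
  then have "?P {\<rho>. \<forall>z\<in>?H. hit \<rho> z} \<le> ?P ({\<rho>. good k \<rho> g C} \<union> (\<Union>p\<in>J. Bad p))"
    by (intro measure_pmf.finite_measure_mono) auto
  also have "\<dots> \<le> ?P {\<rho>. good k \<rho> g C} + ?P (\<Union>p\<in>J. Bad p)"
    by (intro measure_Un_le) auto
  also have "?P (\<Union>p\<in>J. Bad p) \<le> (\<Sum>p\<in>J. ?P (Bad p))"
    using finJ by (intro measure_UNION_le) auto
  also have "\<dots> \<le> (\<Sum>p\<in>J. (1 / real q) ^ (card C + 1))"
    using bad by (rule sum_mono)
  also have "\<dots> \<le> real (k * k) * (1 / real q) ^ (card C + 1)"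
    using cardJ unfolding sum_constant by (intro mult_right_mono of_nat_mono) auto
  also have "?P {\<rho>. \<forall>z\<in>?H. hit \<rho> z} = (1 / real q) ^ card C"
    using prob_hits_inj[OF finite_targets targets_subset[OF assms] inj_on_slot_targets[OF assms(1,2,4)]]
    by (simp add: card_targets)
  finally show ?thesis by (simp add: algebra_simps)
qed

text \<open>By \<open>16 * k * k \<le> q\<close> the loss factor of \<open>prob_good_ge\<close> is
  at least 15/16, hence \<kappa> = (16/15)^2 = 256/225, and 16/5 times 15/16 gives \<mu> \<ge> 3.
  The second moment bound is then at least 225/331, just above 2/3.\<close>

lemma prob_exists_good:
  assumes A: "A = M * k" and Q: "finite Q" "\<And>C. C \<in> Q \<Longrightarrow> C \<subseteq> {1..n}" "\<And>C. C \<in> Q \<Longrightarrow> card C \<le> k"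
    "\<And>C C'. C \<in> Q \<Longrightarrow> C' \<in> Q \<Longrightarrow> C \<noteq> C' \<Longrightarrow> C \<inter> C' = {}"
    and q: "16 * k * k \<le> q"
    and large: "16 / 5 * real q ^ k \<le> real M * real (card Q)"
  shows "measure_pmf.prob space {\<rho>. \<exists>g<M. \<exists>C\<in>Q. good k \<rho> g C} \<ge> 2 / 3"
proof -
  let ?P = "measure_pmf.prob space" 
  define I where "I = {..<M} \<times> Q"
  define G where "G i = {\<rho>. good k \<rho> (fst i) (snd i)}" for i :: "nat \<times> nat set"
  define s where "s i = card (snd i)" for i :: "nat \<times> nat set"
  define \<mu> where "\<mu> = (\<Sum>i\<in>I. ?P (G i))"
  have "real (16 * k * k) \<le> real q" using q by (rule of_nat_mono)
  then have kq: "1 - real (k * k) / real q \<ge> 15 / 16"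
    using q_pos by (simp add: field_simps)
  have lower: "?P (G i) \<ge> 15 / 16 * (1 / real q) ^ s i" if "i \<in> I" for i
  proof -
    have "15 / 16 * (1 / real q) ^ s i \<le> (1 - real (k * k) / real q) * (1 / real q) ^ s i"
      by (rule mult_right_mono[OF kq]) simp
    then show ?thesis
      using prob_good_ge[OF A, of "fst i" "snd i"] that Q
      by (auto simp: I_def G_def s_def mult.commute)
  qed
  have pair: "?P (G i \<inter> G j) \<le> 256 / 225 * ?P (G i) * ?P (G j)"
    if ij: "i \<in> I" "j \<in> I" "i \<noteq> j" for i j
  proof -
    let ?Hi = "targets k (fst i) (snd i)" and ?Hj = "targets k (fst j) (snd j)"
    have "targets k (fst i) (snd i) \<subseteq> {..n} \<times> {..<A}" if "i \<in> I" for i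
      using that by (intro targets_subset[OF A] Q(2,3)) (auto simp: I_def)
    then have sub: "?Hi \<subseteq> {..n} \<times> {..<A}" "?Hj \<subseteq> {..n} \<times> {..<A}"
      using ij by blast+
    \<comment> \<open>Different groups use different draw indices and components of one group share
      no vertex, so the two requirements never overlap and their exponents add.\<close>
    have "?Hi \<inter> ?Hj = {}"
    proof (rule ccontr)
      assume "?Hi \<inter> ?Hj \<noteq> {}"
      then obtain b b' where b: "b < s i" "b' < s j" "fst i * k + b = fst j * k + b'"
        "sorted_list_of_set (snd i) ! b = sorted_list_of_set (snd j) ! b'"
        by (auto simp: targets_def s_def)
      have bk: "b < k" "b' < k" using b ij Q(3) by (auto simp: I_def s_def intro: less_le_trans)
      then have "fst i = fst j" using b(3) mult_add_eq_iff by blast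
      then have "snd i \<noteq> snd j" using ij(3) by (simp add: prod_eq_iff)
      moreover have "finite (snd i)" "finite (snd j)"
        using ij by (intro finite_subset[OF Q(2) finite_atLeastAtMost], simp add: I_def mem_Times_iff)+
      then have "sorted_list_of_set (snd i) ! b \<in> snd i" "sorted_list_of_set (snd j) ! b' \<in> snd j"
        using b(1,2) by (simp_all add: s_def sorted_list_of_set_nth_in)
      ultimately show False using Q(4)[of "snd i" "snd j"] b(4) ij by (auto simp: I_def)
    qed
    then have card: "card (?Hi \<union> ?Hj) = s i + s j"
      by (simp add: card_Un_disjoint finite_targets card_targets s_def)
    have "?P (G i \<inter> G j) \<le> ?P {\<rho>. \<forall>z\<in>?Hi \<union> ?Hj. hit \<rho> z}"
    proof (rule measure_pmf.finite_measure_mono)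
      have "card (snd i) \<le> k" "card (snd j) \<le> k" using ij Q(3) by (auto simp: I_def)
      then show "G i \<inter> G j \<subseteq> {\<rho>. \<forall>z\<in>?Hi \<union> ?Hj. hit \<rho> z}"
        using good_imp_hits unfolding G_def by blast
    qed simp
    also have "\<dots> \<le> (1 / real q) ^ (s i + s j)"
      using prob_hits_le[of "?Hi \<union> ?Hj"] sub by (simp add: finite_targets card)
    also have "\<dots> = 256 / 225 * (15 / 16 * (1 / real q) ^ s i) * (15 / 16 * (1 / real q) ^ s j)"
      by (simp add: power_add)
    also have "\<dots> \<le> 256 / 225 * ?P (G i) * ?P (G j)"
      using lower ij by (intro mult_mono) auto
    finally show ?thesis .
  qed
  have "3 * real q ^ k \<le> real M * real (card Q) * (15 / 16)" using large by simp
  then have "3 \<le> real M * real (card Q) * (15 / 16 * (1 / real q) ^ k)"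
    using q_pos by (simp add: field_simps power_one_over)
  also have "\<dots> = (\<Sum>i\<in>I. 15 / 16 * (1 / real q) ^ k)"
    by (simp add: I_def card_cartesian_product)
  also have "\<dots> \<le> (\<Sum>i\<in>I. ?P (G i))"
  proof (rule sum_mono)
    fix i assume i: "i \<in> I"
    have "(1 / real q) ^ k \<le> (1 / real q) ^ s i"
      using i Q(3) q_pos by (intro power_decreasing) (auto simp: I_def s_def)
    then show "15 / 16 * (1 / real q) ^ k \<le> ?P (G i)" using lower[OF i] by linarith
  qed
  finally have \<mu>3: "3 \<le> \<mu>" by (simp add: \<mu>_def)
  have "?P (\<Union>i\<in>I. G i) \<ge> 1 / (1 / \<mu> + 256 / 225)"
    using \<mu>3 pair Q(1) by (intro second_moment_union[OF _ \<mu>_def]) (auto simp: I_def)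
  moreover have "1 / (1 / \<mu> + 256 / 225) \<ge> 2 / 3"
    using \<mu>3 by (simp add: field_simps)
  moreover have "(\<Union>i\<in>I. G i) = {\<rho>. \<exists>g<M. \<exists>C\<in>Q. good k \<rho> g C}"
    unfolding I_def G_def by fastforce
  ultimately show ?thesis by auto
qed

end

section \<open>The linear sketch\<close>

text \<open>Cell 4 holds the block length \<open>q\<close>, cell 5 the number of edges, cell 6 a loop counter and cell 7 the
  rejection flag. From cell 8 on there is a record of \<open>k + 2\<close> cells for each block \<open>i\<close> and each
  \<open>a = g * k + b < M * k\<close>, where \<open>g\<close> is the group and \<open>b\<close> the colour; its index is \<open>i * (M * k) + a\<close>. The
  record contains the sampled vertex, its degree and the \<open>k\<close> neighbour sums.\<close>

definition cell :: "nat \<Rightarrow> aexp" where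
  "cell c = Load (Const c)"

definition entry :: "nat \<Rightarrow> aexp \<Rightarrow> nat \<Rightarrow> aexp" where
  "entry k e f = Binop Plus (Const (8 + f)) (Binop Times e (Const (k + 2)))"

definition vslot :: "nat \<Rightarrow> nat \<Rightarrow> aexp \<Rightarrow> nat \<Rightarrow> aexp" where
  "vslot k M v a = Binop Plus (Binop Times (Binop Div v (cell 4)) (Const (M * k))) (Const a)"

definition field :: "nat \<Rightarrow> nat \<Rightarrow> aexp \<Rightarrow> nat \<Rightarrow> nat \<Rightarrow> aexp" where
  "field k M v a f = Load (entry k (vslot k M v a) f)"

text \<open>\<open>f = 0\<close> stands for the degree and \<open>f = b + 1\<close> for colour
  \<open>b\<close>. \<open>a div k * k\<close> is the first draw index of the group of
  \<open>a\<close>, so neighbours are looked up in the same group only.\<close>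

definition weight_exp :: "nat \<Rightarrow> nat \<Rightarrow> nat \<Rightarrow> nat \<Rightarrow> nat \<Rightarrow> aexp" where
  "weight_exp k M cv a f =
     (if f = 0 then Const 1
      else Binop Times (Binop Equal (field k M (cell cv) (a div k * k + (f - 1)) 0) (cell cv))
             (Binop Plus (cell 0) (cell cv)))"

definition delta_exp :: "nat \<Rightarrow> nat \<Rightarrow> nat \<Rightarrow> nat \<Rightarrow> nat \<Rightarrow> nat \<Rightarrow> aexp" where
  "delta_exp k M cu cv a f =
     Binop Times (Binop Equal (field k M (cell cu) a 0) (cell cu)) (weight_exp k M cv a f)"

text \<open>Signed update without branching or negative numbers: cell 1 is 1 for an insertion and 0
  for a deletion. A deletion subtracts a term that is present, so truncated subtraction is
  exact.\<close>

definition change_exp :: "aexp \<Rightarrow> aexp \<Rightarrow> aexp" where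
  "change_exp old d = Binop Minus (Binop Plus old (Binop Times (cell 1) d))
     (Binop Times (Binop Minus (Const 1) (cell 1)) d)"

text \<open>Every record in the block of the source is rewritten, those of other sampled vertices
  with a change of 0. The samples consulted sit in field 0, which is never a target; this makes the
  stores independent of each other.\<close>

definition arc_prog :: "nat \<Rightarrow> nat \<Rightarrow> nat \<Rightarrow> nat \<Rightarrow> com" where
  "arc_prog k M cu cv = stores (map (\<lambda>p.
     (entry k (vslot k M (cell cu) (fst p)) (snd p + 1),
      change_exp (field k M (cell cu) (fst p) (snd p + 1)) (delta_exp k M cu cv (fst p) (snd p))))
     (List.product [0..<M * k] [0..<k + 1]))"

definition edge_prog :: "nat \<Rightarrow> nat \<Rightarrow> com" where
  "edge_prog k M = Seq (Store (Const 5) (change_exp (cell 5) (Const 1)))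
     (Seq (arc_prog k M 2 3) (arc_prog k M 3 2))"

text \<open>The two inequalities prevent reduction modulo \<open>2 ^ w\<close>: addresses are
  bounded with a block to spare, a neighbour sum has at most \<open>n\<close> terms of size at most
  \<open>2 * n\<close>, and one change adds at most \<open>2 * n\<close> more.\<close>

locale sketch =
  fixes k M n q w S :: nat
  assumes k1: "1 \<le> k" and n1: "1 \<le> n" and q1: "1 \<le> q"
    and word_addr: "8 + (n div q + 2) * (M * k) * (k + 2) + (k + 2) < 2 ^ w"
    and word_val: "2 * n * n + 4 * n + q + M + k + 8 < 2 ^ w"
    and S: "S = 8 + (n div q + 1) * (M * k) * (k + 2)"
begin

definition addr :: "nat \<Rightarrow> nat \<Rightarrow> nat" where
  "addr j f = 8 + f + j * (k + 2)"

definition weight :: "(nat \<Rightarrow> nat \<Rightarrow> nat) \<Rightarrow> nat \<Rightarrow> nat \<Rightarrow> nat \<Rightarrow> nat" where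
  "weight x a f v =
     (if f = 0 then 1 else if x (v div q) (a div k * k + (f - 1)) = v then n + v else 0)"

text \<open>The records are determined by the samples \<open>x\<close> and the current relation
  alone. \<open>D\<close> may be asymmetric, since between the two halves of an edge update only one
  direction has been recorded.\<close>

definition Inv :: "(nat \<Rightarrow> nat \<Rightarrow> nat) \<Rightarrow> (nat \<times> nat) set \<Rightarrow> memory \<Rightarrow> bool" where
  "Inv x D m \<longleftrightarrow> m 0 = n \<and> m 4 = q \<and>
     (\<forall>i\<le>n div q. \<forall>a<M * k. m (addr (i * (M * k) + a) 0) = x i a \<and>
        (\<forall>f\<le>k. m (addr (i * (M * k) + a) (f + 1)) = (\<Sum>v | (x i a, v) \<in> D. weight x a f v)))"

lemma w_pos: "0 < w"
  using word_val by (cases "w = 0") auto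

lemma addr_eq_iff:
  assumes "f < k + 2" "f' < k + 2"
  shows "addr j f = addr j' f' \<longleftrightarrow> j = j' \<and> f = f'"
proof -
  have "addr j f = addr j' f' \<longleftrightarrow> j * (k + 2) + f = j' * (k + 2) + f'" unfolding addr_def by linarith
  then show ?thesis by (simp only: mult_add_eq_iff[OF assms])
qed

lemma addr_ge: "8 \<le> addr j f"
  by (simp add: addr_def)

lemma entry_index_less:
  assumes "i \<le> n div q" "a < M * k"
  shows "i * (M * k) + a < (n div q + 1) * (M * k)"
  using assms by (intro mult_add_less) auto

lemma addr_less_S:
  assumes "j < (n div q + 1) * (M * k)" "f < k + 2"
  shows "addr j f < S"
  using mult_add_less[OF assms] unfolding addr_def S by linarith

lemma eval_cell: "c \<le> 8 \<Longrightarrow> eval w (cell c) m = m c"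
  using word_val by (simp add: cell_def)

lemma eval_entry:
  assumes "eval w e m \<le> (n div q + 1) * (M * k)" "f < k + 2"
  shows "eval w (entry k e f) m = addr (eval w e m) f"
proof -
  have "eval w e m * (k + 2) \<le> (n div q + 2) * (M * k) * (k + 2)"
    using assms(1) by (intro mult_le_mono1) simp
  then have "8 + f + eval w e m * (k + 2) < 2 ^ w" using assms(2) word_addr by linarith
  then show ?thesis using word_val by (simp add: entry_def addr_def)
qed

lemma eval_vslot:
  assumes "eval w v m \<le> n" "m 4 = q" "a < M * k"
  shows "eval w (vslot k M v a) m = eval w v m div q * (M * k) + a"
proof -
  have le: "eval w v m div q \<le> n div q" using assms(1) by (rule div_le_mono)
  have "(n div q + 1) * (M * k) * 1 \<le> (n div q + 2) * (M * k) * (k + 2)"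
    by (intro mult_le_mono mult_le_mono1) auto
  then have lt: "eval w v m div q * (M * k) + a < 2 ^ w"
    using entry_index_less[OF le assms(3)] word_addr by linarith
  have "1 * (M * k) * 1 \<le> (n div q + 2) * (M * k) * (k + 2)"
    by (intro mult_le_mono mult_le_mono1) auto
  then have "M * k < 2 ^ w" using word_addr by linarith
  moreover have "eval w v m div q < 2 ^ w" using assms(1) word_val div_le_dividend[of "eval w v m" q]
    by linarith
  ultimately show ?thesis
    using lt assms eval_cell[of 4 m] by (simp add: vslot_def)
qed

lemma eval_field:
  assumes "eval w v m \<le> n" "m 4 = q" "a < M * k" "f < k + 2"
  shows "eval w (field k M v a f) m = m (addr (eval w v m div q * (M * k) + a) f)"
proof -
  have "eval w v m div q \<le> n div q" using assms(1) by (rule div_le_mono)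
  then have "eval w (vslot k M v a) m \<le> (n div q + 1) * (M * k)"
    using entry_index_less[of _ a] assms eval_vslot[OF assms(1-3)] by (simp add: less_imp_le)
  then show ?thesis
    using eval_entry[of "vslot k M v a" m f] eval_vslot[OF assms(1-3)] assms(4) by (simp add: field_def)
qed

lemma eval_entry_vslot:
  assumes "eval w v m \<le> n" "m 4 = q" "a < M * k" "f < k + 2"
  shows "eval w (entry k (vslot k M v a) f) m = addr (eval w v m div q * (M * k) + a) f"
proof -
  have "eval w v m div q \<le> n div q" using assms(1) by (rule div_le_mono)
  then have "eval w (vslot k M v a) m \<le> (n div q + 1) * (M * k)"
    using entry_index_less[of _ a] assms eval_vslot[OF assms(1-3)] by (simp add: less_imp_le)
  then show ?thesis
    using eval_entry[of "vslot k M v a" m f] eval_vslot[OF assms(1-3)] assms(4) by simp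
qed

lemma group_colour_less:
  assumes "a < M * k" "b < k"
  shows "a div k * k + b < M * k"
proof -
  have "a div k < M" using assms(1) by (simp add: less_mult_imp_div_less)
  then show ?thesis using assms(2) by (rule mult_add_less)
qed

lemma InvD:
  assumes "Inv x D m"
  shows "m 0 = n" "m 4 = q"
    "i \<le> n div q \<Longrightarrow> a < M * k \<Longrightarrow> m (addr (i * (M * k) + a) 0) = x i a"
    "i \<le> n div q \<Longrightarrow> a < M * k \<Longrightarrow> f \<le> k \<Longrightarrow>
       m (addr (i * (M * k) + a) (f + 1)) = (\<Sum>v | (x i a, v) \<in> D. weight x a f v)"
  using assms unfolding Inv_def by auto

lemma Inv_cong:
  assumes "Inv x D m" "m' 0 = m 0" "m' 4 = m 4" "\<And>z. 8 \<le> z \<Longrightarrow> m' z = m z"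
  shows "Inv x D m'"
  using assms addr_ge unfolding Inv_def by simp

lemma weight_le: "v \<le> n \<Longrightarrow> weight x a f v \<le> 2 * n"
  using n1 by (auto simp: weight_def)

lemma sum_weight_le:
  assumes "D \<subseteq> {1..n} \<times> {1..n}"
  shows "(\<Sum>v | (u, v) \<in> D. weight x a f v) \<le> 2 * n * n"
proof -
  have sub: "{v. (u, v) \<in> D} \<subseteq> {1..n}" using assms by auto
  then have "(\<Sum>v | (u, v) \<in> D. weight x a f v) \<le> of_nat (card {v. (u, v) \<in> D}) * (2 * n)"
    by (intro sum_bounded_above weight_le) auto
  also have "\<dots> \<le> n * (2 * n)"
    using card_mono[OF _ sub] by (intro mult_le_mono1) simp
  finally show ?thesis by (simp add: mult_ac)
qed

lemma eval_change_exp: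
  assumes "m 1 \<le> 1" "eval w old m + eval w d m < 2 ^ w"
  shows "eval w (change_exp old d) m =
    (if m 1 = 1 then eval w old m + eval w d m else eval w old m - eval w d m)"
proof -
  have "m 1 = 0 \<or> m 1 = 1" using assms(1) by linarith
  moreover have "1 < (2::nat) ^ w" "eval w old m < 2 ^ w" "eval w d m < 2 ^ w"
    "eval w old m - eval w d m < 2 ^ w" using assms(2) word_val by linarith+
  ultimately show ?thesis using assms(2) eval_cell[of 1 m]
    by (auto simp: change_exp_def)
qed

lemma eval_weight_exp:
  assumes "m 0 = n" "m 4 = q" "m cv = v" "cv \<le> 8" "v \<le> n" "a < M * k" "f \<le> k"
    and "\<And>b. b < M * k \<Longrightarrow> m (addr (v div q * (M * k) + b) 0) = x (v div q) b"
  shows "eval w (weight_exp k M cv a f) m = weight x a f v"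
proof (cases "f = 0")
  case True
  then show ?thesis using w_pos by (simp add: weight_exp_def weight_def)
next
  case False
  let ?b = "a div k * k + (f - 1)"
  have b: "?b < M * k" using group_colour_less[of a "f - 1"] assms(6,7) False by simp
  have cv: "eval w (cell cv) m = v" "eval w (cell 0) m = n" using eval_cell assms by auto
  have "eval w (field k M (cell cv) ?b 0) m = x (v div q) ?b"
    using eval_field[of "cell cv" m ?b 0] assms(2,5,8) b cv by simp
  moreover have "n + v < 2 ^ w" "1 < (2::nat) ^ w" using word_val assms(5) by linarith+
  ultimately show ?thesis using False cv by (simp add: weight_exp_def weight_def)
qed

text \<open>By \<open>xdiv\<close> a record whose sampled vertex is \<open>u\<close> lies in the
  block of \<open>u\<close>, so the rewritten block contains all affected sums. Each of them changes
  by the single term of \<open>v\<close>.\<close>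

lemma yields_arc_prog:
  assumes inv: "Inv x D m" and xdiv: "\<And>i a. i \<le> n div q \<Longrightarrow> a < M * k \<Longrightarrow> x i a div q = i"
    and D: "D \<subseteq> {1..n} \<times> {1..n}" and uv: "u \<le> n" "v \<le> n"
    and cells: "m 1 \<le> 1" "m cu = u" "m cv = v" "cu < 8" "cv < 8"
    and D': "if m 1 = 1 then (u, v) \<notin> D \<and> D' = insert (u, v) D else (u, v) \<in> D \<and> D' = D - {(u, v)}"
  shows "\<exists>t m'. yields w S t (arc_prog k M cu cv) m (return_pmf m') \<and> Inv x D' m' \<and> (\<forall>z<8. m' z = m z)"
proof -
  define ps where "ps = List.product [0..<M * k] [0..<k + 1]"
  define ad where "ad p = addr (u div q * (M * k) + fst p) (snd p + 1)" for p
  define d where "d a f = (if x (u div q) a = u then weight x a f v else 0)" for a f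
  define vl where "vl p = (if m 1 = 1 then m (ad p) + d (fst p) (snd p) else m (ad p) - d (fst p) (snd p))" for p
  have ui: "u div q \<le> n div q" "v div q \<le> n div q" using uv by (auto intro: div_le_mono)
  have set_ps: "set ps = {..<M * k} \<times> {..k}" by (auto simp: ps_def)
  have ps_dist: "distinct ps" by (simp add: ps_def distinct_product)
  have inj: "inj_on ad (set ps)"
    by (rule inj_onI) (auto simp: ad_def set_ps addr_eq_iff)
  have adS: "ad p < S" if "p \<in> set ps" for p
    using that entry_index_less[OF ui(1)] by (auto simp: ad_def set_ps intro!: addr_less_S)
  have ad8: "8 \<le> ad p" for p by (simp add: ad_def addr_ge)
  have x_notin: "addr j 0 \<notin> ad ` set ps" for j
    by (auto simp: ad_def set_ps addr_eq_iff)
  have ev: "eval w (entry k (vslot k M (cell cu) (fst p)) (snd p + 1)) m' = ad p \<and>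
      eval w (change_exp (field k M (cell cu) (fst p) (snd p + 1)) (delta_exp k M cu cv (fst p) (snd p))) m' = vl p"
    if p: "p \<in> set ps" and own: "m' (ad p) = m (ad p)" and ag: "\<And>z. z \<notin> ad ` set ps \<Longrightarrow> m' z = m z" for p m'
  proof -
    obtain a f where af: "p = (a, f)" "a < M * k" "f \<le> k" using p by (auto simp: set_ps)
    have low: "m' z = m z" if "z < 8" for z
      using ag[of z] ad8 that by (metis imageE not_le)
    have xs: "m' (addr (i * (M * k) + b) 0) = x i b" if "i \<le> n div q" "b < M * k" for i b
      using ag[OF x_notin] InvD(3)[OF inv that] by simp
    have m': "m' 0 = n" "m' 4 = q" "m' cu = u" "m' cv = v" "m' 1 = m 1"
      using low cells InvD(1,2)[OF inv] by auto
    have cu: "eval w (cell cu) m' = u" using eval_cell[of cu m'] cells(4) m'(3) by simp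
    have e1: "eval w (entry k (vslot k M (cell cu) a) (f + 1)) m' = ad p"
      using eval_entry_vslot[of "cell cu" m' a "f + 1"] cu uv(1) m'(2) af by (simp add: ad_def)
    have e2: "eval w (field k M (cell cu) a (f + 1)) m' = m (ad p)"
      using eval_field[of "cell cu" m' a "f + 1"] cu uv(1) m'(2) af own by (simp add: ad_def)
    have "eval w (field k M (cell cu) a 0) m' = x (u div q) a"
      using eval_field[of "cell cu" m' a 0] cu uv(1) m'(2) af xs[OF ui(1), of a] by simp
    moreover have "eval w (weight_exp k M cv a f) m' = weight x a f v"
      using m' cells uv af xs ui by (intro eval_weight_exp) auto
    moreover have "weight x a f v < 2 ^ w" "1 < (2::nat) ^ w"
      using weight_le[OF uv(2), of x a f] word_val by linarith+
    ultimately have e3: "eval w (delta_exp k M cu cv a f) m' = d a f"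
      using cu by (simp add: delta_exp_def d_def)
    have "m (ad p) = (\<Sum>v | (x (u div q) a, v) \<in> D. weight x a f v)"
      using InvD(4)[OF inv ui(1) af(2,3)] by (simp add: ad_def af)
    then have "m (ad p) \<le> 2 * n * n" using sum_weight_le[OF D] by simp
    moreover have "d a f \<le> 2 * n" using weight_le[OF uv(2)] by (simp add: d_def)
    ultimately have "m (ad p) + d a f < 2 ^ w" using word_val by linarith
    then show ?thesis
      using e1 e2 e3 eval_change_exp[of m' "field k M (cell cu) a (f + 1)" "delta_exp k M cu cv a f"]
        m' cells(1) by (simp add: af vl_def)
  qed
  obtain m' where m': "yields w S (2 * length ps) (arc_prog k M cu cv) m (return_pmf m')"
    "\<forall>p\<in>set ps. m' (ad p) = vl p" "\<forall>z. z \<notin> ad ` set ps \<longrightarrow> m' z = m z"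
    using yields_stores[OF ps_dist inj adS ev] unfolding arc_prog_def ps_def[symmetric] by blast
  have low: "\<forall>z<8. m' z = m z" using m'(3) ad8 by (metis imageE not_le)
  have fin: "finite {y. (z, y) \<in> D}" for z
    by (rule finite_subset[of _ "{1..n}"]) (use D in auto)
  have "Inv x D' m'"
    unfolding Inv_def
  proof (intro conjI allI impI)
    show "m' 0 = n" "m' 4 = q" using low InvD(1,2)[OF inv] by auto
    fix i a assume ia: "i \<le> n div q" "a < M * k"
    show "m' (addr (i * (M * k) + a) 0) = x i a"
      using m'(3) x_notin InvD(3)[OF inv ia] by simp
    fix f assume f: "f \<le> k"
    have old: "m (addr (i * (M * k) + a) (f + 1)) = (\<Sum>v | (x i a, v) \<in> D. weight x a f v)"
      using InvD(4)[OF inv ia f] .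
    show "m' (addr (i * (M * k) + a) (f + 1)) = (\<Sum>v | (x i a, v) \<in> D'. weight x a f v)"
    proof (cases "i = u div q")
      case True
      have new: "m' (addr (i * (M * k) + a) (f + 1)) = vl (a, f)"
        using m'(2) ia f True by (auto simp: set_ps ad_def)
      have ad: "ad (a, f) = addr (i * (M * k) + a) (f + 1)" using True by (simp add: ad_def)
      show ?thesis
      proof (cases "x i a = u")
        case xu: True
        show ?thesis
        proof (cases "m 1 = 1")
          case True
          then have "{y. (x i a, y) \<in> D'} = insert v {y. (x i a, y) \<in> D}" "v \<notin> {y. (x i a, y) \<in> D}"
            using D' xu by auto
          then show ?thesis
            using new old ad True xu fin \<open>i = u div q\<close> by (simp add: vl_def d_def)
        next
          case False
          then have eq: "{y. (x i a, y) \<in> D'} = {y. (x i a, y) \<in> D} - {v}" and v: "v \<in> {y. (x i a, y) \<in> D}"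
            using D' xu by auto
          show ?thesis
            using new old ad False xu sum.remove[OF fin v, of "weight x a f"] \<open>i = u div q\<close>
            unfolding eq by (simp add: vl_def d_def)
        qed
      next
        case False
        then have "{y. (x i a, y) \<in> D'} = {y. (x i a, y) \<in> D}"
          using D' by (auto split: if_splits)
        then show ?thesis using new old ad False True by (simp add: vl_def d_def)
      qed
    next
      case False
      then have "x i a \<noteq> u" using xdiv[OF ia] by auto
      then have "{y. (x i a, y) \<in> D'} = {y. (x i a, y) \<in> D}"
        using D' by (auto split: if_splits)
      moreover have "addr (i * (M * k) + a) (f + 1) \<notin> ad ` set ps"
      proof
        assume "addr (i * (M * k) + a) (f + 1) \<in> ad ` set ps"
        then obtain a' where a': "a' < M * k" "i * (M * k) + a = u div q * (M * k) + a'"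
          using f by (auto simp: ad_def set_ps addr_eq_iff)
        then show False using False mult_add_eq_iff[OF ia(2) a'(1)] by blast
      qed
      ultimately show ?thesis using m'(3) old by simp
    qed
  qed
  then show ?thesis using m'(1) low by blast
qed

lemma yields_edge_prog:
  assumes inv: "Inv x (arcs E) m" and xdiv: "\<And>i a. i \<le> n div q \<Longrightarrow> a < M * k \<Longrightarrow> x i a div q = i"
    and E: "E \<subseteq> edges_on n" and m5: "m 5 = card E"
    and e: "valid_stream_from n E [e]"
  shows "\<exists>t m'. yields w S t (edge_prog k M) (feed e m) (return_pmf m') \<and>
    Inv x (arcs (apply_update e E)) m' \<and> m' 5 = card (apply_update e E)"
proof -
  define u where "u = (case e of Insert u v \<Rightarrow> u | Delete u v \<Rightarrow> u)"
  define v where "v = (case e of Insert u v \<Rightarrow> v | Delete u v \<Rightarrow> v)"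
  define ins where "ins = (case e of Insert u v \<Rightarrow> 1 | Delete u v \<Rightarrow> (0::nat))"
  define E' where "E' = apply_update e E"
  define m0 where "m0 = feed e m"
  define m1 where "m1 = m0(5 := card E')"
  have ins: "ins \<le> 1" "ins = 1 \<Longrightarrow> {u, v} \<notin> E \<and> E' = insert {u, v} E"
    "ins \<noteq> 1 \<Longrightarrow> {u, v} \<in> E \<and> E' = E - {{u, v}}"
    using e by (cases e; auto simp: ins_def u_def v_def E'_def)+
  have "{u, v} \<in> edges_on n"
    using e E by (cases e) (auto simp: u_def v_def)
  then have uv: "u \<le> n" "v \<le> n" "u \<noteq> v" using edges_onD by auto
  have m0: "m0 1 = ins" "m0 2 = u" "m0 3 = v" "m0 0 = m 0" "m0 4 = m 4" "m0 5 = m 5"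
    "\<And>z. 8 \<le> z \<Longrightarrow> m0 z = m z"
    by (cases e; auto simp: m0_def ins_def u_def v_def)+
  have fin: "finite E" using E finite_edges_on by (rule finite_subset)
  have D: "arcs E \<subseteq> {1..n} \<times> {1..n}" using E by (rule arcs_subset)
  \<comment> \<open>The relation between the two halves of the update. As
    \<open>u \<noteq> v\<close>, the reverse pair is still untouched in it.\<close>
  define D1 where "D1 = (if ins = 1 then insert (u, v) (arcs E) else arcs E - {(u, v)})"
  have D1: "D1 \<subseteq> {1..n} \<times> {1..n}" "if ins = 1 then (u, v) \<notin> arcs E \<and> D1 = insert (u, v) (arcs E)
      else (u, v) \<in> arcs E \<and> D1 = arcs E - {(u, v)}"
    using D edges_onD[OF \<open>{u, v} \<in> edges_on n\<close>] ins by (auto simp: D1_def arcs_def)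
  have D2: "if ins = 1 then (v, u) \<notin> D1 \<and> arcs E' = insert (v, u) D1
      else (v, u) \<in> D1 \<and> arcs E' = D1 - {(v, u)}"
    using ins uv(3) by (auto simp: D1_def arcs_def insert_commute doubleton_eq_iff)
  have "card E \<le> n * n" using E by (rule card_edges_le)
  then have "m0 5 + 1 < 2 ^ w" using word_val m0 m5 by linarith
  moreover have "eval w (Const 1) m0 = 1" using w_pos by simp
  ultimately have "eval w (change_exp (cell 5) (Const 1)) m0 = card E'"
    using eval_change_exp[of m0 "cell 5" "Const 1"] m0 ins fin m5 eval_cell[of 5 m0] by auto
  moreover have "eval w (Const 5) m0 = 5" using word_val by simp
  ultimately have y0: "yields w S 1 (Store (Const 5) (change_exp (cell 5) (Const 1))) m0 (return_pmf m1)"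
    using yields_Store[of w "Const 5" m0 S "change_exp (cell 5) (Const 1)"] S by (simp only: m1_def)
  have "Inv x (arcs E) m1" using inv by (rule Inv_cong) (auto simp: m1_def m0)
  then obtain t2 m2 where m2: "yields w S t2 (arc_prog k M 2 3) m1 (return_pmf m2)" "Inv x D1 m2"
      "\<forall>z<8. m2 z = m1 z"
    using yields_arc_prog[of x "arcs E" m1 u v 2 3 D1] xdiv D uv m0 ins(1) D1 by (auto simp: m1_def)
  then obtain t3 m3 where m3: "yields w S t3 (arc_prog k M 3 2) m2 (return_pmf m3)" "Inv x (arcs E') m3"
      "\<forall>z<8. m3 z = m2 z"
    using yields_arc_prog[of x D1 m2 v u 3 2 "arcs E'"] xdiv D1(1) uv m0 ins(1) D2 by (auto simp: m1_def)
  have "m3 5 = card E'" using m3(3) m2(3) by (simp add: m1_def)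
  then show ?thesis
    using yields_Seq_det[OF y0 yields_Seq_det[OF m2(1) m3(1)]] m3(2)
    unfolding edge_prog_def m0_def E'_def by blast
qed

end

section \<open>Certified exploration\<close>

definition not_exp :: "aexp \<Rightarrow> aexp" where
  "not_exp e = Binop Equal e (Const 0)"

text \<open>Each factor is first turned into 0 or 1; a product of raw nonzero values could vanish
  modulo \<open>2 ^ w\<close>.\<close>

definition all_exp :: "aexp list \<Rightarrow> aexp" where
  "all_exp es = foldr (\<lambda>e c. Binop Times (Binop Less (Const 0) e) c) es (Const 1)"

definition sum_exp :: "aexp list \<Rightarrow> aexp" where
  "sum_exp es = foldr (Binop Plus) es (Const 0)"

definition first_exp :: "aexp list \<Rightarrow> aexp" where
  "first_exp es = foldr (\<lambda>e c. Binop Plus e (Binop Times (not_exp e) c)) es (Const 0)"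

lemma eval_not_exp: "0 < w \<Longrightarrow> eval w (not_exp e) m = of_bool (eval w e m = 0)"
  by (simp add: not_exp_def)

lemma eval_all_exp: "0 < w \<Longrightarrow> eval w (all_exp es) m = of_bool (\<forall>e\<in>set es. eval w e m \<noteq> 0)"
  by (induction es) (auto simp: all_exp_def)

lemma eval_sum_exp:
  "sum_list (map (\<lambda>e. eval w e m) es) < 2 ^ w \<Longrightarrow>
   eval w (sum_exp es) m = sum_list (map (\<lambda>e. eval w e m) es)"
  by (induction es) (auto simp: sum_exp_def)

lemma eval_first_exp:
  assumes "0 < w" "c < 2 ^ w" "\<And>e. e \<in> set es \<Longrightarrow> eval w e m = 0 \<or> eval w e m = c"
  shows "eval w (first_exp es) m = (if \<exists>e\<in>set es. eval w e m = c then c else 0)"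
  using assms(3)
proof (induction es)
  case Nil
  then show ?case by (simp add: first_exp_def)
next
  case (Cons e es)
  have "eval w (first_exp es) m = (if \<exists>e\<in>set es. eval w e m = c then c else 0)"
    using Cons by simp
  moreover have "eval w e m = 0 \<or> eval w e m = c" using Cons.prems by simp
  ultimately show ?case
    using assms(1,2) eval_not_exp[OF assms(1), of e m] by (auto simp: first_exp_def)
qed

text \<open>A sum with the single term \<open>n + v\<close> gives \<open>v\<close> after subtracting
  \<open>n\<close>, and the empty sum gives 0 by truncated subtraction. Sums with several terms give
  meaningless values, which are left to the certificate.\<close>

definition cand_exp :: "nat \<Rightarrow> nat \<Rightarrow> nat \<Rightarrow> aexp \<Rightarrow> nat \<Rightarrow> nat \<Rightarrow> aexp" where
  "cand_exp k M g c b' b = Binop Times (Binop Less (Const 0) c)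
     (Binop Minus (field k M c (g * k + b') (b + 2)) (cell 0))"

text \<open>\<open>cur_exp k M g t b\<close> evaluates to the vertex of colour \<open>b\<close> in group \<open>g\<close> found within \<open>t\<close> rounds of
  exploration from the vertex of colour 0 in the current block, or to 0 if there is none. The value is
  meaningful only if the component is sampled without collisions; \<open>check_exp\<close> certifies the result.\<close>

fun cur_exp :: "nat \<Rightarrow> nat \<Rightarrow> nat \<Rightarrow> nat \<Rightarrow> nat \<Rightarrow> aexp" where
  "cur_exp k M g 0 b =
     (if b = 0
      then Load (entry k (Binop Plus (Binop Times (cell 6) (Const (M * k))) (Const (g * k))) 0)
      else Const 0)"
| "cur_exp k M g (Suc t) b =
     first_exp (cur_exp k M g t b # map (\<lambda>b'. cand_exp k M g (cur_exp k M g t b') b' b) [0..<k])"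

definition adjacent_exp :: "nat \<Rightarrow> nat \<Rightarrow> nat \<Rightarrow> (nat \<Rightarrow> aexp) \<Rightarrow> nat \<Rightarrow> nat \<Rightarrow> aexp" where
  "adjacent_exp k M g c b b' = all_exp [c b',
     Binop Equal (field k M (c b) (g * k + b) (b' + 2)) (Binop Plus (cell 0) (c b'))]"

text \<open>The nested negations encode an implication, so that unoccupied colours, whose value is
  0, pass the test.\<close>

definition closed_exp :: "nat \<Rightarrow> nat \<Rightarrow> nat \<Rightarrow> (nat \<Rightarrow> aexp) \<Rightarrow> nat \<Rightarrow> aexp" where
  "closed_exp k M g c b = not_exp (all_exp [c b, not_exp (all_exp
     [Binop Equal (field k M (c b) (g * k + b) 0) (c b),
      Binop Equal (field k M (c b) (g * k + b) 1) (sum_exp (map (adjacent_exp k M g c b) [0..<k]))])])"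

definition distinct_exp :: "(nat \<Rightarrow> aexp) \<Rightarrow> nat \<times> nat \<Rightarrow> aexp" where
  "distinct_exp c p = not_exp (all_exp [c (fst p), Binop Equal (c (fst p)) (c (snd p))])"

definition cert_exp :: "nat \<Rightarrow> nat \<Rightarrow> nat \<Rightarrow> (nat \<Rightarrow> aexp) \<Rightarrow> aexp" where
  "cert_exp k M g c = all_exp
     ([c 0, Binop Less (sum_exp (map (\<lambda>b. all_exp [c b]) [0..<k])) (cell 0)] @
      map (\<lambda>b. Binop Less (c b) (Binop Plus (cell 0) (Const 1))) [0..<k] @
      map (closed_exp k M g c) [0..<k] @
      map (distinct_exp c) (filter (\<lambda>p. fst p \<noteq> snd p) (List.product [0..<k] [0..<k])))"

definition check_exp :: "nat \<Rightarrow> nat \<Rightarrow> nat \<Rightarrow> aexp" where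
  "check_exp k M g = cert_exp k M g (cur_exp k M g (k * k))"

section \<open>Soundness of the certificate\<close>

context sketch
begin

definition nbr_sum :: "(nat \<Rightarrow> nat \<Rightarrow> nat) \<Rightarrow> (nat \<times> nat) set \<Rightarrow> nat \<Rightarrow> nat \<Rightarrow> nat \<Rightarrow> nat" where
  "nbr_sum x D g u b = (\<Sum>v | (u, v) \<in> D. if x (v div q) (g * k + b) = v then n + v else 0)"

text \<open>Stated for arbitrary \<open>c\<close>, since colliding samples may make the exploration
  return anything; soundness has to come from the certificate alone.\<close>

definition cert :: "(nat \<Rightarrow> nat \<Rightarrow> nat) \<Rightarrow> (nat \<times> nat) set \<Rightarrow> nat \<Rightarrow> (nat \<Rightarrow> nat) \<Rightarrow> bool" where
  "cert x D g c \<longleftrightarrow> c 0 \<noteq> 0 \<and> card {b. b < k \<and> c b \<noteq> 0} < n \<and> (\<forall>b<k. c b \<le> n) \<and>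
     (\<forall>b<k. c b \<noteq> 0 \<longrightarrow> x (c b div q) (g * k + b) = c b \<and>
        card {v. (c b, v) \<in> D} = card {b'. b' < k \<and> c b' \<noteq> 0 \<and> nbr_sum x D g (c b) b' = n + c b'}) \<and>
     (\<forall>b<k. \<forall>b'<k. b \<noteq> b' \<longrightarrow> c b \<noteq> 0 \<longrightarrow> c b \<noteq> c b')"

lemma sum_list_of_bool: "sum_list (map (\<lambda>b. of_bool (P b)) [0..<j]) = card {b. b < j \<and> P b}"
proof -
  have "sum_list (map (\<lambda>b. of_bool (P b)) [0..<j]) = (\<Sum>b<j. of_bool (P b) :: nat)"
    by (simp add: interv_sum_list_conv_sum_set_nat atLeast0LessThan)
  also have "\<dots> = card ({..<j} \<inter> Collect P)" by (subst sum_of_bool_eq) auto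
  also have "{..<j} \<inter> Collect P = {b. b < j \<and> P b}" by auto
  finally show ?thesis .
qed

lemma card_below_le: "card {b. b < j \<and> P b} \<le> (j::nat)"
  using card_mono[of "{..<j}" "{b. b < j \<and> P b}"] by auto

lemma Inv_fields:
  assumes inv: "Inv x D m" and g: "g < M" and b: "b < k" and u: "u \<le> n" "x (u div q) (g * k + b) = u"
  shows "m (addr (u div q * (M * k) + (g * k + b)) 1) = card {v. (u, v) \<in> D}"
    and "b' < k \<Longrightarrow> m (addr (u div q * (M * k) + (g * k + b)) (b' + 2)) = nbr_sum x D g u b'"
proof -
  have a: "g * k + b < M * k" using g b by (rule mult_add_less)
  have i: "u div q \<le> n div q" using u(1) by (rule div_le_mono)
  show "m (addr (u div q * (M * k) + (g * k + b)) 1) = card {v. (u, v) \<in> D}"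
    using InvD(4)[OF inv i a, of 0] u(2) by (simp add: weight_def)
  show "m (addr (u div q * (M * k) + (g * k + b)) (b' + 2)) = nbr_sum x D g u b'" if "b' < k"
    using InvD(4)[OF inv i a, of "b' + 1"] that u(2) b by (simp add: weight_def nbr_sum_def)
qed

lemma eval_cert_exp:
  assumes inv: "Inv x D m" and g: "g < M"
  shows "eval w (cert_exp k M g ce) m \<noteq> 0 \<longleftrightarrow> cert x D g (\<lambda>b. eval w (ce b) m)"
proof -
  define c where "c b = eval w (ce b) m" for b
  note w = w_pos
  have cells: "eval w (cell 0) m = n" "m 4 = q" using eval_cell[of 0 m] InvD(1,2)[OF inv] by auto
  have W: "k < 2 ^ w" "n + n < 2 ^ w" using word_val by linarith+
  have "sum_list (map (\<lambda>e. eval w e m) (map (\<lambda>b. all_exp [ce b]) [0..<k])) = card {b. b < k \<and> c b \<noteq> 0}"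
    using sum_list_of_bool[of "\<lambda>b. c b \<noteq> 0" k] by (simp add: eval_all_exp[OF w] o_def c_def)
  then have cnt: "eval w (sum_exp (map (\<lambda>b. all_exp [ce b]) [0..<k])) m = card {b. b < k \<and> c b \<noteq> 0}"
    using eval_sum_exp[of w m "map (\<lambda>b. all_exp [ce b]) [0..<k]"] card_below_le[of k "\<lambda>b. c b \<noteq> 0"] W(1)
    by (simp only:)
  have small: "eval w (Binop Less (ce b) (Binop Plus (cell 0) (Const 1))) m \<noteq> 0 \<longleftrightarrow> c b \<le> n" for b
    using w cells W n1 by (auto simp: c_def)
  have dist: "eval w (distinct_exp ce p) m \<noteq> 0 \<longleftrightarrow> (c (fst p) \<noteq> 0 \<longrightarrow> c (fst p) \<noteq> c (snd p))" for p
    using w by (auto simp: distinct_exp_def eval_not_exp eval_all_exp c_def)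
  have clos: "eval w (closed_exp k M g ce b) m \<noteq> 0 \<longleftrightarrow>
      (c b \<noteq> 0 \<longrightarrow> x (c b div q) (g * k + b) = c b \<and>
        card {v. (c b, v) \<in> D} = card {b'. b' < k \<and> c b' \<noteq> 0 \<and> nbr_sum x D g (c b) b' = n + c b'})"
    if b: "b < k" and le: "\<And>b. b < k \<Longrightarrow> c b \<le> n" for b
  proof -
    have a: "g * k + b < M * k" using g b by (rule mult_add_less)
    have i: "c b div q \<le> n div q" using le[OF b] by (rule div_le_mono)
    have fld: "eval w (field k M (ce b) (g * k + b) f) m = m (addr (c b div q * (M * k) + (g * k + b)) f)"
      if "f < k + 2" for f
      using eval_field[of "ce b" m "g * k + b" f] le[OF b] cells(2) a that by (simp add: c_def)
    have f0: "eval w (field k M (ce b) (g * k + b) 0) m = x (c b div q) (g * k + b)"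
      using fld[of 0] InvD(3)[OF inv i a] by simp
    show ?thesis
    proof (cases "x (c b div q) (g * k + b) = c b")
      case True
      have f1: "eval w (field k M (ce b) (g * k + b) 1) m = card {v. (c b, v) \<in> D}"
        using fld[of 1] Inv_fields(1)[OF inv g b le[OF b] True] by simp
      have adj: "eval w (adjacent_exp k M g ce b b') m = of_bool (c b' \<noteq> 0 \<and> nbr_sum x D g (c b) b' = n + c b')"
        if "b' < k" for b'
      proof -
        have "eval w (field k M (ce b) (g * k + b) (b' + 2)) m = nbr_sum x D g (c b) b'"
          using fld[of "b' + 2"] Inv_fields(2)[OF inv g b le[OF b] True that] that by simp
        moreover have "n + c b' < 2 ^ w" using le[OF that] W by linarith
        ultimately show ?thesis
          using w cells by (simp add: adjacent_exp_def eval_all_exp c_def)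
      qed
      have "map (\<lambda>e. eval w e m) (map (adjacent_exp k M g ce b) [0..<k]) =
          map (\<lambda>b'. of_bool (c b' \<noteq> 0 \<and> nbr_sum x D g (c b) b' = n + c b')) [0..<k]"
        using adj by simp
      then have "eval w (sum_exp (map (adjacent_exp k M g ce b) [0..<k])) m =
          card {b'. b' < k \<and> c b' \<noteq> 0 \<and> nbr_sum x D g (c b) b' = n + c b'}"
        using eval_sum_exp[of w m "map (adjacent_exp k M g ce b) [0..<k]"] W(1)
          card_below_le[of k "\<lambda>b'. c b' \<noteq> 0 \<and> nbr_sum x D g (c b) b' = n + c b'"]
          sum_list_of_bool[of "\<lambda>b'. c b' \<noteq> 0 \<and> nbr_sum x D g (c b) b' = n + c b'" k]
        by (simp only:)
      then show ?thesis
        using f0 f1 True w by (simp add: closed_exp_def eval_not_exp eval_all_exp c_def)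
    next
      case False
      then show ?thesis
        using f0 w by (simp add: closed_exp_def eval_not_exp eval_all_exp c_def)
    qed
  qed
  have "eval w (cert_exp k M g ce) m \<noteq> 0 \<longleftrightarrow> c 0 \<noteq> 0 \<and> card {b. b < k \<and> c b \<noteq> 0} < n \<and>
      (\<forall>b<k. c b \<le> n) \<and> (\<forall>b<k. eval w (closed_exp k M g ce b) m \<noteq> 0) \<and>
      (\<forall>b<k. \<forall>b'<k. b \<noteq> b' \<longrightarrow> c b \<noteq> 0 \<longrightarrow> c b \<noteq> c b')"
  proof -
    have "eval w (cert_exp k M g ce) m \<noteq> 0 \<longleftrightarrow> eval w (ce 0) m \<noteq> 0 \<and>
        eval w (Binop Less (sum_exp (map (\<lambda>b. all_exp [ce b]) [0..<k])) (cell 0)) m \<noteq> 0 \<and>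
        (\<forall>b<k. eval w (Binop Less (ce b) (Binop Plus (cell 0) (Const 1))) m \<noteq> 0) \<and>
        (\<forall>b<k. eval w (closed_exp k M g ce b) m \<noteq> 0) \<and>
        (\<forall>b<k. \<forall>b'<k. b \<noteq> b' \<longrightarrow> eval w (distinct_exp ce (b, b')) m \<noteq> 0)"
      unfolding cert_exp_def eval_all_exp[OF w] by (force simp del: eval.simps)
    moreover have "eval w (Binop Less (sum_exp (map (\<lambda>b. all_exp [ce b]) [0..<k])) (cell 0)) m \<noteq> 0
        \<longleftrightarrow> card {b. b < k \<and> c b \<noteq> 0} < n"
      using w by (simp add: cnt cells)
    ultimately show ?thesis unfolding small dist by (simp add: c_def)
  qed
  \<comment> \<open>\<open>clos\<close> presupposes that all values of \<open>c\<close> are at most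
    \<open>n\<close>, which is one of the conjuncts; if it fails, both sides are false whatever the
    other reads return.\<close>
  also have "\<dots> \<longleftrightarrow> cert x D g c"
    unfolding cert_def using clos by blast
  finally show ?thesis by (simp add: c_def[abs_def])
qed

text \<open>The offset \<open>n\<close> makes any two terms of a neighbour sum exceed
  \<open>2 * n\<close>, so a sum \<open>n + c b'\<close> comes from the single neighbour
  \<open>c b'\<close>. Distinct colours give distinct neighbours, and their number equals the
  degree, so no neighbour is left outside. The found vertices form a closed, nonempty and proper
  subset.\<close>

lemma cert_imp_not_connected:
  assumes cert: "cert x (arcs E) g c" and E: "E \<subseteq> edges_on n"
  shows "\<not> connected_graph n E"
proof -
  define U where "U = c ` {b. b < k \<and> c b \<noteq> 0}"
  have "0 < k" using k1 by simp
  then have "U \<noteq> {}" using cert by (auto simp: U_def cert_def)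
  moreover have "U \<subseteq> {1..n}" using cert by (auto simp: U_def cert_def)
  moreover have "card U < n"
    using cert card_image_le[of "{b. b < k \<and> c b \<noteq> 0}" c] by (auto simp: U_def cert_def)
  moreover have "v \<in> U" if uv: "u \<in> U" "(u, v) \<in> arcs E" for u v
  proof -
    let ?N = "{v. (u, v) \<in> arcs E}"
    obtain b where b: "b < k" "u = c b" "c b \<noteq> 0" using uv(1) by (auto simp: U_def)
    define J where "J = {b'. b' < k \<and> c b' \<noteq> 0 \<and> nbr_sum x (arcs E) g u b' = n + c b'}"
    have sub: "?N \<subseteq> {1..n}" using arcs_subset[OF E] by auto
    have fin: "finite ?N" using sub by (rule finite_subset) simp
    have "c b' \<in> ?N" if b': "b' \<in> J" for b'
    proof -
      define T where "T = {v \<in> ?N. x (v div q) (g * k + b') = v}"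
      have finT: "finite T" using fin by (simp add: T_def)
      have "nbr_sum x (arcs E) g u b' = (\<Sum>v\<in>T. n + v)"
        unfolding nbr_sum_def T_def by (rule sum.inter_filter[OF fin, symmetric])
      then have T: "(\<Sum>v\<in>T. n + v) = n + c b'" using b' by (simp add: J_def)
      have cb: "1 \<le> c b'" "c b' \<le> n" using b' cert by (auto simp: J_def cert_def)
      have "T \<noteq> {}" using T cb by auto
      then obtain y where y: "y \<in> T" by blast
      have rest: "n + y + (\<Sum>v\<in>T - {y}. n + v) = n + c b'"
        using T sum.remove[OF finT y, of "\<lambda>v. n + v"] by simp
      have "T - {y} = {}"
      proof (rule ccontr)
        assume "T - {y} \<noteq> {}"
        then obtain z where z: "z \<in> T - {y}" by blast
        have "n + z \<le> (\<Sum>v\<in>T - {y}. n + v)" using finT z by (intro member_le_sum) auto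
        moreover have "1 \<le> y" using y sub by (auto simp: T_def)
        ultimately show False using rest cb by linarith
      qed
      then have "(\<Sum>v\<in>T - {y}. n + v) = 0" by (simp only: sum.empty)
      then have "y = c b'" using rest by linarith
      then show ?thesis using y by (simp add: T_def)
    qed
    then have im: "c ` J \<subseteq> ?N" by blast
    have "inj_on c J"
      using cert unfolding cert_def J_def inj_on_def by blast
    then have "card (c ` J) = card ?N"
      using cert b by (simp add: card_image cert_def J_def)
    then have "c ` J = ?N" using im fin by (intro card_subset_eq) auto
    then have "v \<in> c ` J" using uv(2) by blast
    then show "v \<in> U" by (auto simp: U_def J_def)
  qed
  ultimately show ?thesis by (rule closed_set_not_connected)
qed

end

text \<open>A disjunction by De Morgan; including cell 7 preserves a rejection found in an earlier
  block.\<close>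

definition scan_exp :: "nat \<Rightarrow> nat \<Rightarrow> aexp" where
  "scan_exp k M = not_exp (all_exp (map not_exp (cell 7 # map (check_exp k M) [0..<M])))"

text \<open>All \<open>M\<close> checks, each with \<open>k * k\<close> rounds of exploration, form
  one expression whose size depends on \<open>k\<close> and \<open>M\<close> only. An iteration thus
  takes constantly many steps and writes to cells 6 and 7 only.\<close>

definition scan_loop :: "nat \<Rightarrow> nat \<Rightarrow> com" where
  "scan_loop k M = While (Binop Less (Binop Times (cell 6) (cell 4)) (Binop Plus (cell 0) (Const 1)))
     (Seq (Store (Const 7) (scan_exp k M)) (Store (Const 6) (Binop Plus (cell 6) (Const 1))))"

definition verdict_prog :: "nat \<Rightarrow> nat \<Rightarrow> com" where
  "verdict_prog k M = Seq (Store (Const 6) (Const 0))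
     (Seq (Store (Const 7) (Binop Less (Binop Plus (cell 5) (Const 1)) (cell 0)))
        (Seq (scan_loop k M) (Store (Const 0) (not_exp (cell 7)))))"

section \<open>Exploration of a caught component\<close>

context sketch
begin

context
  fixes E :: "nat set set" and C :: "nat set" and x :: "nat \<Rightarrow> nat \<Rightarrow> nat" and g :: nat
  assumes E: "E \<subseteq> edges_on n" and C: "C \<in> graph_components n E" and Ck: "card C \<le> k" and g: "g < M"
    and hits: "\<And>j b. j < card C \<Longrightarrow> b < k \<Longrightarrow>
      x (sorted_list_of_set C ! j div q) (g * k + b) = sorted_list_of_set C ! j \<longleftrightarrow> j = b"
begin

definition vertex :: "nat \<Rightarrow> nat" where
  "vertex b = sorted_list_of_set C ! b"

lemma vertex_eq_iff: "j < card C \<Longrightarrow> b < card C \<Longrightarrow> vertex j = vertex b \<longleftrightarrow> j = b"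
  by (simp add: vertex_def nth_eq_iff_index_eq finite_component[OF C])

lemma vertex_in: "j < card C \<Longrightarrow> vertex j \<in> C"
  using finite_component[OF C]
  by (metis vertex_def nth_mem set_sorted_list_of_set sorted_list_of_set.length_sorted_key_list_of_set)

lemma vertex_surj: "v \<in> C \<Longrightarrow> \<exists>j<card C. v = vertex j"
  using finite_component[OF C]
  by (metis vertex_def in_set_conv_nth set_sorted_list_of_set sorted_list_of_set.length_sorted_key_list_of_set)

lemma vertex_bounds: "j < card C \<Longrightarrow> 1 \<le> vertex j \<and> vertex j \<le> n"
  using vertex_in component_subset[OF C] by fastforce

lemma x_vertex: "j < card C \<Longrightarrow> b < k \<Longrightarrow> x (vertex j div q) (g * k + b) = vertex j \<longleftrightarrow> j = b"
  using hits by (simp add: vertex_def)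

text \<open>All neighbours stay in the component, and there colour \<open>b\<close> marks only
  \<open>vertex b\<close>; at most one term survives.\<close>

lemma nbr_sum_component:
  assumes "j < card C" "b < k"
  shows "nbr_sum x (arcs E) g (vertex j) b =
    (if b < card C \<and> (vertex j, vertex b) \<in> arcs E then n + vertex b else 0)"
proof -
  let ?N = "{v. (vertex j, v) \<in> arcs E}"
  have fin: "finite ?N"
    by (rule finite_subset[of _ "{1..n}"]) (use arcs_subset[OF E] in auto)
  have eq: "x (v div q) (g * k + b) = v \<longleftrightarrow> b < card C \<and> v = vertex b" if v: "v \<in> ?N" for v
  proof -
    have "v \<in> C" using component_closed[OF C E vertex_in[OF assms(1)]] v by simp
    then obtain i where "i < card C" "v = vertex i" using vertex_surj by blast
    then show ?thesis using x_vertex[of i b] assms(2) vertex_eq_iff[of i b] by auto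
  qed
  have "nbr_sum x (arcs E) g (vertex j) b = (\<Sum>v\<in>?N. if b < card C \<and> v = vertex b then n + v else 0)"
    unfolding nbr_sum_def using eq by (intro sum.cong) auto
  also have "\<dots> = (if b < card C \<and> vertex b \<in> ?N then n + vertex b else 0)"
    using fin by (cases "b < card C") (simp_all add: sum.delta)
  finally show ?thesis by simp
qed

definition near :: "nat \<Rightarrow> nat set" where
  "near t = {v. \<exists>j\<le>t. (vertex 0, v) \<in> arcs E ^^ j}"

lemma card_C_pos: "0 < card C"
  using card_component[OF C] by simp

lemma near_0: "near 0 = {vertex 0}"
  by (auto simp: near_def)

lemma near_subset: "near t \<subseteq> C"
proof -
  have "v \<in> C" if "(vertex 0, v) \<in> arcs E ^^ j" for v j
    using that
  proof (induction j arbitrary: v)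
    case 0
    then show ?case using vertex_in[OF card_C_pos] by simp
  next
    case (Suc j)
    then obtain y where "(vertex 0, y) \<in> arcs E ^^ j" "(y, v) \<in> arcs E" by auto
    then show ?case using Suc.IH component_closed[OF C E] by blast
  qed
  then show ?thesis by (auto simp: near_def)
qed

lemma near_Suc: "near (Suc t) = near t \<union> arcs E `` near t"
proof
  show "near (Suc t) \<subseteq> near t \<union> arcs E `` near t"
  proof
    fix v assume "v \<in> near (Suc t)"
    then obtain j where j: "j \<le> Suc t" "(vertex 0, v) \<in> arcs E ^^ j" by (auto simp: near_def)
    show "v \<in> near t \<union> arcs E `` near t"
    proof (cases "j \<le> t")
      case True
      then show ?thesis using j by (auto simp: near_def)
    next
      case False
      then have "(vertex 0, v) \<in> arcs E ^^ Suc t" using j by (simp add: le_Suc_eq)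
      then show ?thesis by (auto simp: near_def)
    qed
  qed
  show "near t \<union> arcs E `` near t \<subseteq> near (Suc t)"
  proof
    fix v assume "v \<in> near t \<union> arcs E `` near t"
    then consider "v \<in> near t" | y j where "j \<le> t" "(vertex 0, y) \<in> arcs E ^^ j" "(y, v) \<in> arcs E"
      by (auto simp: near_def)
    then show "v \<in> near (Suc t)"
    proof cases
      case 1
      then show ?thesis by (auto simp: near_def intro: le_SucI)
    next
      case 2
      then have "(vertex 0, v) \<in> arcs E ^^ Suc j" by auto
      then show ?thesis using 2(1) unfolding near_def by blast
    qed
  qed
qed

lemma near_final: "near (k * k) = C"
proof
  show "near (k * k) \<subseteq> C" by (rule near_subset)
  show "C \<subseteq> near (k * k)"
  proof
    fix v assume v: "v \<in> C"
    \<comment> \<open>Restricted to \<open>C\<close> the relation has at most \<open>k * k\<close>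
      pairs, which bounds the length of some walk to \<open>v\<close>; hence the
      \<open>k * k\<close> rounds in \<open>check_exp\<close>.\<close>
    define R where "R = arcs E \<inter> C \<times> C"
    have "(vertex 0, v) \<in> (arcs E)\<^sup>*"
      using component_reach[OF C vertex_in[OF card_C_pos] v] .
    then have "(vertex 0, v) \<in> R\<^sup>* \<and> v \<in> C"
    proof (induction rule: rtrancl_induct)
      case base
      then show ?case using vertex_in[OF card_C_pos] by simp
    next
      case (step y z)
      then have "z \<in> C" using component_closed[OF C E] by blast
      then have "(y, z) \<in> R" using step by (simp add: R_def)
      then show ?case using step \<open>z \<in> C\<close> by (meson rtrancl.rtrancl_into_rtrancl)
    qed
    moreover have fin: "finite (C \<times> C)" using finite_component[OF C] by simp
    then have finR: "finite R" by (simp add: R_def)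
    ultimately obtain j where j: "j \<le> card R" "(vertex 0, v) \<in> R ^^ j"
      using rtrancl_finite_eq_relpow[OF finR] by blast
    have "card R \<le> card (C \<times> C)" using fin by (intro card_mono) (auto simp: R_def)
    also have "\<dots> \<le> k * k" using Ck by (simp add: card_cartesian_product mult_le_mono)
    finally have "j \<le> k * k" using j(1) by simp
    moreover have "R ^^ j \<subseteq> arcs E ^^ j"
      by (induction j) (auto simp: R_def relcomp_unfold)
    then have "(vertex 0, v) \<in> arcs E ^^ j" using j(2) by blast
    ultimately show "v \<in> near (k * k)" by (auto simp: near_def)
  qed
qed

text \<open>\<open>t\<close> rounds reveal exactly the ball of radius \<open>t\<close> around
  \<open>vertex 0\<close>. In a caught component every candidate for colour \<open>b\<close> is 0 or
  \<open>vertex b\<close>, so it does not matter which nonzero candidate \<open>first_exp\<close>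
  selects.\<close>

lemma eval_cur_exp:
  assumes inv: "Inv x (arcs E) m" and m6: "m 6 = vertex 0 div q" and b: "b < k"
  shows "eval w (cur_exp k M g t b) m = (if b < card C \<and> vertex b \<in> near t then vertex b else 0)"
  using b
proof (induction t arbitrary: b)
  case 0
  show ?case
  proof (cases "b = 0")
    case True
    have i: "vertex 0 div q \<le> n div q"
      using vertex_bounds[OF card_C_pos] by (intro div_le_mono) simp
    have a: "g * k + 0 < M * k" using g 0 by (intro mult_add_less) auto
    define e where "e = Binop Plus (Binop Times (cell 6) (Const (M * k))) (Const (g * k))"
    have lt: "vertex 0 div q * (M * k) + g * k < (n div q + 1) * (M * k)" using entry_index_less[OF i a] by simp
    have "(n div q + 1) * (M * k) * 1 \<le> (n div q + 2) * (M * k) * (k + 2)"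
      by (intro mult_le_mono mult_le_mono1) auto
    then have lt': "vertex 0 div q * (M * k) + g * k < 2 ^ w" using lt word_addr by linarith
    moreover have "1 * (M * k) * 1 \<le> (n div q + 2) * (M * k) * (k + 2)"
      by (intro mult_le_mono mult_le_mono1) auto
    then have "M * k < 2 ^ w" using word_addr by linarith
    ultimately have "eval w e m = vertex 0 div q * (M * k) + g * k"
      using a eval_cell[of 6 m] m6 by (simp add: e_def)
    then have "eval w (Load (entry k e 0)) m = m (addr (vertex 0 div q * (M * k) + g * k) 0)"
      using eval_entry[of e m 0] lt by simp
    also have "\<dots> = x (vertex 0 div q) (g * k)" using InvD(3)[OF inv i a] by simp
    also have "\<dots> = vertex 0" using x_vertex[OF card_C_pos, of 0] 0 True by simp
    finally show ?thesis using True card_C_pos by (simp add: e_def near_0)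
  next
    case False
    then show ?thesis using vertex_eq_iff[of b 0] card_C_pos by (auto simp: near_0)
  qed
next
  case (Suc t)
  have cells: "eval w (cell 0) m = n" "m 4 = q" using eval_cell[of 0 m] InvD(1,2)[OF inv] by auto
  define c where "c = (if b < card C then vertex b else 0)"
  have cn: "c \<le> n" using vertex_bounds[of b] by (simp add: c_def)
  then have cw: "c < 2 ^ w" using word_val by linarith
  have cand: "eval w (cand_exp k M g (cur_exp k M g t b') b' b) m =
      (if b' < card C \<and> vertex b' \<in> near t \<and> b < card C \<and> (vertex b', vertex b) \<in> arcs E then c else 0)"
    if b': "b' < k" for b'
  proof (cases "b' < card C \<and> vertex b' \<in> near t")
    case True
    then have v: "eval w (cur_exp k M g t b') m = vertex b'" using Suc.IH[OF b'] by simp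
    have vb: "1 \<le> vertex b'" "vertex b' \<le> n" using vertex_bounds[of b'] True by auto
    have a: "g * k + b' < M * k" using g b' by (rule mult_add_less)
    have "eval w (field k M (cur_exp k M g t b') (g * k + b') (b + 2)) m =
        m (addr (vertex b' div q * (M * k) + (g * k + b')) (b + 2))"
      using eval_field[of "cur_exp k M g t b'" m "g * k + b'" "b + 2"] v vb cells a Suc.prems by simp
    also have "\<dots> = nbr_sum x (arcs E) g (vertex b') b"
      using Inv_fields(2)[OF inv g b' vb(2) _ Suc.prems] x_vertex[of b' b'] True b' by simp
    also have "\<dots> = (if b < card C \<and> (vertex b', vertex b) \<in> arcs E then n + vertex b else 0)"
      using nbr_sum_component[of b' b] True Suc.prems by simp
    finally have "eval w (field k M (cur_exp k M g t b') (g * k + b') (b + 2)) m =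
      (if b < card C \<and> (vertex b', vertex b) \<in> arcs E then n + vertex b else 0)" .
    then show ?thesis
      using v vb cells cw w_pos True by (auto simp: cand_exp_def c_def)
  next
    case False
    then show ?thesis using Suc.IH[OF b'] w_pos by (auto simp: cand_exp_def)
  qed
  define es where "es = cur_exp k M g t b # map (\<lambda>b'. cand_exp k M g (cur_exp k M g t b') b' b) [0..<k]"
  have "eval w e m = 0 \<or> eval w e m = c" if "e \<in> set es" for e
    using that Suc.IH[OF Suc.prems] cand by (auto simp: es_def c_def)
  then have first: "eval w (first_exp es) m = (if \<exists>e\<in>set es. eval w e m = c then c else 0)"
    using eval_first_exp[OF w_pos cw] by blast
  show ?case
  proof (cases "b < card C")
    case True
    have c0: "c \<noteq> 0" using vertex_bounds[of b] True by (auto simp: c_def)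
    have "(\<exists>e\<in>set es. eval w e m = c) \<longleftrightarrow> vertex b \<in> near t \<or>
        (\<exists>b'<k. b' < card C \<and> vertex b' \<in> near t \<and> (vertex b', vertex b) \<in> arcs E)"
      using Suc.IH[OF Suc.prems] cand c0 True by (auto simp: es_def c_def)
    also have "\<dots> \<longleftrightarrow> vertex b \<in> near (Suc t)"
      unfolding near_Suc using near_subset[of t] vertex_surj Ck by (fastforce simp: Image_def)
    finally show ?thesis using first True by (simp add: es_def c_def)
  next
    case False
    then show ?thesis using first by (simp add: es_def c_def)
  qed
qed

text \<open>Each neighbour in a caught component carries a colour of its own, so counting colours
  counts neighbours; the positive sum \<open>n + vertex b'\<close> is told apart from the 0 of a
  non-neighbour.\<close>

lemma cert_component:
  assumes "card C < n"
  shows "cert x (arcs E) g (\<lambda>b. if b < card C then vertex b else 0)"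
proof -
  let ?c = "\<lambda>b. if b < card C then vertex b else 0"
  have nz: "b < k \<and> ?c b \<noteq> 0 \<longleftrightarrow> b < card C" for b
    using vertex_bounds[of b] Ck by auto
  have deg: "card {v. (vertex b, v) \<in> arcs E} =
      card {b'. b' < k \<and> ?c b' \<noteq> 0 \<and> nbr_sum x (arcs E) g (vertex b) b' = n + ?c b'}" if b: "b < card C" for b
  proof -
    let ?J = "{b'. b' < card C \<and> (vertex b, vertex b') \<in> arcs E}"
    have "{b'. b' < k \<and> ?c b' \<noteq> 0 \<and> nbr_sum x (arcs E) g (vertex b) b' = n + ?c b'} = ?J"
    proof (intro Collect_cong)
      fix b'
      show "b' < k \<and> ?c b' \<noteq> 0 \<and> nbr_sum x (arcs E) g (vertex b) b' = n + ?c b' \<longleftrightarrow>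
          b' < card C \<and> (vertex b, vertex b') \<in> arcs E"
      proof (cases "b' < card C")
        case True
        then show ?thesis
          using nz[of b'] nbr_sum_component[OF b, of b'] n1 by (simp split: if_splits)
      qed (use nz[of b'] in simp)
    qed
    moreover have "{v. (vertex b, v) \<in> arcs E} = vertex ` ?J"
      using component_closed[OF C E vertex_in[OF b]] vertex_surj by blast
    moreover have "inj_on vertex ?J" using vertex_eq_iff by (auto simp: inj_on_def)
    ultimately show ?thesis by (simp add: card_image)
  qed
  have "{b. b < k \<and> ?c b \<noteq> 0} = {..<card C}" using nz by auto
  then have "card {b. b < k \<and> ?c b \<noteq> 0} < n" using assms by simp
  moreover have "?c 0 \<noteq> 0" using vertex_bounds[OF card_C_pos] card_C_pos by simp
  moreover have "\<forall>b<k. ?c b \<le> n" using vertex_bounds by simp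
  moreover have "\<forall>b<k. ?c b \<noteq> 0 \<longrightarrow> x (?c b div q) (g * k + b) = ?c b \<and>
     card {v. (?c b, v) \<in> arcs E} =
     card {b'. b' < k \<and> ?c b' \<noteq> 0 \<and> nbr_sum x (arcs E) g (?c b) b' = n + ?c b'}"
  proof (intro allI impI)
    fix b assume "b < k" "?c b \<noteq> 0"
    then have b: "b < card C" "b < k" by (auto split: if_splits)
    show "x (?c b div q) (g * k + b) = ?c b \<and> card {v. (?c b, v) \<in> arcs E} =
     card {b'. b' < k \<and> ?c b' \<noteq> 0 \<and> nbr_sum x (arcs E) g (?c b) b' = n + ?c b'}"
      using x_vertex[OF b] deg[OF b(1)] b(1) by simp
  qed
  moreover have "\<forall>b<k. \<forall>b'<k. b \<noteq> b' \<longrightarrow> ?c b \<noteq> 0 \<longrightarrow> ?c b \<noteq> ?c b'"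
    using vertex_eq_iff by auto
  ultimately show ?thesis unfolding cert_def by blast
qed

lemma eval_check_component:
  assumes inv: "Inv x (arcs E) m" and m6: "m 6 = vertex 0 div q" and "card C < n"
  shows "eval w (check_exp k M g) m \<noteq> 0"
proof -
  have cur: "eval w (cur_exp k M g (k * k) b) m = (if b < card C then vertex b else 0)" if "b < k" for b
    using eval_cur_exp[OF inv m6 that, of "k * k"] near_final vertex_in by auto
  have "cert x (arcs E) g (\<lambda>b. eval w (cur_exp k M g (k * k) b) m) \<longleftrightarrow>
      cert x (arcs E) g (\<lambda>b. if b < card C then vertex b else 0)"
    unfolding cert_def using cur k1 by (auto cong: conj_cong)
  then show ?thesis
    using cert_component[OF assms(3)] eval_cert_exp[OF inv g] unfolding check_exp_def by blast
qed

end

end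

section \<open>Programs for set-up and verdict\<close>

primrec pow_exp :: "aexp \<Rightarrow> nat \<Rightarrow> aexp" where
  "pow_exp e 0 = Const 1"
| "pow_exp e (Suc j) = Binop Times e (pow_exp e j)"

text \<open>With a base of at least 1 the partial powers do not exceed the last one, so none of them
  is reduced.\<close>

lemma eval_pow_exp:
  assumes "0 < w" "1 \<le> eval w e m" "eval w e m ^ j < 2 ^ w"
  shows "eval w (pow_exp e j) m = eval w e m ^ j"
  using assms(3)
proof (induction j)
  case 0
  then show ?case using assms(1) by simp
next
  case (Suc j)
  have "eval w e m ^ j \<le> eval w e m ^ Suc j" using assms(2) by (intro power_increasing) auto
  then have "eval w (pow_exp e j) m = eval w e m ^ j"
    using Suc by (intro Suc.IH) (rule le_less_trans)
  then show ?case using Suc.prems by simp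
qed

text \<open>Finds the largest \<open>q\<close> with \<open>q ^ k \<le> B * n\<close> by unit steps
  from 0. The slow search is harmless because initialization has to halt but carries no time
  bound.\<close>

definition root_loop :: "nat \<Rightarrow> nat \<Rightarrow> com" where
  "root_loop k B = While (Binop Less (pow_exp (Binop Plus (cell 4) (Const 1)) k)
       (Binop Plus (Binop Times (Const B) (cell 0)) (Const 1)))
     (Store (Const 4) (Binop Plus (cell 4) (Const 1)))"

definition offset_exp :: "nat \<Rightarrow> nat \<Rightarrow> aexp" where
  "offset_exp k M = Binop Times (Binop Div (cell 6) (Const (M * k))) (cell 4)"

text \<open>Cell 6 runs through the record indices; record \<open>j\<close> belongs to block
  \<open>j div (M * k)\<close>. \<open>Rand\<close> includes its upper bound, hence
  \<open>q - 1\<close>, and the start of the block is added afterwards so that the record holds the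
  drawn number itself.\<close>

definition draw_loop :: "nat \<Rightarrow> nat \<Rightarrow> com" where
  "draw_loop k M = While (Binop Less (offset_exp k M) (Binop Plus (cell 0) (Const 1)))
     (Seq (Rand (entry k (cell 6) 0) (Binop Minus (cell 4) (Const 1)))
       (Seq (Store (entry k (cell 6) 0) (Binop Plus (Load (entry k (cell 6) 0)) (offset_exp k M)))
         (Store (Const 6) (Binop Plus (cell 6) (Const 1)))))"

definition setup_prog :: "nat \<Rightarrow> nat \<Rightarrow> nat \<Rightarrow> com" where
  "setup_prog k M B = Seq (root_loop k B) (draw_loop k M)"

section \<open>Effect and running time of the scan\<close>

context sketch
begin

lemma S_ge: "8 \<le> S"
  by (simp add: S)

lemma yields_Store_cell:
  assumes "c < 8" "eval w e m = y"
  shows "yields w S 1 (Store (Const c) e) m (return_pmf (m(c := y)))"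
proof -
  have "eval w (Const c) m = c" using assms(1) word_val by simp
  then show ?thesis using yields_Store[of w "Const c" m S e] assms S_ge by (simp only:)
qed

lemma eval_scan_exp:
  "eval w (scan_exp k M) m = of_bool (m 7 \<noteq> 0 \<or> (\<exists>g<M. eval w (check_exp k M g) m \<noteq> 0))"
  using w_pos eval_cell[of 7 m] by (auto simp: scan_exp_def eval_not_exp eval_all_exp)

lemma block_iff: "i * q < n + 1 \<longleftrightarrow> i \<le> n div q"
  using q1 by (simp add: less_eq_div_iff_mult_less_eq less_Suc_eq_le)

lemma block_mult_le: "i \<le> n div q + 1 \<Longrightarrow> i * q \<le> n + q"
proof -
  assume "i \<le> n div q + 1"
  then have "i * q \<le> (n div q + 1) * q" by (rule mult_le_mono1)
  also have "\<dots> = n div q * q + q" by simp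
  also have "\<dots> \<le> n + q" by (intro add_right_mono) simp
  finally show ?thesis .
qed

lemma Inv_cells:
  assumes "Inv x D m"
  shows "Inv x D (m(6 := y))" "Inv x D (m(7 := z))"
  using assms by (auto intro: Inv_cong)

text \<open>Both implications quantify over all memories satisfying the invariant, because the loop
  changes cells 6 and 7 between checks. The first serves soundness, as a newly raised flag needs a
  successful check; the second serves completeness, as a block where some check always succeeds
  raises the flag.\<close>

lemma yields_scan_loop:
  assumes "Inv x D m" "m 6 = i" "i + d = n div q + 1"
  shows "\<exists>m'. yields w S (5 * d + 1) (scan_loop k M) m (return_pmf m') \<and>
    (m' 7 \<noteq> 0 \<longrightarrow> m 7 \<noteq> 0 \<or> (\<exists>m'' g. Inv x D m'' \<and> g < M \<and> eval w (check_exp k M g) m'' \<noteq> 0)) \<and>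
    ((m 7 \<noteq> 0 \<or> (\<exists>i'\<ge>i. i' \<le> n div q \<and> (\<forall>m''. Inv x D m'' \<longrightarrow> m'' 6 = i' \<longrightarrow>
        (\<exists>g<M. eval w (check_exp k M g) m'' \<noteq> 0)))) \<longrightarrow> m' 7 \<noteq> 0)"
  using assms
proof (induction d arbitrary: i m)
  case (0 i m)
  have cells: "eval w (cell 6) m = i" "eval w (cell 4) m = q" "eval w (cell 0) m = n"
    using eval_cell 0 InvD(1,2) by auto
  have "i * q < 2 ^ w" "n + 1 < 2 ^ w" "1 < (2::nat) ^ w"
    using block_mult_le[of i] 0 word_val by linarith+
  moreover have "\<not> i * q < n + 1" using block_iff[of i] 0 by simp
  ultimately have "yields w S 1 (scan_loop k M) m (return_pmf m)"
    unfolding scan_loop_def using cells by (intro yields_While_end) simp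
  then show ?case using 0 by auto
next
  case (Suc d i m)
  define m1 where "m1 = m(7 := eval w (scan_exp k M) m)"
  define m2 where "m2 = m1(6 := i + 1)"
  have cells: "eval w (cell 6) m = i" "eval w (cell 4) m = q" "eval w (cell 0) m = n"
    using eval_cell Suc.prems InvD(1,2) by auto
  have i: "i \<le> n div q" using Suc.prems by simp
  have W: "i * q < 2 ^ w" "n + 1 < 2 ^ w" "i + 1 < 2 ^ w" "1 < (2::nat) ^ w"
    using block_mult_le[of i] i word_val div_le_dividend[of n q] by linarith+
  have inv2: "Inv x D m2" unfolding m2_def m1_def using Suc.prems by (intro Inv_cells)
  have m26: "m2 6 = i + 1" and d: "i + 1 + d = n div q + 1" using Suc.prems(3) by (auto simp: m2_def)
  have y1: "yields w S 1 (Store (Const 7) (scan_exp k M)) m (return_pmf m1)"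
    unfolding m1_def by (rule yields_Store_cell) auto
  have "eval w (Binop Plus (cell 6) (Const 1)) m1 = i + 1"
    using W w_pos eval_cell[of 6 m1] Suc.prems by (simp add: m1_def)
  then have y2: "yields w S 1 (Store (Const 6) (Binop Plus (cell 6) (Const 1))) m1 (return_pmf m2)"
    unfolding m2_def by (intro yields_Store_cell) auto
  have cond: "eval w (Binop Less (Binop Times (cell 6) (cell 4)) (Binop Plus (cell 0) (Const 1))) m \<noteq> 0"
    using W w_pos cells block_iff[of i] i by simp
  obtain m' where m': "yields w S (5 * d + 1) (scan_loop k M) m2 (return_pmf m')"
    "m' 7 \<noteq> 0 \<longrightarrow> m2 7 \<noteq> 0 \<or> (\<exists>m'' g. Inv x D m'' \<and> g < M \<and> eval w (check_exp k M g) m'' \<noteq> 0)"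
    "m2 7 \<noteq> 0 \<or> (\<exists>i'\<ge>i + 1. i' \<le> n div q \<and> (\<forall>m''. Inv x D m'' \<longrightarrow> m'' 6 = i' \<longrightarrow>
        (\<exists>g<M. eval w (check_exp k M g) m'' \<noteq> 0))) \<longrightarrow> m' 7 \<noteq> 0"
    using Suc.IH[OF inv2 m26 d] by (elim exE conjE) (rule that)
  have "yields w S (1 + 1 + 1 + (5 * d + 1) + 2) (scan_loop k M) m (return_pmf m')"
    unfolding scan_loop_def
    by (rule yields_While_step_det[OF cond yields_Seq_det[OF y1 y2] m'(1)[unfolded scan_loop_def]])
  then have Y: "yields w S (5 * Suc d + 1) (scan_loop k M) m (return_pmf m')"
    by (rule yields_mono) simp
  have m27: "m2 7 \<noteq> 0 \<longleftrightarrow> m 7 \<noteq> 0 \<or> (\<exists>g<M. eval w (check_exp k M g) m \<noteq> 0)"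
    by (simp add: m2_def m1_def eval_scan_exp)
  have sound: "m' 7 \<noteq> 0 \<longrightarrow> m 7 \<noteq> 0 \<or> (\<exists>m'' g. Inv x D m'' \<and> g < M \<and> eval w (check_exp k M g) m'' \<noteq> 0)"
    using m'(2) m27 Suc.prems(1) by blast
  have compl: "m' 7 \<noteq> 0" if "m 7 \<noteq> 0 \<or> (\<exists>i'\<ge>i. i' \<le> n div q \<and> (\<forall>m''. Inv x D m'' \<longrightarrow> m'' 6 = i' \<longrightarrow>
        (\<exists>g<M. eval w (check_exp k M g) m'' \<noteq> 0)))"
    using that
  proof
    assume "m 7 \<noteq> 0"
    then show ?thesis using m'(3) m27 by blast
  next
    assume "\<exists>i'\<ge>i. i' \<le> n div q \<and> (\<forall>m''. Inv x D m'' \<longrightarrow> m'' 6 = i' \<longrightarrow>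
        (\<exists>g<M. eval w (check_exp k M g) m'' \<noteq> 0))"
    then obtain i' where i': "i \<le> i'" "i' \<le> n div q" "\<forall>m''. Inv x D m'' \<longrightarrow> m'' 6 = i' \<longrightarrow>
        (\<exists>g<M. eval w (check_exp k M g) m'' \<noteq> 0)" by blast
    show ?thesis
    proof (cases "i' = i")
      case True
      then show ?thesis using m'(3) m27 i'(3) Suc.prems(1,2) by blast
    next
      case False
      then have "i + 1 \<le> i'" using i'(1) by simp
      then show ?thesis using m'(3) i'(2,3) by blast
    qed
  qed
  show ?case using Y sound compl by blast
qed

lemma yields_verdict_prog:
  assumes inv: "Inv x D m" and m5: "m 5 \<le> n * n"
  shows "\<exists>m'. yields w S (5 * (n div q) + 20) (verdict_prog k M) m (return_pmf m') \<and>
    (m' 0 = 0 \<longrightarrow> m 5 + 1 < n \<or> (\<exists>m'' g. Inv x D m'' \<and> g < M \<and> eval w (check_exp k M g) m'' \<noteq> 0)) \<and>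
    (m 5 + 1 < n \<or> (\<exists>i\<le>n div q. \<forall>m''. Inv x D m'' \<longrightarrow> m'' 6 = i \<longrightarrow>
        (\<exists>g<M. eval w (check_exp k M g) m'' \<noteq> 0)) \<longrightarrow> m' 0 = 0)"
proof -
  define m1 where "m1 = m(6 := 0)"
  define m2 where "m2 = m1(7 := of_bool (m 5 + 1 < n))"
  have inv1: "Inv x D m1" unfolding m1_def by (rule Inv_cells(1)[OF inv])
  have inv2: "Inv x D m2" unfolding m2_def by (rule Inv_cells(2)[OF inv1])
  have m26: "m2 6 = 0" by (simp add: m2_def m1_def)
  have y1: "yields w S 1 (Store (Const 6) (Const 0)) m (return_pmf m1)"
    unfolding m1_def by (rule yields_Store_cell) auto
  have "m 5 + 1 < 2 ^ w" "1 < (2::nat) ^ w" using m5 word_val by linarith+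
  then have "eval w (Binop Less (Binop Plus (cell 5) (Const 1)) (cell 0)) m1 = of_bool (m 5 + 1 < n)"
    using eval_cell[of 5 m1] eval_cell[of 0 m1] InvD(1)[OF inv] w_pos by (simp add: m1_def)
  then have y2: "yields w S 1 (Store (Const 7) (Binop Less (Binop Plus (cell 5) (Const 1)) (cell 0))) m1 (return_pmf m2)"
    unfolding m2_def by (intro yields_Store_cell) auto
  obtain m3 where m3: "yields w S (5 * (n div q + 1) + 1) (scan_loop k M) m2 (return_pmf m3)"
    "m3 7 \<noteq> 0 \<longrightarrow> m2 7 \<noteq> 0 \<or> (\<exists>m'' g. Inv x D m'' \<and> g < M \<and> eval w (check_exp k M g) m'' \<noteq> 0)"
    "m2 7 \<noteq> 0 \<or> (\<exists>i'\<ge>0. i' \<le> n div q \<and> (\<forall>m''. Inv x D m'' \<longrightarrow> m'' 6 = i' \<longrightarrow>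
        (\<exists>g<M. eval w (check_exp k M g) m'' \<noteq> 0))) \<longrightarrow> m3 7 \<noteq> 0"
    using yields_scan_loop[OF inv2 m26 add_0] by (elim exE conjE) (rule that)
  define m4 where "m4 = m3(0 := of_bool (m3 7 = 0))"
  have "eval w (not_exp (cell 7)) m3 = of_bool (m3 7 = 0)"
    using eval_not_exp[OF w_pos, of "cell 7" m3] eval_cell[of 7 m3] by simp
  then have y4: "yields w S 1 (Store (Const 0) (not_exp (cell 7))) m3 (return_pmf m4)"
    unfolding m4_def by (intro yields_Store_cell) auto
  have y: "yields w S (5 * (n div q) + 20) (verdict_prog k M) m (return_pmf m4)"
    unfolding verdict_prog_def
    by (rule yields_mono[OF yields_Seq_det[OF y1 yields_Seq_det[OF y2 yields_Seq_det[OF m3(1) y4]]]]) simp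
  have m4: "m4 0 = 0 \<longleftrightarrow> m3 7 \<noteq> 0" by (simp add: m4_def)
  have m2: "m2 7 \<noteq> 0 \<longleftrightarrow> m 5 + 1 < n" by (simp add: m2_def)
  show ?thesis
    by (rule exI[of _ m4], intro conjI, rule y)
      (use m3(2,3) in \<open>simp_all only: m4 m2 le0 simp_thms\<close>)
qed

end

section \<open>Search for the block length and random draws\<close>

locale tester = sketch +
  fixes B :: nat
  assumes M1: "1 \<le> M"
    and root_le: "\<And>q'. q' < q \<Longrightarrow> (q' + 1) ^ k \<le> B * n" and root: "B * n < (q + 1) ^ k"
    and word_root: "(q + 1) ^ k + B * n + B + 1 < 2 ^ w"
begin

sublocale block_sampling n q "n div q + 1" "M * k"
  using q1 by unfold_locales auto

text \<open>The whole memory in closed form, including the cells that are still 0: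
  \<open>yields\<close> demands the exact law, so the set-up is tracked by a function of the draws
  rather than by an invariant.\<close>

definition drawn :: "(nat \<Rightarrow> nat) \<Rightarrow> nat \<Rightarrow> memory" where
  "drawn \<rho> j z =
     (if z = 0 then n else if z = 4 then q else if z = 6 then j
      else if 8 \<le> z \<and> (z - 8) mod (k + 2) = 0 \<and> (z - 8) div (k + 2) < j
      then (z - 8) div (k + 2) div (M * k) * q + \<rho> ((z - 8) div (k + 2)) else 0)"

definition sample :: "(nat \<Rightarrow> nat) \<Rightarrow> nat \<Rightarrow> nat \<Rightarrow> nat" where
  "sample \<rho> i a = i * q + \<rho> (i * (M * k) + a)"

lemma A_pos: "0 < M * k"
  using M1 k1 by simp

lemma drawn_addr:
  assumes "f < k + 2"
  shows "drawn \<rho> j (addr i f) = (if f = 0 \<and> i < j then i div (M * k) * q + \<rho> i else 0)"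
proof -
  have "(f + i * N) mod N = f \<and> (f + i * N) div N = i" if "f < N" for N :: nat
    using that by simp
  from this[OF assms] have "(addr i f - 8) mod (k + 2) = f" "(addr i f - 8) div (k + 2) = i"
    unfolding addr_def by (simp_all only: add.assoc diff_add_inverse)
  then show ?thesis
    unfolding drawn_def using addr_ge[of i f] by (cases "f = 0") (simp_all del: add_2_eq_Suc')
qed

lemma drawn_Suc:
  "drawn (\<rho>(j := y)) (j + 1) = (drawn \<rho> j)(addr j 0 := y + j div (M * k) * q, 6 := j + 1)"
proof
  fix z
  consider "z < 8" | i f where "z = addr i f" "f < k + 2"
  proof (cases "z < 8")
    case False
    have "z = addr ((z - 8) div (k + 2)) ((z - 8) mod (k + 2))"
      using False div_mult_mod_eq[of "z - 8" "k + 2"] unfolding addr_def by linarith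
    then show ?thesis using that(2)[of _ "(z - 8) mod (k + 2)"] by simp
  qed
  then show "drawn (\<rho>(j := y)) (j + 1) z = ((drawn \<rho> j)(addr j 0 := y + j div (M * k) * q, 6 := j + 1)) z"
  proof cases
    case 1
    then have "z \<noteq> addr j 0" using addr_ge[of j 0] by auto
    then show ?thesis using 1 by (simp add: drawn_def)
  next
    case 2
    have "z \<noteq> 6" using addr_ge[of i f] 2 by auto
    moreover have "z = addr j 0 \<longleftrightarrow> i = j \<and> f = 0" using addr_eq_iff[of f 0 i j] 2 by simp
    ultimately show ?thesis using 2 by (auto simp: drawn_addr)
  qed
qed

lemma yields_root_loop:
  assumes "q' + d = q"
  shows "yields w S (3 * d + 1) (root_loop k B) ((start_memory n)(4 := q'))
    (return_pmf ((start_memory n)(4 := q)))"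
  using assms
proof (induction d arbitrary: q')
  case (0 q')
  define m where "m = (start_memory n)(4 := q)"
  have cells: "eval w (cell 4) m = q" "eval w (cell 0) m = n"
    using eval_cell by (auto simp: m_def start_memory_def)
  have "q + 1 \<le> (q + 1) ^ k" using k1 power_increasing[of 1 k "q + 1"] by simp
  then have W: "q + 1 < 2 ^ w" "B < 2 ^ w" "B * n + 1 < 2 ^ w" "(q + 1) ^ k < 2 ^ w"
    using word_root by linarith+
  have e: "eval w (Binop Plus (cell 4) (Const 1)) m = q + 1" using cells W w_pos by simp
  have "eval w (pow_exp (Binop Plus (cell 4) (Const 1)) k) m = (q + 1) ^ k"
    using eval_pow_exp[OF w_pos, of "Binop Plus (cell 4) (Const 1)" m k] W(4) unfolding e by simp
  then have "yields w S 1 (root_loop k B) m (return_pmf m)"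
    unfolding root_loop_def using cells W w_pos root by (intro yields_While_end) simp
  moreover have "q' = q" using 0 by simp
  ultimately show ?case by (simp only: m_def mult_0_right add_0)
next
  case (Suc d q')
  define m where "m = (start_memory n)(4 := q')"
  have cells: "eval w (cell 4) m = q'" "eval w (cell 0) m = n"
    using eval_cell by (auto simp: m_def start_memory_def)
  have "q' < q" using Suc.prems by simp
  then have qk: "(q' + 1) ^ k \<le> B * n" by (rule root_le)
  have "q + 1 \<le> (q + 1) ^ k" using k1 power_increasing[of 1 k "q + 1"] by simp
  then have W: "q' + 1 < 2 ^ w" "B < 2 ^ w" "B * n + 1 < 2 ^ w" "(q' + 1) ^ k < 2 ^ w"
    using word_root qk \<open>q' < q\<close> by linarith+
  have e: "eval w (Binop Plus (cell 4) (Const 1)) m = q' + 1" using cells W w_pos by simp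
  have "eval w (pow_exp (Binop Plus (cell 4) (Const 1)) k) m = (q' + 1) ^ k"
    using eval_pow_exp[OF w_pos, of "Binop Plus (cell 4) (Const 1)" m k] W(4) unfolding e by simp
  then have cond: "eval w (Binop Less (pow_exp (Binop Plus (cell 4) (Const 1)) k)
       (Binop Plus (Binop Times (Const B) (cell 0)) (Const 1))) m \<noteq> 0"
    using cells W w_pos qk by simp
  have y: "yields w S 1 (Store (Const 4) (Binop Plus (cell 4) (Const 1))) m (return_pmf (m(4 := q' + 1)))"
    using e by (intro yields_Store_cell) auto
  have "m(4 := q' + 1) = (start_memory n)(4 := q' + 1)" by (simp only: m_def fun_upd_upd)
  then have IH: "yields w S (3 * d + 1) (root_loop k B) (m(4 := q' + 1)) (return_pmf ((start_memory n)(4 := q)))"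
    using Suc.IH[of "q' + 1"] Suc.prems by (simp only:)
  have "yields w S (1 + (3 * d + 1) + 2) (root_loop k B) m (return_pmf ((start_memory n)(4 := q)))"
    unfolding root_loop_def
    by (rule yields_While_step_det[OF cond y IH[unfolded root_loop_def]])
  then show ?case unfolding m_def by (rule yields_mono) simp
qed

lemma eval_offset_exp:
  assumes "m 6 = j" "m 4 = q" "j \<le> (n div q + 1) * (M * k)"
  shows "eval w (offset_exp k M) m = j div (M * k) * q" "j div (M * k) * q \<le> n + q"
proof -
  have "j div (M * k) \<le> (n div q + 1) * (M * k) div (M * k)" using assms(3) by (rule div_le_mono)
  also have "\<dots> = n div q + 1" using A_pos by (rule nonzero_mult_div_cancel_right[OF less_imp_neq[symmetric]])
  finally have jd: "j div (M * k) \<le> n div q + 1" .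
  then show le: "j div (M * k) * q \<le> n + q" by (rule block_mult_le)
  have "1 * (M * k) * 1 \<le> (n div q + 2) * (M * k) * (k + 2)"
    by (intro mult_le_mono mult_le_mono1) auto
  then have "M * k < 2 ^ w" using word_addr by linarith
  moreover have "j div (M * k) < 2 ^ w" "j div (M * k) * q < 2 ^ w"
    using jd le word_val div_le_dividend[of n q] by linarith+
  ultimately show "eval w (offset_exp k M) m = j div (M * k) * q"
    using assms eval_cell[of 6 m] eval_cell[of 4 m] by (simp add: offset_exp_def)
qed

lemma eval_entry_cell:
  assumes "m 6 = j" "j < (n div q + 1) * (M * k)"
  shows "eval w (entry k (cell 6) 0) m = addr j 0"
  using eval_entry[of "cell 6" m 0] eval_cell[of 6 m] assms by simp

lemma yields_draw_body:
  assumes j: "j < (n div q + 1) * (M * k)"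
  shows "yields w S 5
    (Seq (Rand (entry k (cell 6) 0) (Binop Minus (cell 4) (Const 1)))
       (Seq (Store (entry k (cell 6) 0) (Binop Plus (Load (entry k (cell 6) 0)) (offset_exp k M)))
         (Store (Const 6) (Binop Plus (cell 6) (Const 1)))))
    (drawn \<rho> j) (map_pmf (\<lambda>y. drawn (\<rho>(j := y)) (j + 1)) (pmf_of_set {..<q}))"
proof -
  define m where "m = drawn \<rho> j"
  define P where "P = map_pmf (\<lambda>y. m(addr j 0 := y)) (pmf_of_set {..<q})"
  define G where "G m' = m'(addr j 0 := m' (addr j 0) + j div (M * k) * q, 6 := j + 1)" for m' :: memory
  have m: "m 6 = j" "m 4 = q" by (auto simp: m_def drawn_def)
  have adS: "addr j 0 < S" using j by (intro addr_less_S) auto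
  have "q < 2 ^ w" using word_val by linarith
  then have "eval w (Binop Minus (cell 4) (Const 1)) m = q - 1"
    using eval_cell[of 4 m] m w_pos by simp
  moreover have "{..q - 1} = {..<q}" using q1 by auto
  ultimately have y1: "yields w S 1 (Rand (entry k (cell 6) 0) (Binop Minus (cell 4) (Const 1))) m P"
    using yields_Rand[of w "entry k (cell 6) 0" m S "Binop Minus (cell 4) (Const 1)"]
      eval_entry_cell[of m j, OF m(1) j] adS by (simp only: P_def)
  have y2: "yields w S 3 (Seq (Store (entry k (cell 6) 0) (Binop Plus (Load (entry k (cell 6) 0)) (offset_exp k M)))
         (Store (Const 6) (Binop Plus (cell 6) (Const 1)))) m' (return_pmf (G m'))"
    if m': "m' \<in> set_pmf P" for m'
  proof -
    obtain y where y: "m' = m(addr j 0 := y)" "y < q"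
      using m' q1 by (auto simp: P_def lessThan_empty_iff)
    have m'c: "m' 6 = j" "m' 4 = q" using m addr_ge[of j 0] by (auto simp: y)
    have off: "eval w (offset_exp k M) m' = j div (M * k) * q" "j div (M * k) * q \<le> n + q"
      using eval_offset_exp[of m' j, OF m'c] j by auto
    have "j < n div q * (M * k) + (M * k)" using j by (simp add: add.commute)
    then have "j div (M * k) < n div q + 1"
      using j by (intro less_mult_imp_div_less) 
    then have "j div (M * k) * q \<le> n" using block_iff[of "j div (M * k)"] by simp
    then have "y + j div (M * k) * q < 2 ^ w" using y(2) word_val by linarith
    then have e: "eval w (Binop Plus (Load (entry k (cell 6) 0)) (offset_exp k M)) m' = y + j div (M * k) * q"
      using off eval_entry_cell[of m' j, OF m'c(1) j] by (simp add: y(1))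
    define m2 where "m2 = m'(addr j 0 := y + j div (M * k) * q)"
    have s1: "yields w S 1 (Store (entry k (cell 6) 0) (Binop Plus (Load (entry k (cell 6) 0)) (offset_exp k M))) m' (return_pmf m2)"
      using yields_Store[of w "entry k (cell 6) 0" m' S "Binop Plus (Load (entry k (cell 6) 0)) (offset_exp k M)"]
        eval_entry_cell[of m' j, OF m'c(1) j] adS e by (simp only: m2_def)
    have "(n div q + 1) * (M * k) * 1 \<le> (n div q + 2) * (M * k) * (k + 2)"
      by (intro mult_le_mono mult_le_mono1) auto
    then have "j + 1 < 2 ^ w" using j word_addr by linarith
    moreover have "m2 6 = j" using m'c addr_ge[of j 0] by (auto simp: m2_def)
    ultimately have "eval w (Binop Plus (cell 6) (Const 1)) m2 = j + 1"
      using eval_cell[of 6 m2] w_pos by simp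
    then have s2: "yields w S 1 (Store (Const 6) (Binop Plus (cell 6) (Const 1))) m2 (return_pmf (m2(6 := j + 1)))"
      by (intro yields_Store_cell) auto
    have "m2(6 := j + 1) = G m'" by (simp add: m2_def G_def y(1))
    then show ?thesis using yields_Seq_det[OF s1 s2] by (simp add: numeral_3_eq_3)
  qed
  have "bind_pmf P (\<lambda>m'. return_pmf (G m')) = map_pmf (\<lambda>y. G (m(addr j 0 := y))) (pmf_of_set {..<q})"
    by (simp add: P_def map_pmf_def[symmetric] map_pmf_comp)
  also have "(\<lambda>y. G (m(addr j 0 := y))) = (\<lambda>y. drawn (\<rho>(j := y)) (j + 1))"
    by (rule ext) (simp only: G_def m_def drawn_Suc fun_upd_same fun_upd_upd)
  finally show ?thesis
    using yields_Seq[OF y1 y2] by (simp add: m_def)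
qed

text \<open>\<open>\<rho>0\<close> holds the draws made so far; the remaining ones form an
  independent product, from which the induction splits off index \<open>j\<close>.\<close>

lemma yields_draw_loop:
  assumes "j + d = (n div q + 1) * (M * k)"
  shows "yields w S (7 * d + 1) (draw_loop k M) (drawn \<rho>0 j)
    (map_pmf (\<lambda>\<rho>. drawn (\<lambda>i. if i < j then \<rho>0 i else \<rho> i) (j + d))
      (Pi_pmf {j..<j + d} 0 (\<lambda>_. pmf_of_set {..<q})))"
  using assms
proof (induction d arbitrary: j \<rho>0)
  case (0 j \<rho>0)
  define m where "m = drawn \<rho>0 j"
  have m: "m 6 = j" "m 4 = q" "m 0 = n" by (auto simp: m_def drawn_def)
  have j: "j = (n div q + 1) * (M * k)" using 0 by simp
  have "j div (M * k) = n div q + 1" using A_pos unfolding j by (intro nonzero_mult_div_cancel_right) simp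
  then have "\<not> j div (M * k) * q < n + 1" using block_iff[of "j div (M * k)"] by simp
  moreover have "n + 1 < 2 ^ w" using word_val by linarith
  ultimately have "yields w S 1 (draw_loop k M) m (return_pmf m)"
    unfolding draw_loop_def using eval_offset_exp(1)[of m j, OF m(1,2)] j eval_cell[of 0 m] m w_pos
    by (intro yields_While_end) simp
  moreover have "drawn (\<lambda>i. if i < j then \<rho>0 i else 0) j = m"
    unfolding m_def drawn_def by (rule ext) auto
  ultimately show ?case by (simp add: m_def)
next
  case (Suc d j \<rho>0)
  let ?U = "pmf_of_set {..<q}"
  define m where "m = drawn \<rho>0 j"
  have m: "m 6 = j" "m 4 = q" "m 0 = n" by (auto simp: m_def drawn_def)
  have j: "j < (n div q + 1) * (M * k)" using Suc.prems by linarith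
  then have "j div (M * k) < n div q + 1" by (rule less_mult_imp_div_less)
  then have jq: "j div (M * k) * q < n + 1" using block_iff[of "j div (M * k)"] by simp
  have cond: "eval w (Binop Less (offset_exp k M) (Binop Plus (cell 0) (Const 1))) m \<noteq> 0"
  proof -
    have "n + 1 < 2 ^ w" using word_val by linarith
    then show ?thesis
      using jq eval_offset_exp(1)[of m j, OF m(1,2)] j eval_cell[of 0 m] m w_pos by simp
  qed
  define R where "R \<rho> = map_pmf (\<lambda>\<rho>'. drawn (\<lambda>i. if i < j + 1 then \<rho> i else \<rho>' i) (j + 1 + d))
      (Pi_pmf {j + 1..<j + 1 + d} 0 (\<lambda>_. ?U))" for \<rho>
  have IH: "yields w S (7 * d + 1) (draw_loop k M) (drawn \<rho> (j + 1)) (R \<rho>)" for \<rho>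
    unfolding R_def using Suc.prems by (intro Suc.IH) simp
  \<comment> \<open>The loop rule wants the law of the continuation as a function of the memory,
    whereas \<open>R\<close> depends on the draws. \<open>outcome\<close> is such a function and
    agrees with \<open>R\<close> on the memories reached.\<close>
  define Q where "Q = outcome w S (draw_loop k M)"
  have Q: "Q (drawn \<rho> (j + 1)) = R \<rho>" for \<rho> unfolding Q_def using IH by (rule yields_outcome)
  have "yields w S (5 + (7 * d + 1) + 2) (draw_loop k M) m
      (bind_pmf (map_pmf (\<lambda>y. drawn (\<rho>0(j := y)) (j + 1)) ?U) Q)"
    unfolding draw_loop_def
  proof (rule yields_While_step[OF cond yields_draw_body[OF j, of \<rho>0, folded m_def]])
    fix m' assume "m' \<in> set_pmf (map_pmf (\<lambda>y. drawn (\<rho>0(j := y)) (j + 1)) ?U)"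
    then obtain y where "m' = drawn (\<rho>0(j := y)) (j + 1)" by auto
    then show "yields w S (7 * d + 1) (While (Binop Less (offset_exp k M) (Binop Plus (cell 0) (Const 1)))
     (Seq (Rand (entry k (cell 6) 0) (Binop Minus (cell 4) (Const 1)))
       (Seq (Store (entry k (cell 6) 0) (Binop Plus (Load (entry k (cell 6) 0)) (offset_exp k M)))
         (Store (Const 6) (Binop Plus (cell 6) (Const 1)))))) m' (Q m')"
      using IH Q unfolding draw_loop_def by metis
  qed
  moreover have "bind_pmf (map_pmf (\<lambda>y. drawn (\<rho>0(j := y)) (j + 1)) ?U) Q =
      map_pmf (\<lambda>\<rho>. drawn (\<lambda>i. if i < j then \<rho>0 i else \<rho> i) (j + Suc d))
        (Pi_pmf {j..<j + Suc d} 0 (\<lambda>_. ?U))"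
  proof -
    have ins: "{j..<j + Suc d} = insert j {j + 1..<j + 1 + d}" by auto
    have fe: "(\<lambda>i. if i < j + 1 then (\<rho>0(j := y)) i else \<rho> i) = (\<lambda>i. if i < j then \<rho>0 i else (\<rho>(j := y)) i)"
      for y \<rho> by (rule ext) auto
    have "bind_pmf (map_pmf (\<lambda>y. drawn (\<rho>0(j := y)) (j + 1)) ?U) Q = bind_pmf ?U (\<lambda>y. R (\<rho>0(j := y)))"
      by (simp only: bind_map_pmf Q)
    also have "\<dots> = bind_pmf ?U (\<lambda>y. map_pmf (\<lambda>\<rho>. drawn (\<lambda>i. if i < j then \<rho>0 i else (\<rho>(j := y)) i) (j + 1 + d))
        (Pi_pmf {j + 1..<j + 1 + d} 0 (\<lambda>_. ?U)))"
      unfolding R_def fe ..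
    also have "\<dots> = map_pmf (\<lambda>\<rho>. drawn (\<lambda>i. if i < j then \<rho>0 i else \<rho> i) (j + Suc d))
        (Pi_pmf {j..<j + Suc d} 0 (\<lambda>_. ?U))"
      unfolding ins by (subst Pi_pmf_insert') (auto simp: map_bind_pmf map_pmf_def bind_assoc_pmf bind_return_pmf)
    finally show ?thesis .
  qed
  ultimately have "yields w S (5 + (7 * d + 1) + 2) (draw_loop k M) (drawn \<rho>0 j)
      (map_pmf (\<lambda>\<rho>. drawn (\<lambda>i. if i < j then \<rho>0 i else \<rho> i) (j + Suc d))
        (Pi_pmf {j..<j + Suc d} 0 (\<lambda>_. ?U)))"
    by (simp only: m_def)
  then show ?case by (rule yields_mono) simp
qed

end

section \<open>Correctness of the tester\<close>

definition tester_alg :: "nat \<Rightarrow> nat \<Rightarrow> nat \<Rightarrow> nat \<Rightarrow> stream_alg" where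
  "tester_alg f k M B = \<lparr>word_factor = f, init_prog = setup_prog k M B,
     update_prog = edge_prog k M, post_prog = verdict_prog k M\<rparr>"

context tester
begin

lemma yields_setup_prog:
  "\<exists>t. yields w S t (setup_prog k M B) (start_memory n)
     (map_pmf (\<lambda>\<rho>. drawn \<rho> ((n div q + 1) * (M * k))) space)"
proof -
  have "yields w S (3 * q + 1) (root_loop k B) ((start_memory n)(4 := 0))
      (return_pmf ((start_memory n)(4 := q)))"
    by (rule yields_root_loop) simp
  moreover have "(start_memory n)(4 := 0) = start_memory n"
    by (auto simp: start_memory_def)
  moreover have "(start_memory n)(4 := q) = drawn (\<lambda>_. 0) 0"
    by (rule ext) (auto simp: start_memory_def drawn_def)
  ultimately have 1: "yields w S (3 * q + 1) (root_loop k B) (start_memory n)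
      (return_pmf (drawn (\<lambda>_. 0) 0))"
    by (simp only:)
  let ?J = "(n div q + 1) * (M * k)"
  have "yields w S (7 * ?J + 1) (draw_loop k M) (drawn (\<lambda>_. 0) 0)
      (map_pmf (\<lambda>\<rho>. drawn \<rho> ?J) space)"
    using yields_draw_loop[of 0 ?J "\<lambda>_. 0", OF add_0] unfolding space_def
    by (simp only: add_0 not_less0 if_False lessThan_atLeast0)
  then show ?thesis
    unfolding setup_prog_def using yields_Seq_det[OF 1] by blast
qed

lemma sample_div:
  assumes "\<rho> \<in> set_pmf space" "i \<le> n div q" "a < M * k"
  shows "sample \<rho> i a div q = i"
  using set_space[OF assms(1) entry_index_less[OF assms(2,3)]] q1 by (simp add: sample_def)

text \<open>The bridge from the probability space, which holds offsets, to the records, which hold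
  block start plus offset.\<close>

lemma hit_iff_sample: "hit \<rho> (v, a) \<longleftrightarrow> sample \<rho> (v div q) a = v"
proof -
  have "v div q * q + v mod q = v" by simp
  then show ?thesis unfolding hit_def slot_def sample_def by (metis add_left_cancel case_prod_conv fst_conv)
qed

lemma Inv_drawn: "Inv (sample \<rho>) (arcs {}) (drawn \<rho> ((n div q + 1) * (M * k)))"
  unfolding Inv_def
proof (intro conjI allI impI)
  fix i a assume ia: "i \<le> n div q" "a < M * k"
  have "(i * (M * k) + a) div (M * k) = i" using ia(2) by (rule mult_add_div)
  then show "drawn \<rho> ((n div q + 1) * (M * k)) (addr (i * (M * k) + a) 0) = sample \<rho> i a"
    using drawn_addr[of 0 \<rho> "(n div q + 1) * (M * k)" "i * (M * k) + a"] entry_index_less[OF ia]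
    unfolding sample_def by simp
  fix f assume "f \<le> k"
  then show "drawn \<rho> ((n div q + 1) * (M * k)) (addr (i * (M * k) + a) (f + 1)) =
      (\<Sum>v | (sample \<rho> i a, v) \<in> arcs {}. weight (sample \<rho>) a f v)"
    by (subst drawn_addr) (auto simp: arcs_def)
qed (auto simp: drawn_def)

context
  fixes f :: nat and alg :: stream_alg
  assumes alg: "alg = tester_alg f k M B" and w: "w = word_size alg n"
begin

text \<open>Updates draw nothing, so the final memory is a function \<open>F\<close> of the initial
  draws. The stream is fixed independently of them, so events about its graph can be analysed in
  \<open>space\<close>.\<close>

lemma memory_after_sketch:
  assumes "valid_stream n xs"
  shows "\<exists>F. memory_after alg S n xs = map_pmf F space \<and>
    (\<forall>\<rho>\<in>set_pmf space. Inv (sample \<rho>) (arcs (stream_graph xs)) (F \<rho>) \<and> F \<rho> 5 = card (stream_graph xs))"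
  using assms
proof (induction xs rule: rev_induct)
  case Nil
  obtain t where "yields w S t (setup_prog k M B) (start_memory n)
     (map_pmf (\<lambda>\<rho>. drawn \<rho> ((n div q + 1) * (M * k))) space)"
    using yields_setup_prog by blast
  then have "memory_after alg S n [] = map_pmf (\<lambda>\<rho>. drawn \<rho> ((n div q + 1) * (M * k))) space"
    unfolding memory_after_def w[symmetric] using yields_outcome by (simp add: alg tester_alg_def)
  moreover have "drawn \<rho> j 5 = 0" for \<rho> j by (simp add: drawn_def)
  ultimately show ?case using Inv_drawn unfolding stream_graph_def by auto
next
  case (snoc e xs)
  define E where "E = stream_graph xs"
  have v: "valid_stream n xs" "valid_stream_from n E [e]"
    using snoc.prems unfolding valid_stream_snoc E_def by auto
  have E: "E \<subseteq> edges_on n" unfolding E_def using v(1) by (rule stream_graph_subset)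
  obtain F where F: "memory_after alg S n xs = map_pmf F space"
    "\<And>\<rho>. \<rho> \<in> set_pmf space \<Longrightarrow> Inv (sample \<rho>) (arcs E) (F \<rho>) \<and> F \<rho> 5 = card E"
    using snoc.IH[OF v(1)] unfolding E_def by blast
  have "\<forall>\<rho>\<in>set_pmf space. \<exists>m'. outcome w S (edge_prog k M) (feed e (F \<rho>)) = return_pmf m' \<and>
      Inv (sample \<rho>) (arcs (apply_update e E)) m' \<and> m' 5 = card (apply_update e E)"
  proof
    fix \<rho> assume \<rho>: "\<rho> \<in> set_pmf space"
    show "\<exists>m'. outcome w S (edge_prog k M) (feed e (F \<rho>)) = return_pmf m' \<and>
      Inv (sample \<rho>) (arcs (apply_update e E)) m' \<and> m' 5 = card (apply_update e E)"
      using yields_edge_prog[of "sample \<rho>" E "F \<rho>" e] F(2)[OF \<rho>] sample_div[OF \<rho>] E v(2)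
        yields_outcome by blast
  qed
  then obtain G where G: "\<And>\<rho>. \<rho> \<in> set_pmf space \<Longrightarrow>
      outcome w S (edge_prog k M) (feed e (F \<rho>)) = return_pmf (G \<rho>) \<and>
      Inv (sample \<rho>) (arcs (apply_update e E)) (G \<rho>) \<and> G \<rho> 5 = card (apply_update e E)"
    unfolding bchoice_iff by blast
  have "memory_after alg S n (xs @ [e]) =
      bind_pmf (memory_after alg S n xs) (\<lambda>m. outcome w S (edge_prog k M) (feed e m))"
    unfolding memory_after_def w[symmetric] by (simp add: alg tester_alg_def)
  also have "\<dots> = bind_pmf space (\<lambda>\<rho>. outcome w S (edge_prog k M) (feed e (F \<rho>)))"
    by (simp add: F(1) bind_map_pmf)
  also have "\<dots> = bind_pmf space (\<lambda>\<rho>. return_pmf (G \<rho>))"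
    using G by (intro bind_pmf_cong) auto
  finally have "memory_after alg S n (xs @ [e]) = map_pmf G space" by (simp add: map_pmf_def)
  then show ?case using G unfolding stream_graph_snoc E_def by blast
qed

lemma runs_within_tester:
  assumes "0 < f"
  shows "runs_within alg n S (5 * (n div q) + 20)"
  unfolding runs_within_def w[symmetric]
proof (intro conjI allI impI ballI)
  show "4 \<le> S" using S_ge by simp
  show "0 < word_factor alg" using assms by (simp add: alg tester_alg_def)
  show "\<exists>t. halts_within w S t (init_prog alg) (start_memory n)"
    using yields_setup_prog yields_halts unfolding alg tester_alg_def stream_alg.simps by blast
next
  fix xs e m assume v: "valid_stream n (xs @ [e])" and m: "m \<in> set_pmf (memory_after alg S n xs)"
  then have v': "valid_stream n xs" "valid_stream_from n (stream_graph xs) [e]"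
    unfolding valid_stream_snoc by auto
  obtain \<rho> where \<rho>: "\<rho> \<in> set_pmf space" "Inv (sample \<rho>) (arcs (stream_graph xs)) m" "m 5 = card (stream_graph xs)"
    using memory_after_sketch[OF v'(1)] m by auto
  show "\<exists>t. halts_within w S t (update_prog alg) (feed e m)"
    using yields_edge_prog[OF \<rho>(2) sample_div[OF \<rho>(1)] stream_graph_subset[OF v'(1)] \<rho>(3) v'(2)] yields_halts
    unfolding alg tester_alg_def stream_alg.simps by blast
next
  fix xs m assume v: "valid_stream n xs" and m: "m \<in> set_pmf (memory_after alg S n xs)"
  obtain \<rho> where \<rho>: "\<rho> \<in> set_pmf space" "Inv (sample \<rho>) (arcs (stream_graph xs)) m" "m 5 = card (stream_graph xs)"
    using memory_after_sketch[OF v] m by auto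
  then have "m 5 \<le> n * n" using card_edges_le[OF stream_graph_subset[OF v]] by simp
  from yields_verdict_prog[OF \<rho>(2) this]
  show "halts_within w S (5 * (n div q) + 20) (post_prog alg) m"
    using yields_halts by (auto simp: alg tester_alg_def)
qed

lemma verdict_tester:
  assumes v: "valid_stream n xs"
  shows "\<exists>acc. verdict alg S n xs = map_pmf acc space \<and>
    (connected_graph n (stream_graph xs) \<longrightarrow> (\<forall>\<rho>\<in>set_pmf space. acc \<rho>)) \<and>
    (\<not> connected_graph n (stream_graph xs) \<longrightarrow> (\<forall>\<rho>\<in>set_pmf space.
      card (stream_graph xs) + 1 < n \<or>
      (\<exists>g<M. \<exists>C\<in>{C \<in> graph_components n (stream_graph xs). card C \<le> k}. good k \<rho> g C) \<longrightarrow> \<not> acc \<rho>))"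
proof -
  define E where "E = stream_graph xs"
  have E: "E \<subseteq> edges_on n" unfolding E_def using v by (rule stream_graph_subset)
  obtain F where F: "memory_after alg S n xs = map_pmf F space"
    "\<And>\<rho>. \<rho> \<in> set_pmf space \<Longrightarrow> Inv (sample \<rho>) (arcs E) (F \<rho>) \<and> F \<rho> 5 = card E"
    using memory_after_sketch[OF v] unfolding E_def by blast
  define found where
    "found \<rho> \<longleftrightarrow> (\<exists>m'' g. Inv (sample \<rho>) (arcs E) m'' \<and> g < M \<and> eval w (check_exp k M g) m'' \<noteq> 0)" for \<rho>
  define sure where
    "sure \<rho> i \<longleftrightarrow> (\<forall>m''. Inv (sample \<rho>) (arcs E) m'' \<longrightarrow> m'' 6 = i \<longrightarrow>
        (\<exists>g<M. eval w (check_exp k M g) m'' \<noteq> 0))" for \<rho> i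
  have "\<forall>\<rho>\<in>set_pmf space. \<exists>m'. outcome w S (verdict_prog k M) (F \<rho>) = return_pmf m' \<and>
      (m' 0 = 0 \<longrightarrow> card E + 1 < n \<or> found \<rho>) \<and> (card E + 1 < n \<or> (\<exists>i\<le>n div q. sure \<rho> i) \<longrightarrow> m' 0 = 0)"
  proof
    fix \<rho> assume \<rho>: "\<rho> \<in> set_pmf space"
    have "F \<rho> 5 \<le> n * n" using F(2)[OF \<rho>] card_edges_le[OF E] by simp
    from yields_verdict_prog[OF conjunct1[OF F(2)[OF \<rho>]] this]
    show "\<exists>m'. outcome w S (verdict_prog k M) (F \<rho>) = return_pmf m' \<and>
      (m' 0 = 0 \<longrightarrow> card E + 1 < n \<or> found \<rho>) \<and> (card E + 1 < n \<or> (\<exists>i\<le>n div q. sure \<rho> i) \<longrightarrow> m' 0 = 0)"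
      unfolding conjunct2[OF F(2)[OF \<rho>]] found_def[symmetric] sure_def[symmetric]
      by (elim exE conjE) (intro exI conjI, erule yields_outcome, assumption+)
  qed
  then obtain G where G: "\<forall>\<rho>\<in>set_pmf space. outcome w S (verdict_prog k M) (F \<rho>) = return_pmf (G \<rho>) \<and>
      (G \<rho> 0 = 0 \<longrightarrow> card E + 1 < n \<or> found \<rho>) \<and> (card E + 1 < n \<or> (\<exists>i\<le>n div q. sure \<rho> i) \<longrightarrow> G \<rho> 0 = 0)"
    unfolding bchoice_iff by blast
  define acc where "acc \<rho> \<longleftrightarrow> G \<rho> 0 \<noteq> 0" for \<rho>
  have "verdict alg S n xs = bind_pmf space (\<lambda>\<rho>. map_pmf (\<lambda>m'. m' 0 \<noteq> 0) (outcome w S (verdict_prog k M) (F \<rho>)))"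
    unfolding verdict_def w[symmetric] F(1) by (simp add: bind_map_pmf alg tester_alg_def)
  also have "\<dots> = bind_pmf space (\<lambda>\<rho>. return_pmf (acc \<rho>))"
    using G by (intro bind_pmf_cong) (auto simp: acc_def)
  finally have V: "verdict alg S n xs = map_pmf acc space" by (simp add: map_pmf_def)
  have conn: "acc \<rho>" if "connected_graph n E" "\<rho> \<in> set_pmf space" for \<rho>
  proof (rule ccontr)
    assume "\<not> acc \<rho>"
    then have "G \<rho> 0 = 0" by (simp add: acc_def)
    then have "card E + 1 < n \<or> found \<rho>" using bspec[OF G that(2)] by simp
    then consider "card E + 1 < n" | m'' g where "Inv (sample \<rho>) (arcs E) m''" "g < M" "eval w (check_exp k M g) m'' \<noteq> 0"
      unfolding found_def by blast
    then show False
    proof cases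
      case 1
      then show False using connected_graph_card_edges[OF that(1) E] by simp
    next
      case 2
      then show False
        using cert_imp_not_connected[OF _ E] eval_cert_exp[OF 2(1,2)] that(1) unfolding check_exp_def by blast
    qed
  qed
  have disc: "\<not> acc \<rho>" if nc: "\<not> connected_graph n E" and \<rho>: "\<rho> \<in> set_pmf space"
    and g: "card E + 1 < n \<or> (\<exists>g<M. \<exists>C\<in>{C \<in> graph_components n E. card C \<le> k}. good k \<rho> g C)" for \<rho>
    using g
  proof
    assume "card E + 1 < n"
    then show ?thesis using bspec[OF G \<rho>] by (simp add: acc_def)
  next
    assume "\<exists>g<M. \<exists>C\<in>{C \<in> graph_components n E. card C \<le> k}. good k \<rho> g C"
    then obtain g C where gC: "g < M" "C \<in> graph_components n E" "card C \<le> k" "good k \<rho> g C" by blast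
    have hits: "sample \<rho> (sorted_list_of_set C ! j div q) (g * k + b) = sorted_list_of_set C ! j \<longleftrightarrow> j = b"
      if "j < card C" "b < k" for j b
      using gC(4) that unfolding good_def hit_iff_sample by blast
    define i where "i = sorted_list_of_set C ! 0 div q"
    have pos: "0 < card C" using card_component[OF gC(2)] by simp
    \<comment> \<open>A component with \<open>n\<close> vertices would be the whole vertex set and
      make the graph connected; the certificate needs a proper subset.\<close>
    have Cn: "card C < n"
    proof (rule ccontr)
      assume "\<not> card C < n"
      then have "C = {1..n}"
        using component_subset[OF gC(2)] by (intro card_seteq) auto
      then show False
        using nc component_reach[OF gC(2)] unfolding connected_graph_iff_arcs by blast
    qed
    have "sorted_list_of_set C ! 0 \<le> n"
      using vertex_bounds[OF E gC(2,3,1) hits pos] by (simp add: vertex_def[OF E gC(2,3,1) hits])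
    then have i: "i \<le> n div q" unfolding i_def by (rule div_le_mono)
    have check: "eval w (check_exp k M g) m'' \<noteq> 0" if "Inv (sample \<rho>) (arcs E) m''" "m'' 6 = i" for m''
      using eval_check_component[OF E gC(2,3,1) hits that(1) _ Cn] that(2)
      by (simp add: i_def vertex_def[OF E gC(2,3,1) hits])
    have "sure \<rho> i" unfolding sure_def using check gC(1) by blast
    then have "\<exists>i\<le>n div q. sure \<rho> i" using i by (intro exI conjI)
    then have "G \<rho> 0 = 0" using bspec[OF G \<rho>] by (elim conjE mp) (rule disjI2)
    then show ?thesis by (simp add: acc_def)
  qed
  show ?thesis
    by (intro exI[of _ acc] conjI impI ballI V) (simp_all only: E_def[symmetric] conn disc not_False_eq_True)
qed

text \<open>\<open>large\<close> weighs the lower bound on the number of small components against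
  \<open>q ^ k\<close>; its factor \<open>k\<close> stems from \<open>many_small_components\<close>
  and cancels. Acceptance of connected graphs even has probability 1.\<close>

lemma tester_correct:
  assumes v: "valid_stream n xs" and \<epsilon>: "\<epsilon> > 0" and q: "16 * k * k \<le> q"
    and large: "16 / 5 * real k * real q ^ k \<le> real M * (((real k + 1) * \<epsilon> - 1) * real n)"
  shows "connected_graph n (stream_graph xs) \<Longrightarrow> pmf (verdict alg S n xs) True \<ge> 2 / 3"
    and "far_from connected_graph \<epsilon> n (stream_graph xs) \<Longrightarrow> pmf (verdict alg S n xs) False \<ge> 2 / 3"
proof -
  define E where "E = stream_graph xs"
  have E: "E \<subseteq> edges_on n" unfolding E_def using v by (rule stream_graph_subset)
  obtain acc where V: "verdict alg S n xs = map_pmf acc space"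
    and conn: "connected_graph n E \<longrightarrow> (\<forall>\<rho>\<in>set_pmf space. acc \<rho>)"
    and disc: "\<not> connected_graph n E \<longrightarrow> (\<forall>\<rho>\<in>set_pmf space. card E + 1 < n \<or>
      (\<exists>g<M. \<exists>C\<in>{C \<in> graph_components n E. card C \<le> k}. good k \<rho> g C) \<longrightarrow> \<not> acc \<rho>)"
    using verdict_tester[OF v] unfolding E_def by blast
  have pmfV: "pmf (verdict alg S n xs) y = measure_pmf.prob space {\<rho>. acc \<rho> = y}" for y
    unfolding V pmf_map by (simp add: vimage_def)
  show "pmf (verdict alg S n xs) True \<ge> 2 / 3" if "connected_graph n (stream_graph xs)"
  proof -
    have "measure_pmf.prob space {\<rho>. acc \<rho> = True} = 1"
      using conn that unfolding E_def by (subst measure_pmf.prob_eq_1) (auto simp: AE_measure_pmf_iff)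
    then show ?thesis unfolding pmfV by simp
  qed
  show "pmf (verdict alg S n xs) False \<ge> 2 / 3" if far: "far_from connected_graph \<epsilon> n (stream_graph xs)"
  proof -
    have far: "far_from connected_graph \<epsilon> n E" using far by (simp add: E_def)
    have nc: "\<not> connected_graph n E"
    proof
      assume "connected_graph n E"
      then have "real (card ((E - E) \<union> (E - E))) > \<epsilon> * real (card E)"
        using far E unfolding far_from_def by blast
      then show False using \<epsilon> by (simp add: mult_less_0_iff)
    qed
    show ?thesis
    proof (cases "card E + 1 < n")
      case True
      then have "measure_pmf.prob space {\<rho>. acc \<rho> = False} = 1"
        using disc nc by (subst measure_pmf.prob_eq_1) (auto simp: AE_measure_pmf_iff)
      then show ?thesis unfolding pmfV by simp
    next
      case False
      define Q where "Q = {C \<in> graph_components n E. card C \<le> k}"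
      have "((real k + 1) * \<epsilon> - 1) * real n \<le> real k * real (card Q)"
        unfolding Q_def using many_small_components(2)[OF far E n1 _ \<epsilon> k1] False by simp
      then have "real M * (((real k + 1) * \<epsilon> - 1) * real n) \<le> real M * (real k * real (card Q))"
        by (intro mult_left_mono) auto
      then have "16 / 5 * real k * real q ^ k \<le> real M * (real k * real (card Q))"
        using large by (rule order.trans[rotated])
      then have "real k * (16 / 5 * real q ^ k) \<le> real k * (real M * real (card Q))"
        by (simp add: mult_ac)
      then have large': "16 / 5 * real q ^ k \<le> real M * real (card Q)"
        using k1 by (simp add: mult_le_cancel_left_pos)
      have "2 / 3 \<le> measure_pmf.prob space {\<rho>. \<exists>g<M. \<exists>C\<in>Q. good k \<rho> g C}"
      proof (rule prob_exists_good[OF refl])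
        show "finite Q" using finite_components by (simp add: Q_def)
        show "C \<subseteq> {1..n}" if "C \<in> Q" for C using that component_subset unfolding Q_def by blast
        show "card C \<le> k" if "C \<in> Q" for C using that by (simp add: Q_def)
        show "C \<inter> C' = {}" if "C \<in> Q" "C' \<in> Q" "C \<noteq> C'" for C C'
          using that components_disjoint[of C n E C'] by (simp add: Q_def)
      qed (rule q, rule large')
      \<comment> \<open>\<open>disc\<close> speaks about the support only, and intersecting with it
        leaves the probability unchanged.\<close>
      also have "\<dots> = measure_pmf.prob space ({\<rho>. \<exists>g<M. \<exists>C\<in>Q. good k \<rho> g C} \<inter> set_pmf space)"
        by (simp add: measure_Int_set_pmf)
      also have "\<dots> \<le> measure_pmf.prob space {\<rho>. acc \<rho> = False}"
        using disc nc by (intro measure_pmf.finite_measure_mono) (auto simp: Q_def)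
      finally show ?thesis unfolding pmfV .
    qed
  qed
qed

end

end

section \<open>Space and time\<close>

text \<open>The factor of \<open>n\<close> under the \<open>k\<close>-th root. This value gives
  \<open>16 * k * k \<le> block_length k n\<close> already for \<open>n = 1\<close>, as the second
  moment bound requires.\<close>

definition root_bound :: "nat \<Rightarrow> nat" where
  "root_bound k = (16 * k * k) ^ k"

definition block_length :: "nat \<Rightarrow> nat \<Rightarrow> nat" where
  "block_length k n = (LEAST q. root_bound k * n < (q + 1) ^ k)"

lemma block_length:
  assumes k: "1 \<le> k" and n: "1 \<le> n"
  shows "root_bound k * n < (block_length k n + 1) ^ k"
    and "q' < block_length k n \<Longrightarrow> (q' + 1) ^ k \<le> root_bound k * n"
    and "16 * k * k \<le> block_length k n"
    and "block_length k n ^ k \<le> root_bound k * n"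
    and "block_length k n \<le> root_bound k * n"
proof -
  let ?q = "block_length k n" and ?B = "root_bound k"
  have "?B * n + 1 \<le> (?B * n + 1) ^ k" using power_increasing[of 1 k "?B * n + 1"] k by simp
  then have "?B * n < (?B * n + 1) ^ k" by linarith
  then show root: "?B * n < (?q + 1) ^ k" unfolding block_length_def by (rule LeastI)
  show le: "(q' + 1) ^ k \<le> ?B * n" if "q' < ?q" for q'
    using not_less_Least[OF that[unfolded block_length_def]] by simp
  show ge: "16 * k * k \<le> ?q"
  proof (rule ccontr)
    assume "\<not> 16 * k * k \<le> ?q"
    then have "(?q + 1) ^ k \<le> ?B" unfolding root_bound_def by (intro power_mono) auto
    also have "\<dots> \<le> ?B * n" using n by simp
    finally show False using root by simp
  qed
  then have q1: "1 \<le> ?q" using k by (cases "?q") auto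
  then show qk: "?q ^ k \<le> ?B * n" using le[of "?q - 1"] by simp
  have "?q \<le> ?q ^ k" using power_increasing[of 1 k ?q] k q1 by simp
  then show "?q \<le> ?B * n" using qk by simp
qed

text \<open>From \<open>n \<le> (q + 1) ^ k\<close> the \<open>k\<close>-th root of \<open>n\<close>
  is at most \<open>q + 1 \<le> 2 * q\<close>, so dividing \<open>n\<close> by \<open>q\<close>
  instead of by its root costs a factor of at most 2.\<close>

lemma blocks_bound:
  assumes k: "1 \<le> k" and n: "1 \<le> n"
  shows "real (n div block_length k n) \<le> 2 * real n powr (1 - 1 / real k)"
proof -
  let ?q = "block_length k n"
  have q1: "1 \<le> ?q" using block_length(3)[OF assms] k by (cases "?q") auto
  have "1 \<le> root_bound k" using k by (simp add: root_bound_def)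
  then have "1 * n \<le> root_bound k * n" by (rule mult_le_mono1)
  then have "n \<le> (?q + 1) ^ k" using block_length(1)[OF assms] by linarith
  then have "real n \<le> (real ?q + 1) ^ k"
    by (metis of_nat_1 of_nat_add of_nat_le_iff of_nat_power)
  also have "\<dots> = (real ?q + 1) powr real k" by (simp add: powr_realpow)
  finally have "real n powr (1 / real k) \<le> ((real ?q + 1) powr real k) powr (1 / real k)"
    by (intro powr_mono2) auto
  also have "\<dots> = real ?q + 1" using k by (simp add: powr_powr)
  also have "\<dots> \<le> 2 * real ?q" using q1 by simp
  finally have nq: "real n powr (1 / real k) \<le> 2 * real ?q" .
  have "real (n div ?q) \<le> real n / real ?q" by (rule of_nat_div_le_of_nat)
  also have "real n = real n powr (1 - 1 / real k) * real n powr (1 / real k)"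
    using n by (simp add: powr_add[symmetric])
  also have "\<dots> / real ?q \<le> real n powr (1 - 1 / real k) * (2 * real ?q) / real ?q"
    using nq by (intro divide_right_mono mult_left_mono) auto
  also have "\<dots> = 2 * real n powr (1 - 1 / real k)" using q1 by simp
  finally show ?thesis .
qed

text \<open>The summands are coefficients that suffice for every word-size condition of
  \<open>tester\<close> once the terms are bounded by multiples of
  \<open>(n + 1)\<^sup>2\<close>.\<close>

definition word_const :: "nat \<Rightarrow> nat \<Rightarrow> nat" where
  "word_const k M = 30 + 2 * (M * k * (k + 2)) + 2 * k + 3 * root_bound k + M + 2 ^ k * root_bound k"

definition space_words :: "nat \<Rightarrow> nat \<Rightarrow> nat \<Rightarrow> nat" where
  "space_words k M n = 8 + (n div block_length k n + 1) * (M * k) * (k + 2)"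

text \<open>For \<open>K = word_const k M\<close>, \<open>K < 2 ^ K\<close> absorbs the constant and
  \<open>n + 1 \<le> 2 ^ floorlog 2 n\<close> the square, hence the factor \<open>K + 2\<close>; as
  \<open>floorlog 2 n \<ge> 1\<close>, \<open>K\<close> multiples of it provide \<open>K\<close>
  bits.\<close>

lemma word_const_less:
  assumes "1 \<le> n"
  shows "word_const k M * (n + 1)\<^sup>2 < 2 ^ ((word_const k M + 2) * floorlog 2 n)"
proof -
  let ?K = "word_const k M" and ?L = "floorlog 2 n"
  have L: "1 \<le> ?L" using assms by (simp add: floorlog_def)
  have "n + 1 \<le> 2 ^ ?L" using floorlog_bounds[of n 2] assms by simp
  then have "(n + 1)\<^sup>2 \<le> (2 ^ ?L)\<^sup>2" by (rule power_mono) simp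
  then have "?K * (n + 1)\<^sup>2 \<le> ?K * (2 ^ ?L)\<^sup>2" by (rule mult_le_mono2)
  also have "\<dots> < 2 ^ ?K * (2 ^ ?L)\<^sup>2" by (intro mult_strict_right_mono less_exp) simp
  also have "\<dots> = 2 ^ (?K + 2 * ?L)" by (simp add: power_add power_mult[symmetric] mult.commute)
  also have "\<dots> \<le> 2 ^ ((?K + 2) * ?L)"
  proof (rule power_increasing)
    have "?K * 1 \<le> ?K * ?L" using L by (rule mult_le_mono2)
    then show "?K + 2 * ?L \<le> (?K + 2) * ?L" by (simp add: algebra_simps)
  qed simp
  finally show ?thesis .
qed

lemma tester_block_length:
  assumes k: "1 \<le> k" and M: "1 \<le> M" and n: "1 \<le> n"
  shows "tester k M n (block_length k n) ((word_const k M + 2) * floorlog 2 n) (space_words k M n)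
    (root_bound k)"
proof
  let ?q = "block_length k n" and ?B = "root_bound k" and ?A = "M * k * (k + 2)"
  let ?P = "(n + 1)\<^sup>2" and ?w = "(word_const k M + 2) * floorlog 2 n"
  note W = word_const_less[OF n, of k M]
  have W': "30 * ?P + 2 * (?A * ?P) + 2 * (k * ?P) + 3 * (?B * ?P) + M * ?P + 2 ^ k * ?B * ?P < 2 ^ ?w"
    using W by (simp add: word_const_def algebra_simps)
  have P: "1 \<le> ?P" "n \<le> ?P" "n * n \<le> ?P" by (auto simp: power2_eq_square)
  have q1: "1 \<le> ?q" using block_length(3)[OF k n] k by (cases "?q") auto
  have kP: "k \<le> k * ?P" "M \<le> M * ?P" "?B \<le> ?B * ?P" using P(1) by simp_all
  have BnP: "?B * n \<le> ?B * ?P" using P(2) by (rule mult_le_mono2)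
  show "1 \<le> k" "1 \<le> n" "1 \<le> ?q" "1 \<le> M" using k n q1 M by auto
  show "8 + (n div ?q + 2) * (M * k) * (k + 2) + (k + 2) < 2 ^ ?w"
  proof -
    have "n + 2 \<le> 2 * ?P" by (simp add: power2_eq_square)
    then have "n div ?q + 2 \<le> 2 * ?P" using div_le_dividend[of n ?q] by linarith
    then have "(n div ?q + 2) * ?A \<le> 2 * ?P * ?A" by (rule mult_le_mono1)
    then have "(n div ?q + 2) * (M * k) * (k + 2) \<le> 2 * (?A * ?P)" by (simp only: mult_ac)
    then show ?thesis using W' kP P by linarith
  qed
  show "2 * n * n + 4 * n + ?q + M + k + 8 < 2 ^ ?w"
    using W' kP P BnP block_length(5)[OF k n] by linarith
  show "space_words k M n = 8 + (n div ?q + 1) * (M * k) * (k + 2)"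
    by (simp add: space_words_def)
  show "(q' + 1) ^ k \<le> ?B * n" if "q' < ?q" for q' using block_length(2)[OF k n that] .
  show "?B * n < (?q + 1) ^ k" using block_length(1)[OF k n] .
  show "(?q + 1) ^ k + ?B * n + ?B + 1 < 2 ^ ?w"
  proof -
    \<comment> \<open>Origin of the summand \<open>2 ^ k * root_bound k\<close> in
      \<open>word_const\<close>: the last power tested by the root search exceeds
      \<open>root_bound k * n\<close>, but by at most a factor \<open>2 ^ k\<close>.\<close>
    have "(?q + 1) ^ k \<le> (2 * ?q) ^ k" using q1 by (intro power_mono) auto
    also have "\<dots> = 2 ^ k * ?q ^ k" by (rule power_mult_distrib)
    also have "\<dots> \<le> 2 ^ k * (?B * n)" using block_length(4)[OF k n] by (rule mult_le_mono2)
    also have "\<dots> \<le> 2 ^ k * (?B * ?P)" using BnP by (rule mult_le_mono2)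
    also have "\<dots> = 2 ^ k * ?B * ?P" by (simp add: mult_ac)
    finally show ?thesis using W' kP P BnP by linarith
  qed
qed

theorem theorem4p1:
  fixes \<epsilon> :: real
  assumes "\<epsilon> > 0"
  shows "\<exists>A S T. dynamic_streaming_tester connected_graph \<epsilon> A S T \<and>
           (\<lambda>n. real (space_bits A S n)) \<in> soft_O (\<lambda>n. max 1 (real n powr (1 - \<epsilon>))) \<and>
           (\<lambda>n. real (T n)) \<in> soft_O (\<lambda>n. max 1 (real n powr (1 - \<epsilon>)))"
proof -
  \<comment> \<open>The floor gives \<open>(k + 1) * \<epsilon> > 1\<close>, which leaves linearly
    many small components, and for \<epsilon> \<le> 1 also \<open>k \<le> 1 / \<epsilon>\<close>,
    which keeps the number of blocks within the bound. For \<epsilon> > 1 the floor is 0, and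
    \<open>k = 1\<close> leaves a constant number of blocks.\<close>
  define k where "k = max 1 (nat \<lfloor>1 / \<epsilon>\<rfloor>)"
  define g where "g n = max 1 (real n powr (1 - \<epsilon>))" for n :: nat
  define \<delta> where "\<delta> = (real k + 1) * \<epsilon> - 1"
  have k: "1 \<le> k" by (simp add: k_def)
  have "1 / \<epsilon> < real k + 1" unfolding k_def by linarith
  then have \<delta>: "\<delta> > 0" using assms by (simp add: \<delta>_def field_simps)
  have g: "real n powr (1 - 1 / real k) \<le> g n" if "1 \<le> n" for n
  proof (cases "k = 1")
    case True
    then show ?thesis by (simp add: g_def)
  next
    case False
    then have "real k = of_int \<lfloor>1 / \<epsilon>\<rfloor>" using k by (auto simp: k_def max_def split: if_splits)
    then have "real k \<le> 1 / \<epsilon>" by linarith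
    then have "\<epsilon> \<le> 1 / real k" using assms k by (simp add: field_simps)
    then have "real n powr (1 - 1 / real k) \<le> real n powr (1 - \<epsilon>)"
      using that by (intro powr_mono) auto
    then show ?thesis by (simp add: g_def)
  qed
  \<comment> \<open>Together with \<open>q ^ k \<le> root_bound k * n\<close> this makes
    \<open>M * \<delta> * n\<close> at least \<open>16 / 5 * k * q ^ k\<close>, which is the
    hypothesis \<open>large\<close> of \<open>tester_correct\<close>.\<close>
  define M where "M = nat \<lceil>16 / 5 * real k * real (root_bound k) / \<delta>\<rceil> + 1"
  have M1: "1 \<le> M" by (simp add: M_def)
  have "16 / 5 * real k * real (root_bound k) / \<delta> \<le> real M" unfolding M_def by linarith
  then have M: "16 / 5 * real k * real (root_bound k) \<le> real M * \<delta>"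
    using \<delta> by (simp add: field_simps)
  define A where "A = tester_alg (word_const k M + 2) k M (root_bound k)"
  define S where "S = space_words k M"
  define T where "T n = 5 * (n div block_length k n) + 20" for n
  have wA: "word_size A n = (word_const k M + 2) * floorlog 2 n" for n
    by (simp add: A_def tester_alg_def word_size_def)
  have "dynamic_streaming_tester connected_graph \<epsilon> A S T"
    unfolding dynamic_streaming_tester_def
  proof (intro allI impI)
    fix n :: nat assume n: "1 \<le> n"
    interpret tester k M n "block_length k n" "(word_const k M + 2) * floorlog 2 n" "S n" "root_bound k"
      unfolding S_def using tester_block_length[OF k M1 n] .
    have "real (block_length k n ^ k) \<le> real (root_bound k * n)"
      using block_length(4)[OF k n] by (rule of_nat_mono)
    then have "16 / 5 * real k * real (block_length k n) ^ k \<le> 16 / 5 * real k * (real (root_bound k) * real n)"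
      by (intro mult_left_mono) auto
    also have "\<dots> = 16 / 5 * real k * real (root_bound k) * real n" by simp
    also have "\<dots> \<le> real M * \<delta> * real n" using M by (rule mult_right_mono) simp
    finally have large: "16 / 5 * real k * real (block_length k n) ^ k \<le>
        real M * (((real k + 1) * \<epsilon> - 1) * real n)"
      by (simp add: \<delta>_def mult.assoc)
    note correct = tester_correct[OF A_def wA[symmetric] _ assms block_length(3)[OF k n] large]
    have "runs_within A n (S n) (T n)"
      unfolding T_def by (rule runs_within_tester[OF A_def wA[symmetric]]) simp
    then show "runs_within A n (S n) (T n) \<and>
      (\<forall>xs. valid_stream n xs \<longrightarrow>
         (connected_graph n (stream_graph xs) \<longrightarrow> 2 / 3 \<le> pmf (verdict A (S n) n xs) True) \<and>
         (far_from connected_graph \<epsilon> n (stream_graph xs) \<longrightarrow> 2 / 3 \<le> pmf (verdict A (S n) n xs) False))"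
      using correct by blast
  qed
  moreover have blocks: "real (n div block_length k n) \<le> 2 * g n" if "1 \<le> n" for n
    using blocks_bound[OF k that] g[OF that] by simp
  have g1: "1 \<le> g n" for n by (simp add: g_def)
  have "(\<lambda>n. real (T n)) \<in> soft_O g"
  proof -
    have "(\<lambda>n. real (T n)) \<in> O(\<lambda>n. g n * ln (real n) ^ 0)"
    \<comment> \<open>\<open>5 * (2 * g n) + 20 \<le> 30 * g n\<close>, since
      \<open>g n \<ge> 1\<close>.\<close>
    proof (rule bigoI[where c = 30])
      show "\<forall>\<^sub>F n in sequentially. norm (real (T n)) \<le> 30 * norm (g n * ln (real n) ^ 0)"
        using eventually_ge_at_top[of 1]
      proof eventually_elim
        case (elim n)
        show ?case using blocks[OF elim] g1[of n] by (simp add: T_def)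
      qed
    qed
    then show ?thesis unfolding soft_O_def by blast
  qed
  moreover have "(\<lambda>n. real (space_bits A S n)) \<in> soft_O g"
  proof -
    define a where "a = real (M * k * (k + 2))"
    define f where "f = real (word_const k M + 2)"
    define c where "c = (8 + 3 * a) * (f * (1 / ln 2 + 1))"
    have "(\<lambda>n. real (space_bits A S n)) \<in> O(\<lambda>n. g n * ln (real n) ^ 1)"
    proof (rule bigoI[where c = c])
      show "\<forall>\<^sub>F n in sequentially. norm (real (space_bits A S n)) \<le> c * norm (g n * ln (real n) ^ 1)"
        using eventually_ge_at_top[of 3]
      proof eventually_elim
        case (elim n)
        then have n: "1 \<le> n" by simp
        \<comment> \<open>The threshold 3 exceeds e, so the logarithm is at least 1 and absorbs the
          additive 1 from rounding in \<open>floorlog\<close>.\<close>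
        have "exp 1 \<le> real n" using exp_le elim by linarith
        then have ln1: "1 \<le> ln (real n)" using n by (simp add: ln_ge_iff)
        have "real (floorlog 2 n) \<le> log 2 (real n) + 1"
          using n by (simp add: floorlog_def)
        also have "\<dots> \<le> (1 / ln 2 + 1) * ln (real n)" using ln1 by (simp add: log_def algebra_simps)
        finally have fl: "real (floorlog 2 n) \<le> (1 / ln 2 + 1) * ln (real n)" .
        have "real (S n) = 8 + (real (n div block_length k n) + 1) * a"
          by (simp add: S_def space_words_def a_def algebra_simps)
        also have "\<dots> \<le> 8 * g n + (2 * g n + g n) * a"
          using g1[of n] blocks[OF n] by (intro add_mono mult_right_mono) (auto simp: a_def)
        also have "\<dots> = (8 + 3 * a) * g n" by (simp add: algebra_simps)
        finally have Sn: "real (S n) \<le> (8 + 3 * a) * g n" .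
        have "real (space_bits A S n) = real (S n) * (f * real (floorlog 2 n))"
          unfolding space_bits_def wA f_def by (simp only: of_nat_mult)
        also have "\<dots> \<le> (8 + 3 * a) * g n * (f * ((1 / ln 2 + 1) * ln (real n)))"
          using Sn fl g1[of n] by (intro mult_mono) (auto simp: a_def f_def)
        also have "\<dots> = c * (g n * ln (real n))" by (simp add: c_def mult_ac)
        finally show ?case using g1[of n] ln1 by simp
      qed
    qed
    then show ?thesis unfolding soft_O_def by blast
  qed
  ultimately show ?thesis unfolding g_def[abs_def] by blast
qed

end
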